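(* Let $H$ be a hypergroup. Suppose that there is a non-zero $f\in C_C(H)^+$ such that $H$ has the positivity property of translations of $f$, i.e. for all $\mu,\nu\in M^+(H)$, $$\mu\ast f\le\nu\ast f \text{ pointwise on } H\ \Longrightarrow\ \|\mu\|\le\|\nu\|.$$ Suppose also that $WUCB_r(H)$ has a left invariant mean. Then $H$ has a left Haar measure.
   Context: Hypergroup: a non-empty locally compact Hausdorff space $H$ such that: (1) there is a binary operation $\ast$ (convolution) on the vector space $M(H)$ of bounded complex regular Borel (Radon) measures making it an algebra (as usual, convolution is determined by its values on point masses: $\mu\ast\nu=\int\int \delta_x\ast\delta_y\,d\mu(x)\,d\nu(y)$ weakly); (2) for $x,y\in H$, $\delta_x\ast\delta_y$ is a probability measure with compact support; (3) the map $(x,y)\mapsto\delta_x\ast\delta_y$ from $H\times H$ to the compactly supported probability measures is continuous (for the weak topology given by integration against bounded continuous functions); (4) the map $(x,y)\mapsto \mathrm{supp}(\delta_x\ast\delta_y)$ is continuous into the space of non-empty compact subsets of $H$ with the Michael topology (generated by the sets $\{C: C\cap U\neq\emptyset,\ C\subset V\}$, $U,V\subset H$ open); (5) there is a unique $e\in H$ with $\delta_x\ast\delta_e=\delta_e\ast\delta_x=\delta_x$ for all $x\in H$; (6) there is a homeomorphism $x\mapsto\check{x}$ of $H$ with $\check{\check{x}}=x$ which, extended to $M(H)$ by $\check{\mu}(A)=\mu(\{x\in H:\check{x}\in A\})$, satisfies $(\mu\ast\nu)\check{}=\check{\nu}\ast\check{\mu}$; (7) for $x,y\in H$, $e\in\mathrm{supp}(\delta_x\ast\delta_y)$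 if and only if $y=\check{x}$. $C(H)$ is the space of bounded continuous complex-valued functions on $H$ with the supremum norm; $C_C(H)$ is the subspace of compactly supported functions; $C_C(H)^+$ is the set of functions in $C_C(H)$ with non-negative real values. $M^+(H)$ is the set of non-negative measures in $M(H)$, and $\|\mu\|$ is the total variation norm (so $\|\mu\|=\mu(H)$ for $\mu\in M^+(H)$). For $\mu\in M(H)$ and $f\in C(H)$, $(\mu\ast f)(y)=\int_H\int_H f\,d(\delta_{\check{x}}\ast\delta_y)\,d\mu(x)$; in particular $(\delta_x\ast f)(y)=\int_H f\,d(\delta_{\check{x}}\ast\delta_y)$. $WUCB_r(H)$ is the space of $f\in C(H)$ such that $H\ni x\mapsto\delta_x\ast f\in C(H)$ is continuous for the weak topology $\sigma(C(H),C(H)^* )$ on $C(H)$. A left invariant mean on $WUCB_r(H)$ is a linear functional $m$ on it with $\|m\|=m(1)=1$ and $m(\delta_x\ast f)=m(f)$ for all $f\in WUCB_r(H)$, $x\in H$. A left Haar measure for $H$ is a non-zero regular Borel measure $\lambda$ on $H$ with values in $[0,\infty]$ (regular includes being finite on compact sets) such that, writing $\lambda(f)=\int_H f\,d\lambda$, $\lambda(\delta_x\ast f)=\lambda(f)$ for all $f\in C_C(H)$ and $x\in H$. *)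

theory Defs
  imports "HOL-Analysis.Analysis" "HOL-Library.Complex_Order"
begin

text \<open>The order on \<^typ>\<open>complex\<close> is that of \<^theory>\<open>HOL-Library.Complex_Order\<close>: \<open>z \<le> w\<close> iff
  \<open>w - z\<close> is a non-negative real. In particular \<open>0 \<le> z\<close> says that \<open>z\<close> is real and
  non-negative.\<close>

section \<open>Complex Radon measures\<close>

text \<open>Outer regular on Borel sets, inner regular on open sets, finite on compact sets. For finite
  measures this implies inner regularity on all Borel sets.\<close>

definition regular_borel_measure :: "'a::t2_space measure \<Rightarrow> bool" where
  "regular_borel_measure N \<longleftrightarrow>
     sets N = sets borel \<and>
     (\<forall>K. compact K \<longrightarrow> emeasure N K < \<infinity>) \<and>
     (\<forall>A\<in>sets borel. emeasure N A = (INF U\<in>{U. open U \<and> A \<subseteq> U}. emeasure N U)) \<and>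
     (\<forall>U. open U \<longrightarrow> emeasure N U = (SUP K\<in>{K. compact K \<and> K \<subseteq> U}. emeasure N K))"

text \<open>A complex measure is represented by its set function, extended by \<open>0\<close> to the sets that are not
  Borel (so that equality of set functions is equality of measures).\<close>

definition complex_borel_measure :: "('a::topological_space set \<Rightarrow> complex) \<Rightarrow> bool" where
  "complex_borel_measure \<mu> \<longleftrightarrow>
     (\<forall>A. A \<notin> sets borel \<longrightarrow> \<mu> A = 0) \<and>
     (\<forall>A::nat \<Rightarrow> 'a set. range A \<subseteq> sets borel \<and> disjoint_family A \<longrightarrow>
        (\<lambda>i. \<mu> (A i)) sums \<mu> (\<Union>i. A i))"

definition variation :: "('a::topological_space set \<Rightarrow> complex) \<Rightarrow> 'a measure" where
  "variation \<mu> = measure_of UNIV (sets borel)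
     (\<lambda>A. SUP P\<in>{P. finite P \<and> disjoint P \<and> P \<subseteq> sets borel \<and> \<Union>P = A}.
        \<Sum>B\<in>P. ennreal (cmod (\<mu> B)))"

definition radon_measures :: "('a::t2_space set \<Rightarrow> complex) set" where
  "radon_measures = {\<mu>. complex_borel_measure \<mu> \<and>
     emeasure (variation \<mu>) UNIV < \<infinity> \<and> regular_borel_measure (variation \<mu>)}"

definition pos_radon_measures :: "('a::t2_space set \<Rightarrow> complex) set" where
  "pos_radon_measures = {\<mu> \<in> radon_measures. \<forall>A. 0 \<le> \<mu> A}"

definition tv_norm :: "('a::t2_space set \<Rightarrow> complex) \<Rightarrow> real" where
  "tv_norm \<mu> = measure (variation \<mu>) UNIV"

definition msupport :: "('a::t2_space set \<Rightarrow> complex) \<Rightarrow> 'a set" where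
  "msupport \<mu> = {x. \<forall>U. open U \<and> x \<in> U \<longrightarrow> emeasure (variation \<mu>) U > 0}"

definition point_mass :: "'a::t2_space \<Rightarrow> 'a set \<Rightarrow> complex" where
  "point_mass x = (\<lambda>A. if A \<in> sets borel \<and> x \<in> A then 1 else 0)"

definition compact_prob_measures :: "('a::t2_space set \<Rightarrow> complex) set" where
  "compact_prob_measures = {\<mu> \<in> pos_radon_measures. \<mu> UNIV = 1 \<and> compact (msupport \<mu>)}"

text \<open>The positive part of a finite signed measure \<open>s\<close> (recall that \<^const>\<open>ennreal\<close> truncates negative
  numbers to \<open>0\<close>, and that the supremum includes the empty set). The integral against a complex
  measure is defined by the Jordan decompositions of its real and imaginary parts.\<close>

definition jordan_pos :: "('a::topological_space set \<Rightarrow> real) \<Rightarrow> 'a measure" where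
  "jordan_pos s = measure_of UNIV (sets borel)
     (\<lambda>A. SUP B\<in>{B \<in> sets borel. B \<subseteq> A}. ennreal (s B))"

definition cintegral :: "('a::topological_space set \<Rightarrow> complex) \<Rightarrow> ('a \<Rightarrow> complex) \<Rightarrow> complex" where
  "cintegral \<mu> f =
     ((LINT x|jordan_pos (\<lambda>A. Re (\<mu> A)). f x) - (LINT x|jordan_pos (\<lambda>A. - Re (\<mu> A)). f x)) +
     \<i> * ((LINT x|jordan_pos (\<lambda>A. Im (\<mu> A)). f x) - (LINT x|jordan_pos (\<lambda>A. - Im (\<mu> A)). f x))"

lemma measure_of_borel_eqI:
  assumes "sets M = sets borel" and "\<And>A. A \<in> sets borel \<Longrightarrow> g A = emeasure M A"
  shows "measure_of UNIV (sets borel) g = M"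
proof -
  have "space M = UNIV"
    using sets_eq_imp_space_eq[OF assms(1)] by simp
  then have "measure_of UNIV (sets borel) g = measure_of (space M) (sets M) (emeasure M)"
    unfolding assms(1)[symmetric]
    using sets.sigma_sets_eq[of M] sets.space_closed[of M] assms
    by (auto intro!: measure_of_eq)
  then show ?thesis
    by (simp only: measure_of_of_measure)
qed

lemma jordan_pos_nonneg:
  assumes M: "finite_measure M" "sets M = sets borel"
    and s: "\<And>A. A \<in> sets borel \<Longrightarrow> s A = measure M A"
  shows "jordan_pos s = M"
proof -
  interpret finite_measure M by fact
  have "(SUP B\<in>{B \<in> sets borel. B \<subseteq> A}. ennreal (s B)) = emeasure M A"
    if "A \<in> sets borel" for A
    using that M by (intro antisym SUP_least SUP_upper2[where i = A])
      (auto simp: s emeasure_eq_measure intro!: ennreal_leI finite_measure_mono)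
  then show ?thesis
    unfolding jordan_pos_def by (intro measure_of_borel_eqI M)
qed

lemma jordan_pos_nonpos:
  assumes "\<And>A. A \<in> sets borel \<Longrightarrow> s A \<le> 0"
  shows "jordan_pos s = null_measure borel"
proof -
  have "finite_measure (null_measure borel)"
    by (rule finite_measureI) simp
  have "jordan_pos s = jordan_pos (\<lambda>_. 0)"
    unfolding jordan_pos_def
    by (intro arg_cong[where f = "measure_of UNIV (sets borel)"] ext SUP_cong)
      (auto simp: assms ennreal_neg)
  also have "\<dots> = null_measure borel"
    by (rule jordan_pos_nonneg) (use \<open>finite_measure _\<close> in \<open>auto simp: measure_def\<close>)
  finally show ?thesis .
qed

lemma cintegral_nonneg:
  assumes "finite_measure M" "sets M = sets borel"
    and "\<And>A. A \<in> sets borel \<Longrightarrow> \<mu> A = of_real (measure M A)"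
  shows "cintegral \<mu> f = (LINT x|M. f x)"
proof -
  have "jordan_pos (\<lambda>A. Re (\<mu> A)) = M"
    by (rule jordan_pos_nonneg) (use assms in auto)
  moreover have "jordan_pos (\<lambda>A. - Re (\<mu> A)) = null_measure borel"
    "jordan_pos (\<lambda>A. Im (\<mu> A)) = null_measure borel"
    "jordan_pos (\<lambda>A. - Im (\<mu> A)) = null_measure borel"
    by (rule jordan_pos_nonpos; use assms in simp)+
  ultimately show ?thesis
    by (simp add: cintegral_def)
qed

lemma variation_nonneg:
  assumes M: "finite_measure M" "sets M = sets borel"
    and \<mu>: "\<And>A. A \<in> sets borel \<Longrightarrow> \<mu> A = of_real (measure M A)"
  shows "variation \<mu> = M"
proof -
  interpret finite_measure M by fact
  have *: "(\<Sum>B\<in>P. ennreal (cmod (\<mu> B))) = emeasure M (\<Union>P)"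
    if "finite P" "disjoint P" "P \<subseteq> sets borel" for P
  proof -
    have "(\<Sum>B\<in>P. ennreal (cmod (\<mu> B))) = (\<Sum>B\<in>P. emeasure M B)"
      using that by (intro sum.cong) (auto simp: \<mu> emeasure_eq_measure)
    also have "\<dots> = emeasure M (\<Union>B\<in>P. B)"
      using that M(2) by (intro sum_emeasure) (auto simp: disjoint_family_on_def disjoint_def)
    finally show ?thesis by simp
  qed
  let ?s = "\<lambda>A. SUP P\<in>{P. finite P \<and> disjoint P \<and> P \<subseteq> sets borel \<and> \<Union>P = A}.
      \<Sum>B\<in>P. ennreal (cmod (\<mu> B))"
  have "?s A = emeasure M A" if "A \<in> sets borel" for A
  proof (rule antisym)
    show "?s A \<le> emeasure M A"
      using * by (intro SUP_least) auto
    have "(\<Sum>B\<in>{A}. ennreal (cmod (\<mu> B))) \<le> ?s A"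
      using that by (intro SUP_upper) auto
    then show "emeasure M A \<le> ?s A"
      using that by (simp add: \<mu> emeasure_eq_measure)
  qed
  then show ?thesis
    unfolding variation_def by (intro measure_of_borel_eqI M)
qed

section \<open>Function spaces, weak topologies and the Michael topology\<close>

text \<open>The space \<open>C(H)\<close> of bounded continuous functions is the library's set
  \<open>bcontfun :: ('a \<Rightarrow> complex) set\<close>.\<close>

definition sup_norm :: "('a \<Rightarrow> complex) \<Rightarrow> real" where
  "sup_norm f = (SUP x. cmod (f x))"

definition cont_compact_supp :: "('a::t2_space \<Rightarrow> complex) set" where
  "cont_compact_supp = {f. continuous_on UNIV f \<and> compact (closure {x. f x \<noteq> 0})}"

definition clinear_on :: "('a \<Rightarrow> complex) set \<Rightarrow> (('a \<Rightarrow> complex) \<Rightarrow> complex) \<Rightarrow> bool" where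
  "clinear_on V \<phi> \<longleftrightarrow>
     (\<forall>f\<in>V. \<forall>g\<in>V. \<phi> (\<lambda>x. f x + g x) = \<phi> f + \<phi> g) \<and>
     (\<forall>c. \<forall>f\<in>V. \<phi> (\<lambda>x. c * f x) = c * \<phi> f)"

definition functional_norm :: "('a \<Rightarrow> complex) set \<Rightarrow> (('a \<Rightarrow> complex) \<Rightarrow> complex) \<Rightarrow> ennreal" where
  "functional_norm V \<phi> = (SUP f\<in>{f \<in> V. sup_norm f \<le> 1}. ennreal (cmod (\<phi> f)))"

definition dual_space :: "('a \<Rightarrow> complex) set \<Rightarrow> (('a \<Rightarrow> complex) \<Rightarrow> complex) set" where
  "dual_space V = {\<phi>. clinear_on V \<phi> \<and> functional_norm V \<phi> < \<infinity>}"

definition weak_topology :: "'v set \<Rightarrow> ('v \<Rightarrow> complex) set \<Rightarrow> 'v topology" where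
  "weak_topology X F = topology_generated_by {{v \<in> X. \<phi> v \<in> U} |\<phi> U. \<phi> \<in> F \<and> open U}"

lemma continuous_map_weak_topology:
  assumes "F \<noteq> {}"
  shows "continuous_map T (weak_topology X F) g \<longleftrightarrow>
    g ` topspace T \<subseteq> X \<and> (\<forall>\<phi>\<in>F. continuous_map T euclidean (\<lambda>t. \<phi> (g t)))"
proof -
  have top: "\<Union>{{v \<in> X. \<phi> v \<in> U} |\<phi> U. \<phi> \<in> F \<and> open U} = X"
    using assms by (auto intro: exI[of _ UNIV])
  have eq: "openin T (g -` {v \<in> X. \<phi> v \<in> U} \<inter> topspace T) \<longleftrightarrow>
      openin T {t \<in> topspace T. \<phi> (g t) \<in> U}"
    if "g ` topspace T \<subseteq> X" for \<phi> U
    using that by (intro arg_cong[where f = "openin T"]) auto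
  have "continuous_map T (weak_topology X F) g \<longleftrightarrow> g ` topspace T \<subseteq> X \<and>
      (\<forall>\<phi>\<in>F. \<forall>U. open U \<longrightarrow> openin T (g -` {v \<in> X. \<phi> v \<in> U} \<inter> topspace T))"
    unfolding weak_topology_def continuous_on_generated_topo_iff top by blast
  also have "\<dots> \<longleftrightarrow> g ` topspace T \<subseteq> X \<and>
      (\<forall>\<phi>\<in>F. continuous_map T euclidean (\<lambda>t. \<phi> (g t)))"
  proof (cases "g ` topspace T \<subseteq> X")
    case True
    show ?thesis
      unfolding eq[OF True] by (simp add: continuous_map_def)
  qed blast
  finally show ?thesis .
qed

definition michael_topology :: "'a::t2_space set topology" where
  "michael_topology = topology_generated_by
     {{C. compact C \<and> C \<noteq> {} \<and> C \<inter> U \<noteq> {} \<and> C \<subseteq> V} |U V. open U \<and> open V}"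

section \<open>Hypergroups\<close>

definition check_measure :: "('a \<Rightarrow> 'a) \<Rightarrow> ('a set \<Rightarrow> complex) \<Rightarrow> 'a set \<Rightarrow> complex" where
  "check_measure chk \<mu> = (\<lambda>A. \<mu> {x. chk x \<in> A})"

locale hypergroup =
  fixes conv :: "('a::t2_space set \<Rightarrow> complex) \<Rightarrow> ('a set \<Rightarrow> complex) \<Rightarrow> ('a set \<Rightarrow> complex)"
    and e :: 'a
    and chk :: "'a \<Rightarrow> 'a"
  assumes locally_compact: "locally_compact_space (euclidean :: 'a topology)"
    and conv_closed: "\<lbrakk>\<mu> \<in> radon_measures; \<nu> \<in> radon_measures\<rbrakk> \<Longrightarrow> conv \<mu> \<nu> \<in> radon_measures"
    and conv_assoc: "\<lbrakk>\<mu> \<in> radon_measures; \<nu> \<in> radon_measures; \<rho> \<in> radon_measures\<rbrakk> \<Longrightarrow>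
      conv (conv \<mu> \<nu>) \<rho> = conv \<mu> (conv \<nu> \<rho>)"
    and conv_add_left: "\<lbrakk>\<mu> \<in> radon_measures; \<nu> \<in> radon_measures; \<rho> \<in> radon_measures\<rbrakk> \<Longrightarrow>
      conv (\<lambda>A. \<mu> A + \<nu> A) \<rho> = (\<lambda>A. conv \<mu> \<rho> A + conv \<nu> \<rho> A)"
    and conv_add_right: "\<lbrakk>\<mu> \<in> radon_measures; \<nu> \<in> radon_measures; \<rho> \<in> radon_measures\<rbrakk> \<Longrightarrow>
      conv \<rho> (\<lambda>A. \<mu> A + \<nu> A) = (\<lambda>A. conv \<rho> \<mu> A + conv \<rho> \<nu> A)"
    and conv_scale_left: "\<lbrakk>\<mu> \<in> radon_measures; \<nu> \<in> radon_measures\<rbrakk> \<Longrightarrow>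
      conv (\<lambda>A. c * \<mu> A) \<nu> = (\<lambda>A. c * conv \<mu> \<nu> A)"
    and conv_scale_right: "\<lbrakk>\<mu> \<in> radon_measures; \<nu> \<in> radon_measures\<rbrakk> \<Longrightarrow>
      conv \<mu> (\<lambda>A. c * \<nu> A) = (\<lambda>A. c * conv \<mu> \<nu> A)"
    and conv_weak: "\<lbrakk>\<mu> \<in> radon_measures; \<nu> \<in> radon_measures; f \<in> bcontfun\<rbrakk> \<Longrightarrow>
      cintegral (conv \<mu> \<nu>) f =
      cintegral \<nu> (\<lambda>y. cintegral \<mu> (\<lambda>x. cintegral (conv (point_mass x) (point_mass y)) f))"
    and conv_point_mass: "conv (point_mass x) (point_mass y) \<in> compact_prob_measures"
    and conv_continuous:
      "continuous_map euclidean
         (weak_topology compact_prob_measures {(\<lambda>\<mu>. cintegral \<mu> f) |f. f \<in> bcontfun})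
         (\<lambda>(x, y). conv (point_mass x) (point_mass y))"
    and supp_continuous:
      "continuous_map euclidean michael_topology
         (\<lambda>(x, y). msupport (conv (point_mass x) (point_mass y)))"
    and unit: "conv (point_mass x) (point_mass e) = point_mass x"
      "conv (point_mass e) (point_mass x) = point_mass x"
    and unit_unique: "(\<And>x. conv (point_mass x) (point_mass e') = point_mass x \<and>
      conv (point_mass e') (point_mass x) = point_mass x) \<Longrightarrow> e' = e"
    and chk_homeomorphic: "homeomorphic_map euclidean euclidean chk"
    and chk_chk: "chk (chk x) = x"
    and chk_conv: "\<lbrakk>\<mu> \<in> radon_measures; \<nu> \<in> radon_measures\<rbrakk> \<Longrightarrow>
      check_measure chk (conv \<mu> \<nu>) = conv (check_measure chk \<nu>) (check_measure chk \<mu>)"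
    and unit_in_supp:
      "e \<in> msupport (conv (point_mass x) (point_mass y)) \<longleftrightarrow> y = chk x"

text \<open>In the following definitions \<open>conv\<close> and \<open>chk\<close> are the convolution and the involution of a
  hypergroup.\<close>

definition conv_fun ::
    "(('a::t2_space set \<Rightarrow> complex) \<Rightarrow> ('a set \<Rightarrow> complex) \<Rightarrow> ('a set \<Rightarrow> complex)) \<Rightarrow> ('a \<Rightarrow> 'a) \<Rightarrow>
     ('a set \<Rightarrow> complex) \<Rightarrow> ('a \<Rightarrow> complex) \<Rightarrow> 'a \<Rightarrow> complex" where
  "conv_fun conv chk \<mu> f =
     (\<lambda>y. cintegral \<mu> (\<lambda>x. cintegral (conv (point_mass (chk x)) (point_mass y)) f))"

definition positivity_property ::
    "(('a::t2_space set \<Rightarrow> complex) \<Rightarrow> ('a set \<Rightarrow> complex) \<Rightarrow> ('a set \<Rightarrow> complex)) \<Rightarrow> ('a \<Rightarrow> 'a) \<Rightarrow>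
     ('a \<Rightarrow> complex) \<Rightarrow> bool" where
  "positivity_property conv chk f \<longleftrightarrow>
     (\<forall>\<mu>\<in>pos_radon_measures. \<forall>\<nu>\<in>pos_radon_measures.
        (\<forall>y. conv_fun conv chk \<mu> f y \<le> conv_fun conv chk \<nu> f y) \<longrightarrow> tv_norm \<mu> \<le> tv_norm \<nu>)"

definition WUCB_r ::
    "(('a::t2_space set \<Rightarrow> complex) \<Rightarrow> ('a set \<Rightarrow> complex) \<Rightarrow> ('a set \<Rightarrow> complex)) \<Rightarrow> ('a \<Rightarrow> 'a) \<Rightarrow>
     ('a \<Rightarrow> complex) set" where
  "WUCB_r conv chk = {f \<in> bcontfun.
     continuous_map euclidean (weak_topology bcontfun (dual_space bcontfun))
       (\<lambda>x. conv_fun conv chk (point_mass x) f)}"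

definition left_invariant_mean ::
    "(('a::t2_space set \<Rightarrow> complex) \<Rightarrow> ('a set \<Rightarrow> complex) \<Rightarrow> ('a set \<Rightarrow> complex)) \<Rightarrow> ('a \<Rightarrow> 'a) \<Rightarrow>
     (('a \<Rightarrow> complex) \<Rightarrow> complex) \<Rightarrow> bool" where
  "left_invariant_mean conv chk m \<longleftrightarrow>
     clinear_on (WUCB_r conv chk) m \<and>
     functional_norm (WUCB_r conv chk) m = 1 \<and> m (\<lambda>_. 1) = 1 \<and>
     (\<forall>f\<in>WUCB_r conv chk. \<forall>x. m (conv_fun conv chk (point_mass x) f) = m f)"

definition left_haar_measure ::
    "(('a::t2_space set \<Rightarrow> complex) \<Rightarrow> ('a set \<Rightarrow> complex) \<Rightarrow> ('a set \<Rightarrow> complex)) \<Rightarrow> ('a \<Rightarrow> 'a) \<Rightarrow>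
     'a measure \<Rightarrow> bool" where
  "left_haar_measure conv chk N \<longleftrightarrow>
     regular_borel_measure N \<and> emeasure N UNIV \<noteq> 0 \<and>
     (\<forall>f\<in>cont_compact_supp. \<forall>x.
        (LINT y|N. conv_fun conv chk (point_mass x) f y) = (LINT y|N. f y))"

end

theory Submission
  imports Defs
begin

text \<open>By the positivity property, \<open>\<Sum>i. c i * ltrans (x i) f \<mapsto> \<Sum>i. c i\<close> is a well-defined positive
  functional on the span of the left translates of \<open>f\<close>. These translates dominate every compactly
  supported function, so Hahn-Banach extends it to a positive functional \<open>\<Phi>\<close> on all real compactly
  supported continuous functions with \<open>\<Phi> (ltrans x f) = 1\<close> for all \<open>x\<close>. For compactly supported
  \<open>h\<close> let \<open>F h z = \<Phi> (ltrans (chk z) h)\<close>. As \<open>\<Phi>\<close> commutes with integrals over the compactly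
  supported measures \<open>\<delta>\<^sub>x * \<delta>\<^sub>y\<close>, associativity gives \<open>ltrans x (F h) = F (ltrans x h)\<close>. Therefore
  \<open>F h\<close> is bounded and \<open>x \<mapsto> ltrans x (F h)\<close> is even norm continuous, so that the mean \<open>m\<close> applies to
  \<open>F h\<close>, and \<open>h \<mapsto> m (F h)\<close> is a left invariant positive functional with value \<open>1\<close> at \<open>f\<close>. The measure
  representing it is a left Haar measure.\<close>

section \<open>The Hahn-Banach theorem\<close>

text \<open>The mean cannot simply be applied to \<open>h\<close>: already on non-compact groups
  every invariant mean kills all compactly supported functions. The functional \<open>\<Phi>\<close>
  is not invariant either; it only takes the same value on all translates of the one function
  \<open>f\<close>. The transform \<open>F\<close> combines the two: it makes \<open>f\<close> the
  constant 1, where \<open>m\<close> is known, and turns translation of \<open>h\<close> into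
  translation of a function to which \<open>m\<close> applies. Translation by a point is here an
  average over a measure and not a point map. Hence moving \<open>\<Phi>\<close> past a translation
  is an interchange with an integral. It is done by Riemann sums, as no \<sigma>-finiteness is at
  hand for a Fubini argument. Supports of translates are located by means of the axiom on when
  \<open>e\<close> lies in a support. As \<open>\<Phi>\<close> need not be bounded for the supremum
  norm, small differences are measured against a fixed majorant in \<open>Cc\<close>; their images
  under \<open>F\<close> then become uniformly small. The majorant is in turn bounded by translates
  of \<open>f\<close>, each of which \<open>F\<close> sends to 1.\<close>

definition sublinear_on :: "'v::real_vector set \<Rightarrow> ('v \<Rightarrow> real) \<Rightarrow> bool" where
  "sublinear_on V q \<longleftrightarrow>
     (\<forall>x\<in>V. \<forall>y\<in>V. q (x + y) \<le> q x + q y) \<and> (\<forall>x\<in>V. \<forall>c>0. q (c *\<^sub>R x) \<le> c * q x)"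

text \<open>Using the inequality once more, with factor 1/c at the point
  \<open>c *\<^sub>R x\<close>, reverses it.\<close>

lemma sublinear_on_scale:
  assumes "sublinear_on V q" "subspace V" "x \<in> V" "c > 0"
  shows "q (c *\<^sub>R x) = c * q x"
proof (rule antisym)
  show "q (c *\<^sub>R x) \<le> c * q x"
    using assms by (auto simp: sublinear_on_def)
  have "q ((1 / c) *\<^sub>R (c *\<^sub>R x)) \<le> (1 / c) * q (c *\<^sub>R x)"
    using assms unfolding sublinear_on_def by (meson divide_pos_pos subspace_scale zero_less_one)
  then show "c * q x \<le> q (c *\<^sub>R x)"
    using \<open>c > 0\<close> by (simp add: field_simps)
qed

lemma sublinear_on_0:
  assumes "sublinear_on V q" "subspace V"
  shows "q 0 = 0"
  using sublinear_on_scale[OF assms subspace_0[OF assms(2)], of 2] by simp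

lemma sublinear_on_ge:
  assumes "sublinear_on V q" "subspace V" "x \<in> V"
  shows "- q (- x) \<le> q x"
proof -
  have "q (x + - x) \<le> q x + q (- x)"
    using assms subspace_neg unfolding sublinear_on_def by blast
  then show ?thesis
    using sublinear_on_0[OF assms(1,2)] by simp
qed

text \<open>Every member satisfies q v \<ge> - q (- v) \<ge> - p (- v), a bound that does not depend
  on \<open>q\<close>, so the infimum is finite. For subadditivity one member must be small at two
  points at once; of two members of a chain the smaller one will do.\<close>

lemma sublinear_on_Inf_chain:
  assumes V: "subspace V" and C: "C \<noteq> {}" "\<And>q. q \<in> C \<Longrightarrow> sublinear_on V q"
    and le: "\<And>q v. q \<in> C \<Longrightarrow> v \<in> V \<Longrightarrow> q v \<le> p v"
    and chain: "\<And>q r. q \<in> C \<Longrightarrow> r \<in> C \<Longrightarrow> (\<forall>v\<in>V. q v \<le> r v) \<or> (\<forall>v\<in>V. r v \<le> q v)"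
  defines "u \<equiv> \<lambda>v. if v \<in> V then INF q\<in>C. q v else 0"
  shows "sublinear_on V u" and "\<And>q v. q \<in> C \<Longrightarrow> v \<in> V \<Longrightarrow> u v \<le> q v"
proof -
  have bdd: "bdd_below ((\<lambda>q. q v) ` C)" if "v \<in> V" for v
  proof (rule bdd_belowI2)
    show "- p (- v) \<le> q v" if "q \<in> C" for q
      using sublinear_on_ge[OF C(2)[OF that] V \<open>v \<in> V\<close>] le[OF that subspace_neg[OF V \<open>v \<in> V\<close>]]
      by linarith
  qed
  show low: "u v \<le> q v" if "q \<in> C" "v \<in> V" for q v
    using that bdd by (auto simp: u_def intro: cINF_lower)
  have great: "c \<le> u v" if "v \<in> V" "\<And>q. q \<in> C \<Longrightarrow> c \<le> q v" for c v
    using that C(1) by (auto simp: u_def intro: cINF_greatest)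
  show "sublinear_on V u"
    unfolding sublinear_on_def
  proof (intro conjI ballI allI impI)
    fix x y assume xy: "x \<in> V" "y \<in> V"
    have xyV: "x + y \<in> V"
      using xy V by (simp add: subspace_add)
    have *: "u (x + y) \<le> q x + r y" if qr: "q \<in> C" "r \<in> C" for q r
    proof -
      obtain s where s: "s \<in> C" "s x \<le> q x" "s y \<le> r y"
        using chain[OF qr] qr xy by blast
      have "u (x + y) \<le> s (x + y)"
        using low s xyV by blast
      also have "\<dots> \<le> s x + s y"
        using C(2)[OF s(1)] xy by (simp add: sublinear_on_def)
      finally show ?thesis
        using s by linarith
    qed
    have "u (x + y) - r y \<le> u x" if "r \<in> C" for r
      using * that xy by (intro great) (auto simp: algebra_simps)
    then have "u (x + y) - u x \<le> u y"
      using xy by (intro great) (auto simp: algebra_simps)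
    then show "u (x + y) \<le> u x + u y"
      by simp
  next
    fix x and c :: real assume x: "x \<in> V" "c > 0"
    have cx: "c *\<^sub>R x \<in> V"
      using x V by (simp add: subspace_scale)
    have "u (c *\<^sub>R x) / c \<le> u x"
    proof (rule great)
      fix q assume q: "q \<in> C"
      have "u (c *\<^sub>R x) \<le> q (c *\<^sub>R x)"
        using low q cx by blast
      also have "\<dots> \<le> c * q x"
        using C(2)[OF q] x by (simp add: sublinear_on_def)
      finally show "u (c *\<^sub>R x) / c \<le> q x"
        using x by (simp add: field_simps)
    qed (rule x)
    then show "u (c *\<^sub>R x) \<le> c * u x"
      using x by (simp add: field_simps)
  qed
qed

text \<open>Zorn's lemma for the reversed pointwise order, with the infimum of a chain as its
  bound.\<close>

lemma minimal_sublinear_on: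
  assumes V: "subspace V" and p: "sublinear_on V p"
  obtains q where "sublinear_on V q" "\<And>v. v \<in> V \<Longrightarrow> q v \<le> p v"
    "\<forall>r. sublinear_on V r \<longrightarrow> (\<forall>v\<in>V. r v \<le> q v) \<longrightarrow> (\<forall>v\<in>V. r v = q v)"
proof -
  \<comment> \<open>Functions are made to vanish off \<open>V\<close>, since otherwise two of them
    could agree on \<open>V\<close> and still differ, and \<open>P\<close> would not be
    antisymmetric.\<close>
  define A where "A = {q. sublinear_on V q \<and> (\<forall>v\<in>V. q v \<le> p v) \<and> (\<forall>v. v \<notin> V \<longrightarrow> q v = 0)}"
  define P where "P q r \<longleftrightarrow> (\<forall>v\<in>V. r v \<le> q v)" for q r :: "'a \<Rightarrow> real"
  have cut: "(\<lambda>v. if v \<in> V then r v else 0) \<in> A"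
    if "sublinear_on V r" "\<And>v. v \<in> V \<Longrightarrow> r v \<le> p v" for r
    using that V by (auto simp: A_def sublinear_on_def subspace_add subspace_scale)
  have "\<exists>m\<in>A. \<forall>a\<in>A. P m a \<longrightarrow> a = m"
  proof (rule predicate_Zorn)
    have "a = b" if "a \<in> A" "b \<in> A" "P a b" "P b a" for a b
    proof
      fix v show "a v = b v"
        using that by (cases "v \<in> V") (force simp: A_def P_def)+
    qed
    moreover have "P a c" if "P a b" "P b c" for a b c
      unfolding P_def
    proof
      fix v assume "v \<in> V"
      then have "c v \<le> b v" "b v \<le> a v"
        using that by (auto simp: P_def)
      then show "c v \<le> a v" by (rule order_trans)
    qed
    moreover have "P a a" for a
      by (simp add: P_def)
    ultimately show "partial_order_on A (relation_of P A)"
      unfolding partial_order_on_def preorder_on_def refl_on_def trans_def antisym_def relation_of_def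
      by blast
  next
    fix C assume C: "C \<in> Chains (relation_of P A)"
    have CA: "a \<in> A" if "a \<in> C" for a
      using C that by (auto simp: Chains_def relation_of_def)
    show "\<exists>u\<in>A. \<forall>a\<in>C. P a u"
    proof (cases "C = {}")
      case True
      then show ?thesis
        using cut[OF p] by auto
    next
      case False
      have chain: "(\<forall>v\<in>V. q v \<le> r v) \<or> (\<forall>v\<in>V. r v \<le> q v)" if "q \<in> C" "r \<in> C" for q r
        using C that unfolding Chains_def relation_of_def P_def by blast
      define u where "u = (\<lambda>v. if v \<in> V then INF q\<in>C. q v else 0)"
      have u: "sublinear_on V u" "\<And>q v. q \<in> C \<Longrightarrow> v \<in> V \<Longrightarrow> u v \<le> q v"
        using sublinear_on_Inf_chain[OF V False, of p] CA chain unfolding u_def A_def by blast+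
      have "u v \<le> p v" if "v \<in> V" for v
      proof -
        obtain q where "q \<in> C" using False by blast
        then show ?thesis
          using u(2)[of q v] CA that by (force simp: A_def)
      qed
      then have "u \<in> A"
        using u(1) by (auto simp: A_def u_def)
      then show ?thesis
        using u(2) by (auto simp: P_def)
    qed
  qed
  then obtain q where q: "q \<in> A" "\<And>a. a \<in> A \<Longrightarrow> P q a \<Longrightarrow> a = q"
    by blast
  show thesis
  proof
    have "r v = q v" if r: "sublinear_on V r" "\<forall>v\<in>V. r v \<le> q v" and v: "v \<in> V" for r v
    proof -
      have "r v \<le> p v" if "v \<in> V" for v
        using r(2) q(1) that by (force simp: A_def)
      then have "(\<lambda>v. if v \<in> V then r v else 0) = q"
        using r by (intro q(2) cut) (auto simp: P_def)
      then show "r v = q v"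
        using v by (auto dest: fun_cong[where x = v])
    qed
    then show "\<forall>r. sublinear_on V r \<longrightarrow> (\<forall>v\<in>V. r v \<le> q v) \<longrightarrow> (\<forall>v\<in>V. r v = q v)"
      by blast
  qed (use q(1) in \<open>auto simp: A_def\<close>)
qed

text \<open>A minimal sublinear functional \<open>q\<close> is additive: \<open>x \<mapsto> inf {q (x + t y) - t q y | t \<ge> 0}\<close> is
  sublinear and below \<open>q\<close>, hence equal to \<open>q\<close>, and \<open>t = 1\<close> gives \<open>q x \<le> q (x + y) - q y\<close>.\<close>

theorem Hahn_Banach_sublinear:
  assumes V: "subspace V" and p: "sublinear_on V p"
  obtains \<Phi> where "\<And>x y. x \<in> V \<Longrightarrow> y \<in> V \<Longrightarrow> \<Phi> (x + y) = \<Phi> x + \<Phi> y"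
    "\<And>x c. x \<in> V \<Longrightarrow> \<Phi> (c *\<^sub>R x) = c * \<Phi> x" "\<And>x. x \<in> V \<Longrightarrow> \<Phi> x \<le> p x"
proof -
  obtain q where q: "sublinear_on V q" "\<And>v. v \<in> V \<Longrightarrow> q v \<le> p v"
    and min: "\<forall>r. sublinear_on V r \<longrightarrow> (\<forall>v\<in>V. r v \<le> q v) \<longrightarrow> (\<forall>v\<in>V. r v = q v)"
    by (rule minimal_sublinear_on[OF V p]) (rule that)
  have sub: "q (x + y) \<le> q x + q y" if "x \<in> V" "y \<in> V" for x y
    using q(1) that by (simp add: sublinear_on_def)
  have scale: "q (c *\<^sub>R x) = c * q x" if "x \<in> V" "c \<ge> 0" for x c
    using sublinear_on_scale[OF q(1) V that(1), of c] sublinear_on_0[OF q(1) V] that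
    by (cases "c = 0") auto
  have add: "q (x + y) = q x + q y" if x: "x \<in> V" and y: "y \<in> V" for x y
  proof (rule antisym[OF sub[OF x y]])
    define r where "r x = (INF t\<in>{0..}. q (x + t *\<^sub>R y) - t * q y)" for x
    have mem: "x + t *\<^sub>R y \<in> V" if "x \<in> V" for x t
      using that y V by (simp add: subspace_add subspace_scale)
    have bdd: "bdd_below ((\<lambda>t. q (x + t *\<^sub>R y) - t * q y) ` {0..})" if "x \<in> V" for x
    proof (rule bdd_belowI2)
      fix t :: real assume "t \<in> {0..}"
      then have "t * q y = q ((x + t *\<^sub>R y) + - x)"
        using scale y by simp
      also have "\<dots> \<le> q (x + t *\<^sub>R y) + q (- x)"
        using mem that V by (intro sub) (auto simp: subspace_neg)
      finally show "- q (- x) \<le> q (x + t *\<^sub>R y) - t * q y"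
        by simp
    qed
    have low: "r x \<le> q (x + t *\<^sub>R y) - t * q y" if "x \<in> V" "t \<ge> 0" for x t
      unfolding r_def using bdd that by (intro cINF_lower) auto
    have great: "c \<le> r x" if "\<And>t. t \<ge> 0 \<Longrightarrow> c \<le> q (x + t *\<^sub>R y) - t * q y" for c x
      unfolding r_def using that by (intro cINF_greatest) auto
    have "sublinear_on V r"
      unfolding sublinear_on_def
    proof (intro conjI ballI allI impI)
      fix a b assume ab: "a \<in> V" "b \<in> V"
      \<comment> \<open>The parameter s + t at a + b allows the parameters at a and at b to be
        chosen independently, so both infima can be taken afterwards.\<close>
      have *: "r (a + b) \<le> (q (a + s *\<^sub>R y) - s * q y) + (q (b + t *\<^sub>R y) - t * q y)"
        if "s \<ge> 0" "t \<ge> 0" for s t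
      proof -
        have "r (a + b) \<le> q ((a + b) + (s + t) *\<^sub>R y) - (s + t) * q y"
          using ab V that by (intro low) (auto simp: subspace_add)
        also have "(a + b) + (s + t) *\<^sub>R y = (a + s *\<^sub>R y) + (b + t *\<^sub>R y)"
          by (simp add: algebra_simps)
        also have "q \<dots> \<le> q (a + s *\<^sub>R y) + q (b + t *\<^sub>R y)"
          using mem ab by (intro sub)
        finally show ?thesis
          by (simp add: algebra_simps)
      qed
      have "r (a + b) - (q (b + t *\<^sub>R y) - t * q y) \<le> r a" if "t \<ge> 0" for t
        using * that by (intro great) (simp add: algebra_simps)
      then have "r (a + b) - r a \<le> r b"
        by (intro great) (simp add: algebra_simps)
      then show "r (a + b) \<le> r a + r b"
        by simp
    next
      fix a and c :: real assume a: "a \<in> V" "c > 0"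
      have "r (c *\<^sub>R a) / c \<le> r a"
      proof (rule great)
        fix t :: real assume t: "t \<ge> 0"
        have "r (c *\<^sub>R a) \<le> q (c *\<^sub>R a + (c * t) *\<^sub>R y) - (c * t) * q y"
          using a V t by (intro low) (auto simp: subspace_scale)
        also have "c *\<^sub>R a + (c * t) *\<^sub>R y = c *\<^sub>R (a + t *\<^sub>R y)"
          by (simp add: algebra_simps)
        also have "q \<dots> = c * q (a + t *\<^sub>R y)"
          using a mem by (intro scale) auto
        finally show "r (c *\<^sub>R a) / c \<le> q (a + t *\<^sub>R y) - t * q y"
          using a by (simp add: field_simps)
      qed
      then show "r (c *\<^sub>R a) \<le> c * r a"
        using a by (simp add: field_simps)
    qed
    moreover have "r v \<le> q v" if "v \<in> V" for v
      using low[OF that, of 0] by simp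
    ultimately have "r x = q x"
      using min x by blast
    then show "q x + q y \<le> q (x + y)"
      using low[OF x, of 1] by simp
  qed
  have neg: "q (- x) = - q x" if "x \<in> V" for x
    using add[of x "- x"] that V sublinear_on_0[OF q(1) V] by (simp add: subspace_neg)
  have "q (c *\<^sub>R x) = c * q x" if "x \<in> V" for c x
  proof (cases "c \<ge> 0")
    case False
    then show ?thesis
      using neg[of "(- c) *\<^sub>R x"] scale[OF that, of "- c"] that V by (simp add: subspace_scale subspace_neg)
  qed (use that scale in auto)
  then show thesis
    using that add q(2) by blast
qed

section \<open>The Riesz representation theorem\<close>

definition Cc :: "('a::topological_space \<Rightarrow> real) set" where
  "Cc = {g. continuous_on UNIV g \<and> (\<exists>K. compact K \<and> (\<forall>x. x \<notin> K \<longrightarrow> g x = 0))}"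

lemma CcI: "continuous_on UNIV g \<Longrightarrow> compact K \<Longrightarrow> (\<And>x. x \<notin> K \<Longrightarrow> g x = 0) \<Longrightarrow> g \<in> Cc"
  by (auto simp: Cc_def)

lemma Cc_continuous: "g \<in> Cc \<Longrightarrow> continuous_on UNIV g"
  by (simp add: Cc_def)

lemma Cc_support: "g \<in> Cc \<Longrightarrow> \<exists>K. compact K \<and> (\<forall>x. x \<notin> K \<longrightarrow> g x = 0)"
  by (simp add: Cc_def)

lemma Cc_zero: "(\<lambda>_. 0) \<in> Cc"
  by (rule CcI[of _ "{}"]) auto

lemma Cc_add:
  assumes "g \<in> Cc" "h \<in> Cc" shows "(\<lambda>x. g x + h x) \<in> Cc"
proof -
  obtain K L where "compact K" "compact L" "\<And>x. x \<notin> K \<Longrightarrow> g x = 0" "\<And>x. x \<notin> L \<Longrightarrow> h x = 0"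
    using assms[THEN Cc_support] by blast
  then show ?thesis
    by (intro CcI[of _ "K \<union> L"] continuous_on_add assms[THEN Cc_continuous] compact_Un) simp_all
qed

lemma Cc_compose:
  assumes "g \<in> Cc" "continuous_on UNIV \<phi>" "\<phi> 0 = 0" shows "(\<lambda>x. \<phi> (g x)) \<in> Cc"
proof -
  obtain K where "compact K" "\<And>x. x \<notin> K \<Longrightarrow> g x = 0"
    using Cc_support[OF assms(1)] by blast
  then show ?thesis
    using continuous_on_compose2[OF assms(2) Cc_continuous[OF assms(1)] subset_UNIV] assms(3)
    by (intro CcI[of _ K]) simp_all
qed

lemma Cc_mult:
  assumes "g \<in> Cc" "continuous_on UNIV h" shows "(\<lambda>x. g x * h x) \<in> Cc"
proof -
  obtain K where "compact K" "\<And>x. x \<notin> K \<Longrightarrow> g x = 0"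
    using Cc_support[OF assms(1)] by blast
  then show ?thesis
    by (intro CcI[of _ K] continuous_on_mult Cc_continuous[OF assms(1)] assms(2)) simp_all
qed

lemma Cc_scale: "g \<in> Cc \<Longrightarrow> (\<lambda>x. c * g x) \<in> Cc"
  by (rule Cc_compose[where \<phi> = "\<lambda>t. c * t"]) (auto intro!: continuous_intros)

lemma Cc_minus: "g \<in> Cc \<Longrightarrow> (\<lambda>x. - g x) \<in> Cc"
  using Cc_scale[of g "- 1"] by simp

lemma Cc_diff: "g \<in> Cc \<Longrightarrow> h \<in> Cc \<Longrightarrow> (\<lambda>x. g x - h x) \<in> Cc"
  using Cc_add[OF _ Cc_minus, of g h] by simp

lemma Cc_abs: "g \<in> Cc \<Longrightarrow> (\<lambda>x. \<bar>g x\<bar>) \<in> Cc"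
  by (rule Cc_compose) (auto intro!: continuous_intros)

lemma Cc_sum: "(\<And>i. i \<in> I \<Longrightarrow> g i \<in> Cc) \<Longrightarrow> (\<lambda>x. \<Sum>i\<in>I. g i x) \<in> Cc"
  by (induction I rule: infinite_finite_induct) (auto intro: Cc_zero Cc_add)

lemma Cc_bounded:
  assumes "g \<in> Cc" shows "\<exists>B>0. \<forall>x. \<bar>g x\<bar> \<le> B"
proof -
  obtain K where K: "compact K" "\<And>x. x \<notin> K \<Longrightarrow> g x = 0"
    using Cc_support[OF assms] by blast
  have "compact (g ` K)"
    using K(1) Cc_continuous[OF assms] by (intro compact_continuous_image) (auto intro: continuous_on_subset)
  then have "bounded (g ` K)"
    by (rule compact_imp_bounded)
  then obtain B where B: "B > 0" "\<And>y. y \<in> g ` K \<Longrightarrow> \<bar>y\<bar> \<le> B"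
    unfolding bounded_pos by auto
  have "\<bar>g x\<bar> \<le> B" for x
    using B K(2)[of x] by (cases "x \<in> K") auto
  then show ?thesis
    using B(1) by blast
qed

section \<open>Separation in locally compact Hausdorff spaces\<close>

lemma Hausdorff_space_t2: "Hausdorff_space (euclidean :: 'a::t2_space topology)"
  unfolding Hausdorff_space_def disjnt_def using hausdorff by fastforce

lemma compact_neighbourhood:
  fixes K :: "'a::t2_space set"
  assumes "locally_compact_space (euclidean :: 'a topology)" "compact K"
  shows "\<exists>V C. open V \<and> compact C \<and> K \<subseteq> V \<and> V \<subseteq> C"
proof -
  have "\<exists>U L. openin euclidean U \<and> compactin euclidean L \<and> closedin euclidean L \<and> K \<subseteq> U \<and> U \<subseteq> L"
    using locally_compact_space_compact_closed_compact[of "euclidean :: 'a topology"]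
      Hausdorff_space_t2[where 'a = 'a] assms
    by (metis compactin_euclidean_iff)
  then obtain U L where "open U" "compact L" "K \<subseteq> U" "U \<subseteq> L"
    by auto
  then show ?thesis
    by (intro exI[of _ U] exI[of _ L]) simp
qed

text \<open>Stronger than a plain separating function: \<open>g\<close> is 1 on an open set around
  \<open>K\<close>, so removing \<open>W\<close> from a compact set leaves a compact set, and
  \<open>g\<close> vanishes off a compact subset of \<open>U\<close>.\<close>

lemma Urysohn_Cc:
  fixes K :: "'a::t2_space set"
  assumes lc: "locally_compact_space (euclidean :: 'a topology)"
    and K: "compact K" and U: "open U" "K \<subseteq> U"
  obtains g W L where "g \<in> Cc" "\<And>x. 0 \<le> g x" "\<And>x. g x \<le> 1" "open W" "K \<subseteq> W" "\<And>x. x \<in> W \<Longrightarrow> g x = 1"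
    "compact L" "L \<subseteq> U" "\<And>x. x \<notin> L \<Longrightarrow> g x = 0"
proof -
  obtain V C where V: "open V" "compact C" "K \<subseteq> V" "V \<subseteq> C"
    using compact_neighbourhood[OF lc K] by blast
  have "completely_regular_space (euclidean :: 'a topology)"
    using lc Hausdorff_space_t2 by (intro locally_compact_regular_imp_completely_regular_space) auto
  moreover have "closed (- (U \<inter> V))" "disjnt K (- (U \<inter> V))"
    using U V by (auto simp: disjnt_def)
  ultimately obtain f :: "'a \<Rightarrow> real" where f: "continuous_on UNIV f" "f ` (- (U \<inter> V)) \<subseteq> {0}" "f ` K \<subseteq> {1}"
    using Urysohn_completely_regular_compact_closed_alt[of "euclidean :: 'a topology" K "- (U \<inter> V)" 0 1] K
    by (auto simp: compactin_euclidean_iff)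
  \<comment> \<open>The truncation sends values of \<open>f\<close> below 1/3 to 0 and above 2/3 to
    1. This leaves room on both sides: \<open>W\<close> is open and contains \<open>K\<close>, while
    \<open>L\<close> is closed and lies in \<open>U \<inter> V\<close>, hence in the compact set
    \<open>C\<close>.\<close>
  define g where "g x = min 1 (max 0 (3 * f x - 1))" for x
  define L where "L = {x. 1 / 3 \<le> f x}"
  define W where "W = {x. 2 / 3 < f x}"
  have LUV: "L \<subseteq> U \<inter> V"
    using f(2) by (force simp: L_def)
  have "closed L"
    unfolding L_def using f(1) by (intro closed_Collect_le continuous_intros)
  moreover have "L \<subseteq> C"
    using LUV V by blast
  ultimately have L: "compact L"
    using compact_Int_closed[OF V(2), of L] by (simp add: Int_absorb1)
  have W: "open W" "K \<subseteq> W"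
    unfolding W_def using f by (auto intro!: open_Collect_less continuous_intros)
  show thesis
  proof
    show "g \<in> Cc"
      using L f(1) by (intro CcI[of _ L]) (auto simp: g_def[abs_def] L_def intro!: continuous_intros)
  qed (use L W LUV in \<open>auto simp: g_def L_def W_def\<close>)
qed

section \<open>Positive functionals and their outer measures\<close>

locale positive_functional =
  fixes \<Lambda> :: "('a::t2_space \<Rightarrow> real) \<Rightarrow> real"
  assumes lc: "locally_compact_space (euclidean :: 'a topology)"
    and add: "g \<in> Cc \<Longrightarrow> h \<in> Cc \<Longrightarrow> \<Lambda> (\<lambda>x. g x + h x) = \<Lambda> g + \<Lambda> h"
    and scale: "g \<in> Cc \<Longrightarrow> \<Lambda> (\<lambda>x. c * g x) = c * \<Lambda> g"
    and nonneg: "g \<in> Cc \<Longrightarrow> (\<And>x. 0 \<le> g x) \<Longrightarrow> 0 \<le> \<Lambda> g"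
begin

lemma zero: "\<Lambda> (\<lambda>_. 0) = 0"
  using scale[OF Cc_zero, of 0] by simp

lemma diff: "g \<in> Cc \<Longrightarrow> h \<in> Cc \<Longrightarrow> \<Lambda> (\<lambda>x. g x - h x) = \<Lambda> g - \<Lambda> h"
  using add[OF _ Cc_minus, of g h] scale[of h "- 1"] by simp

lemma mono: "g \<in> Cc \<Longrightarrow> h \<in> Cc \<Longrightarrow> (\<And>x. g x \<le> h x) \<Longrightarrow> \<Lambda> g \<le> \<Lambda> h"
  using nonneg[OF Cc_diff, of h g] diff[of h g] by simp

lemma sum: "(\<And>i. i \<in> I \<Longrightarrow> g i \<in> Cc) \<Longrightarrow> \<Lambda> (\<lambda>x. \<Sum>i\<in>I. g i x) = (\<Sum>i\<in>I. \<Lambda> (g i))"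
  by (induction I rule: infinite_finite_induct) (auto simp: zero add Cc_sum)

text \<open>The relation usually written g \<prec> U in the Riesz theorem.\<close>

definition subordinate :: "'a set \<Rightarrow> ('a \<Rightarrow> real) set" where
  "subordinate U = {g \<in> Cc. (\<forall>x. 0 \<le> g x \<and> g x \<le> 1) \<and>
     (\<exists>L. compact L \<and> L \<subseteq> U \<and> (\<forall>x. x \<notin> L \<longrightarrow> g x = 0))}"

definition content :: "'a set \<Rightarrow> ennreal" where
  "content U = (SUP g\<in>subordinate U. ennreal (\<Lambda> g))"

definition outer :: "'a set \<Rightarrow> ennreal" where
  "outer A = (INF U\<in>{U. open U \<and> A \<subseteq> U}. content U)"

lemma subordinate_Cc: "g \<in> subordinate U \<Longrightarrow> g \<in> Cc"
  by (simp add: subordinate_def)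

lemma zero_subordinate: "(\<lambda>_. 0) \<in> subordinate U"
  using Cc_zero by (auto simp: subordinate_def intro!: exI[of _ "{}"])

lemma content_upper: "g \<in> subordinate U \<Longrightarrow> ennreal (\<Lambda> g) \<le> content U"
  unfolding content_def by (rule SUP_upper)

lemma content_mono: "U \<subseteq> V \<Longrightarrow> content U \<le> content V"
  unfolding content_def subordinate_def by (rule SUP_subset_mono) auto

text \<open>A two-piece partition of unity: \<open>h\<close> is 1 near the part of the carrier
  \<open>L\<close> outside \<open>V\<close> and is carried inside \<open>U\<close>. Then g = g h + g
  (1 - h), where the second summand vanishes off \<open>L - W\<close>, a compact subset of
  \<open>V\<close>.\<close>

lemma content_Un:
  assumes "open U" "open V"
  shows "content (U \<union> V) \<le> content U + content V"
  unfolding content_def[of "U \<union> V"]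
proof (rule SUP_least)
  fix g assume g: "g \<in> subordinate (U \<union> V)"
  then obtain L where L: "compact L" "L \<subseteq> U \<union> V" "\<And>x. x \<notin> L \<Longrightarrow> g x = 0"
    and g': "g \<in> Cc" "\<And>x. 0 \<le> g x" "\<And>x. g x \<le> 1"
    by (auto simp: subordinate_def)
  have "compact (L - V)" "L - V \<subseteq> U"
    using L assms by (auto intro: compact_diff)
  then obtain h W M where h: "h \<in> Cc" "\<And>x. 0 \<le> h x" "\<And>x. h x \<le> 1" "open W" "L - V \<subseteq> W"
     "\<And>x. x \<in> W \<Longrightarrow> h x = 1" "compact M" "M \<subseteq> U" "\<And>x. x \<notin> M \<Longrightarrow> h x = 0"
    using Urysohn_Cc[OF lc _ assms(1)] by metis
  have "continuous_on UNIV h"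
    using h(1) by (rule Cc_continuous)
  then have C: "(\<lambda>x. g x * h x) \<in> Cc" "(\<lambda>x. g x * (1 - h x)) \<in> Cc"
    using g'(1) by (auto intro!: Cc_mult continuous_intros)
  have "(\<lambda>x. g x * h x) \<in> subordinate U"
    using C(1) h g' unfolding subordinate_def by (auto intro!: mult_le_one exI[of _ M])
  moreover have "compact (L - W)"
    using L(1) h(4) by (rule compact_diff)
  then have "(\<lambda>x. g x * (1 - h x)) \<in> subordinate V"
    using C(2) h(2-6) g' L unfolding subordinate_def
    by (auto intro!: mult_le_one exI[of _ "L - W"]) (metis)
  ultimately have "ennreal (\<Lambda> (\<lambda>x. g x * h x)) + ennreal (\<Lambda> (\<lambda>x. g x * (1 - h x))) \<le> content U + content V"
    by (intro add_mono content_upper)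
  moreover have "\<Lambda> g = \<Lambda> (\<lambda>x. g x * h x) + \<Lambda> (\<lambda>x. g x * (1 - h x))"
    using add[OF C] by (simp add: algebra_simps)
  ultimately show "ennreal (\<Lambda> g) \<le> content U + content V"
    using nonneg[OF C(1)] nonneg[OF C(2)] g' h by (simp add: ennreal_plus)
qed

lemma content_UN_lessThan:
  assumes "\<And>i. open (U i)"
  shows "content (\<Union>i<n. U i) \<le> (\<Sum>i<n::nat. content (U i))"
proof (induction n)
  case 0
  have "content {} = 0"
    unfolding content_def
  proof (rule antisym[OF SUP_least])
    fix g assume "g \<in> subordinate {}"
    then have "g = (\<lambda>_. 0)"
      by (auto simp: subordinate_def)
    then show "ennreal (\<Lambda> g) \<le> 0"
      by (simp add: zero)
  qed simp
  then show ?case by simp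
next
  case (Suc n)
  have "content (\<Union>i<Suc n. U i) = content ((\<Union>i<n. U i) \<union> U n)"
    by (simp add: lessThan_Suc Un_commute)
  also have "\<dots> \<le> content (\<Union>i<n. U i) + content (U n)"
    using assms by (intro content_Un) auto
  finally show ?case
    using Suc add_right_mono order_trans by fastforce
qed

text \<open>The carrier of a subordinate function is compact and meets only finitely many of the
  sets needed to cover it, so finite subadditivity suffices.\<close>

lemma content_UN:
  assumes "\<And>i. open (U i)"
  shows "content (\<Union>i. U i) \<le> (\<Sum>i::nat. content (U i))"
  unfolding content_def[of "\<Union>i. U i"]
proof (rule SUP_least)
  fix g assume g: "g \<in> subordinate (\<Union>i. U i)"
  then obtain L where L: "compact L" "L \<subseteq> (\<Union>i. U i)" "\<And>x. x \<notin> L \<Longrightarrow> g x = 0"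
    by (auto simp: subordinate_def)
  obtain I where I: "finite I" "L \<subseteq> (\<Union>i\<in>I. U i)"
    using compactE_image[OF L(1), of UNIV U] assms L(2) by auto
  then obtain n where "I \<subseteq> {..<n}"
    using finite_nat_iff_bounded by blast
  then have "L \<subseteq> (\<Union>i<n. U i)"
    using I by blast
  then have "g \<in> subordinate (\<Union>i<n. U i)"
    using g L by (auto simp: subordinate_def)
  then have "ennreal (\<Lambda> g) \<le> content (\<Union>i<n. U i)"
    by (rule content_upper)
  also have "\<dots> \<le> (\<Sum>i<n. content (U i))"
    using assms by (rule content_UN_lessThan)
  also have "\<dots> \<le> (\<Sum>i. content (U i))"
    by (rule sum_le_suminf) auto
  finally show "ennreal (\<Lambda> g) \<le> (\<Sum>i. content (U i))" .
qed

lemma outer_open: "open U \<Longrightarrow> outer U = content U"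
  unfolding outer_def by (rule antisym) (auto intro!: INF_lower INF_greatest content_mono)

lemma outer_mono: "A \<subseteq> B \<Longrightarrow> outer A \<le> outer B"
  unfolding outer_def by (rule INF_superset_mono) auto

lemma outer_le: "open U \<Longrightarrow> A \<subseteq> U \<Longrightarrow> outer A \<le> content U"
  unfolding outer_def by (rule INF_lower) auto

lemma outer_UN: "outer (\<Union>i. A i) \<le> (\<Sum>i::nat. outer (A i))"
proof (rule ennreal_le_epsilon)
  fix e :: real assume e: "0 < e" and fin: "(\<Sum>i. outer (A i)) < top"
  have "\<exists>U. open U \<and> A i \<subseteq> U \<and> content U \<le> outer (A i) + e * (1/2) ^ Suc i" for i
  proof -
    have "outer (A i) \<noteq> \<infinity>"
      using ennreal_suminf_lessD[OF fin, of i] by simp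
    then obtain U where "U \<in> {U. open U \<and> A i \<subseteq> U}" "content U \<le> outer (A i) + ennreal (e * (1/2) ^ Suc i)"
      using INF_approx_ennreal[OF _ outer_def[of "A i"], of "e * (1/2) ^ Suc i"] e by auto
    then show ?thesis
      using e by (auto simp: ennreal_mult)
  qed
  then obtain U where U: "\<And>i. open (U i)" "\<And>i. A i \<subseteq> U i"
      "\<And>i. content (U i) \<le> outer (A i) + e * (1/2) ^ Suc i"
    by metis
  have "outer (\<Union>i. A i) \<le> content (\<Union>i. U i)"
    using U by (intro outer_le) auto
  also have "\<dots> \<le> (\<Sum>i. content (U i))"
    using U(1) by (rule content_UN)
  also have "\<dots> \<le> (\<Sum>i. outer (A i) + e * (1/2) ^ Suc i)"
    using U(3) by (intro suminf_le) auto
  also have "\<dots> = (\<Sum>i. outer (A i)) + (\<Sum>i. ennreal e * ennreal ((1/2) ^ Suc i))"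
    using e by (subst suminf_add[symmetric])
      (auto simp del: ennreal_suminf_cmult simp add: ennreal_mult[symmetric])
  also have "\<dots> = (\<Sum>i. outer (A i)) + e"
    unfolding ennreal_suminf_cmult
    by (subst suminf_ennreal_eq[OF zero_le_power power_half_series]) auto
  finally show "outer (\<Union>i. A i) \<le> (\<Sum>i. outer (A i)) + e" .
qed

lemma outer_empty: "outer {} = 0"
  using outer_open[of "{}"] content_UN_lessThan[of "\<lambda>_. {}" 0] by simp

lemma outer_measure_space_outer: "outer_measure_space (Pow UNIV) outer"
  unfolding outer_measure_space_def positive_def increasing_def countably_subadditive_def
  using outer_empty outer_mono outer_UN by auto

lemma outer_Un: "outer (A \<union> B) \<le> outer A + outer B"
proof -
  have "outer (A \<union> B) = outer (\<Union>i. binaryset A B i)"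
    by (simp add: UN_binaryset_eq)
  also have "\<dots> \<le> (\<Sum>i. outer (binaryset A B i))"
    by (rule outer_UN)
  also have "\<dots> = outer A + outer B"
    using outer_empty by (subst suminf_binaryset_eq) auto
  finally show ?thesis .
qed

text \<open>Caratheodory's inequality for an open test set. If \<open>g\<close> is carried by
  \<open>L\<close> inside \<open>V \<inter> U\<close> and \<open>h\<close> is carried inside
  \<open>V - L\<close>, the carriers are disjoint, so g + h is still at most 1 and subordinate to
  \<open>V\<close>. Moreover \<open>V - L\<close> is an open set containing
  \<open>V - U\<close>.\<close>

lemma content_split:
  assumes "open U" "open V"
  shows "content (V \<inter> U) + outer (V - U) \<le> content V"
proof -
  have "ennreal (\<Lambda> g) + outer (V - U) \<le> content V" if g: "g \<in> subordinate (V \<inter> U)" for g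
  proof -
    obtain L where L: "compact L" "L \<subseteq> V \<inter> U" "\<And>x. x \<notin> L \<Longrightarrow> g x = 0"
      and g': "g \<in> Cc" "\<And>x. 0 \<le> g x" "\<And>x. g x \<le> 1"
      using g by (auto simp: subordinate_def)
    have o: "open (V - L)"
      using assms(2) L(1) by (intro open_Diff compact_imp_closed)
    have "ennreal (\<Lambda> g) + ennreal (\<Lambda> h) \<le> content V" if h: "h \<in> subordinate (V - L)" for h
    proof -
      obtain M where M: "compact M" "M \<subseteq> V - L" "\<And>x. x \<notin> M \<Longrightarrow> h x = 0"
        and h': "h \<in> Cc" "\<And>x. 0 \<le> h x" "\<And>x. h x \<le> 1"
        using h by (auto simp: subordinate_def)
      have "g x + h x \<le> 1" for x
        using L M g'(3)[of x] h'(3)[of x] by (cases "x \<in> L"; cases "x \<in> M") auto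
      moreover have "compact (L \<union> M)" "L \<union> M \<subseteq> V" "\<And>x. x \<notin> L \<union> M \<Longrightarrow> g x + h x = 0"
        using L M by auto
      ultimately have "(\<lambda>x. g x + h x) \<in> subordinate V"
        using Cc_add[OF g'(1) h'(1)] g'(2) h'(2) unfolding subordinate_def
        by (auto simp del: Un_iff intro!: exI[of _ "L \<union> M"])
      from content_upper[OF this] show ?thesis
        using add[OF g'(1) h'(1)] nonneg[OF g'(1,2)] nonneg[OF h'(1,2)] by (simp add: ennreal_plus)
    qed
    then have "ennreal (\<Lambda> g) + content (V - L) \<le> content V"
      unfolding content_def[of "V - L"] using zero_subordinate
      by (subst ennreal_SUP_add_right) (auto intro!: SUP_least)
    moreover have "outer (V - U) \<le> content (V - L)"
      using o L by (intro outer_le) auto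
    ultimately show ?thesis
      using add_left_mono order_trans by blast
  qed
  then show ?thesis
    unfolding content_def[of "V \<inter> U"] using zero_subordinate
    by (subst ennreal_SUP_add_left[symmetric]) (auto intro!: SUP_least)
qed

lemma open_in_lambda_system:
  assumes "open U" shows "U \<in> lambda_system UNIV (Pow UNIV) outer"
proof -
  have "outer (A \<inter> U) + outer (A - U) = outer A" for A
  proof (rule antisym)
    show "outer A \<le> outer (A \<inter> U) + outer (A - U)"
      using outer_Un[of "A \<inter> U" "A - U"] by (simp add: Int_Diff_Un)
    show "outer (A \<inter> U) + outer (A - U) \<le> outer A"
      unfolding outer_def[of A]
    proof (rule INF_greatest)
      fix V assume V: "V \<in> {V. open V \<and> A \<subseteq> V}"
      then have "outer (A \<inter> U) + outer (A - U) \<le> content (V \<inter> U) + outer (V - U)"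
        using assms by (intro add_mono outer_le outer_mono) auto
      also have "\<dots> \<le> content V"
        using V assms by (intro content_split) auto
      finally show "outer (A \<inter> U) + outer (A - U) \<le> content V" .
    qed
  qed
  then show ?thesis
    by (simp add: lambda_system_def Int_commute Diff_eq)
qed

section \<open>The Riesz measure, its values on compact sets and its regularity\<close>

definition riesz_measure :: "'a measure" where
  "riesz_measure = measure_of UNIV (sets borel) outer"

lemma sets_riesz_measure: "sets riesz_measure = sets borel"
  unfolding riesz_measure_def using sets.sigma_sets_eq[of borel] by (simp add: sets_measure_of)

lemma emeasure_riesz_measure:
  assumes "A \<in> sets borel" shows "emeasure riesz_measure A = outer A"
proof -
  have ms: "measure_space UNIV (lambda_system UNIV (Pow UNIV) outer) outer"
    using sigma_algebra.caratheodory_lemma[OF sigma_algebra_Pow outer_measure_space_outer] .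
  have "sigma_sets UNIV {S. open S} \<subseteq> lambda_system UNIV (Pow UNIV) outer"
    using ms open_in_lambda_system unfolding measure_space_def
    by (intro sigma_algebra.sigma_sets_subset) auto
  then have "sets borel \<subseteq> lambda_system UNIV (Pow UNIV) outer"
    by (simp add: borel_def)
  then have "measure_space UNIV (sets borel) outer"
    using measure_down[OF ms] sets.sigma_algebra_axioms[of borel] by simp
  then show ?thesis
    unfolding riesz_measure_def
    by (intro emeasure_measure_of_sigma) (use assms sets.sigma_algebra_axioms[of borel] in \<open>auto simp: measure_space_def\<close>)
qed

text \<open>For c < 1 the set where k > c is open and contains \<open>K\<close>, and every
  \<open>g\<close> subordinate to it satisfies c g \<le> k. Letting c tend to 1 removes the loss;
  the choice c = 1/2 first shows that the outer measure is finite, so that the limit can be taken in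
  the reals.\<close>

lemma outer_compact_le:
  assumes K: "compact K" and k: "k \<in> Cc" "\<And>x. 0 \<le> k x" "\<And>x. x \<in> K \<Longrightarrow> 1 \<le> k x"
  shows "outer K \<le> ennreal (\<Lambda> k)"
proof -
  have *: "outer K \<le> ennreal (\<Lambda> k / c)" if c: "0 < c" "c < 1" for c
  proof -
    define U where "U = {x. c < k x}"
    have "open U" "K \<subseteq> U"
      using c k Cc_continuous[OF k(1)] unfolding U_def
      by (fastforce intro!: open_Collect_less continuous_intros)+
    then have "outer K \<le> content U"
      by (rule outer_le)
    also have "\<dots> \<le> ennreal (\<Lambda> k / c)"
      unfolding content_def
    proof (intro SUP_least ennreal_leI)
      fix g assume g: "g \<in> subordinate U"
      have "c * g x \<le> k x" for x
      proof (cases "x \<in> U")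
        case True
        have "c * g x \<le> c * 1"
          using g c by (intro mult_left_mono) (auto simp: subordinate_def)
        then show ?thesis
          using True by (simp add: U_def)
      next
        case False
        then show ?thesis
          using g k(2)[of x] by (auto simp: subordinate_def)
      qed
      then have "\<Lambda> (\<lambda>x. c * g x) \<le> \<Lambda> k"
        using k(1) subordinate_Cc[OF g] by (intro mono Cc_scale) auto
      then show "\<Lambda> g \<le> \<Lambda> k / c"
        using scale[OF subordinate_Cc[OF g]] c by (simp add: field_simps)
    qed
    finally show ?thesis .
  qed
  then have fin: "outer K < top"
    using *[of "1/2"] by (simp add: le_less_trans)
  then obtain r where r: "outer K = ennreal r" "r \<ge> 0"
    by (metis ennreal_cases not_le order_refl top.not_eq_extremum)
  have "0 \<le> \<Lambda> k"
    using k by (intro nonneg)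
  have "c * r \<le> \<Lambda> k" if "0 < c" "c < 1" for c
  proof -
    have "r \<le> \<Lambda> k / c"
      using *[OF that] r that \<open>0 \<le> \<Lambda> k\<close> by (simp add: ennreal_le_iff)
    then show ?thesis
      using that by (simp add: field_simps)
  qed
  then have "r \<le> \<Lambda> k"
    by (rule field_le_mult_one_interval) 
  then show ?thesis
    using r by (simp add: ennreal_leI)
qed

lemma outer_compact_finite:
  assumes "compact K" shows "outer K < \<infinity>"
proof -
  obtain k W L where "k \<in> Cc" "\<And>x. 0 \<le> k x" "K \<subseteq> W" "\<And>x. x \<in> W \<Longrightarrow> k x = 1"
    by (rule Urysohn_Cc[OF lc assms open_UNIV]) auto
  then have "outer K \<le> ennreal (\<Lambda> k)"
    using assms by (intro outer_compact_le) (auto simp: subset_iff)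
  then show ?thesis
    by (simp add: le_less_trans)
qed

lemma le_outer_compact:
  assumes K: "compact K" and k: "k \<in> Cc" "\<And>x. 0 \<le> k x" "\<And>x. k x \<le> 1" "\<And>x. x \<notin> K \<Longrightarrow> k x = 0"
  shows "ennreal (\<Lambda> k) \<le> outer K"
  unfolding outer_def
proof (rule INF_greatest)
  fix U assume "U \<in> {U. open U \<and> K \<subseteq> U}"
  then have "k \<in> subordinate U"
    using assms by (auto simp: subordinate_def)
  then show "ennreal (\<Lambda> k) \<le> content U"
    by (rule content_upper)
qed

lemma regular_riesz_measure: "regular_borel_measure riesz_measure"
  unfolding regular_borel_measure_def
proof (intro conjI allI impI ballI)
  fix K :: "'a set" assume "compact K"
  then show "emeasure riesz_measure K < \<infinity>"
    using outer_compact_finite by (simp add: emeasure_riesz_measure borel_compact)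
next
  fix A :: "'a set" assume "A \<in> sets borel"
  then show "emeasure riesz_measure A = (INF U\<in>{U. open U \<and> A \<subseteq> U}. emeasure riesz_measure U)"
    by (auto simp: emeasure_riesz_measure outer_def[of A] outer_open intro!: INF_cong)
next
  fix U :: "'a set" assume U: "open U"
  have "outer U = (SUP K\<in>{K. compact K \<and> K \<subseteq> U}. outer K)"
  proof (rule antisym)
    show "outer U \<le> (SUP K\<in>{K. compact K \<and> K \<subseteq> U}. outer K)"
      unfolding outer_open[OF U] content_def
    proof (rule SUP_least)
      fix g assume g: "g \<in> subordinate U"
      then obtain L where L: "compact L" "L \<subseteq> U" "\<And>x. x \<notin> L \<Longrightarrow> g x = 0"
        by (auto simp: subordinate_def)
      then have "ennreal (\<Lambda> g) \<le> outer L"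
        using g by (intro le_outer_compact) (auto simp: subordinate_def)
      also have "\<dots> \<le> (SUP K\<in>{K. compact K \<and> K \<subseteq> U}. outer K)"
        using L by (intro SUP_upper) auto
      finally show "ennreal (\<Lambda> g) \<le> (SUP K\<in>{K. compact K \<and> K \<subseteq> U}. outer K)" .
    qed
  qed (auto intro!: SUP_least outer_mono)
  then show "emeasure riesz_measure U = (SUP K\<in>{K. compact K \<and> K \<subseteq> U}. emeasure riesz_measure K)"
    using U by (auto simp: emeasure_riesz_measure borel_compact intro!: SUP_cong)
qed (rule sets_riesz_measure)

section \<open>The integral agrees with the functional\<close>

lemma integrable_Cc:
  assumes "g \<in> Cc" shows "integrable riesz_measure g"
proof -
  obtain K where K: "compact K" "\<And>x. x \<notin> K \<Longrightarrow> g x = 0"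
    using Cc_support[OF assms] by blast
  obtain B where B: "\<And>x. \<bar>g x\<bar> \<le> B"
    using Cc_bounded[OF assms] by blast
  have m: "g \<in> borel_measurable riesz_measure"
    using Cc_continuous[OF assms] by (simp add: measurable_cong_sets[OF sets_riesz_measure refl] borel_measurable_continuous_onI)
  have Ks: "K \<in> sets riesz_measure"
    using K(1) by (simp add: sets_riesz_measure borel_compact)
  show ?thesis
  proof (rule Bochner_Integration.integrable_bound[OF _ m])
    show "integrable riesz_measure (\<lambda>x. B * indicator K x :: real)"
      using Ks outer_compact_finite[OF K(1)] K(1)
      by (intro integrable_mult_right integrable_real_indicator) (auto simp: emeasure_riesz_measure borel_compact)
    show "AE x in riesz_measure. norm (g x) \<le> norm (B * indicator K x)"
    proof (rule AE_I2)
      fix x show "norm (g x) \<le> norm (B * indicator K x)"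
        using K(2)[of x] B[of x] by (cases "x \<in> K") auto
    qed
  qed
qed

text \<open>Cut \<open>g\<close> into horizontal slices of height \<open>d\<close>. The integral and \<open>\<Lambda>\<close> of the \<open>i\<close>-th slice both
  lie between \<open>d \<mu>(K (i + 1))\<close> and \<open>d \<mu>(K i)\<close>, and the differences telescope.\<close>

lemma slice_estimate:
  assumes g: "g \<in> Cc" "\<And>x. 0 \<le> g x" "\<And>x. g x \<le> real n * d" and d: "d > 0"
    and S: "compact S" "\<And>x. x \<notin> S \<Longrightarrow> g x = 0"
  shows "\<bar>\<Lambda> g - (LINT x|riesz_measure. g x)\<bar> \<le> d * measure riesz_measure S"
proof -
  let ?\<mu> = "measure riesz_measure"
  \<comment> \<open>At level 0 the set of x with g x \<ge> 0 would be the whole space; the carrier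
    \<open>S\<close> takes its place, so all \<open>K i\<close> are compact and of finite
    measure.\<close>
  define K where "K i = (if i = 0 then S else {x. real i * d \<le> g x})" for i :: nat
  define s where "s i x = max 0 (min d (g x - real i * d))" for i :: nat and x
  have "closed {x. real i * d \<le> g x}" for i
    using Cc_continuous[OF g(1)] by (intro closed_Collect_le continuous_intros)
  moreover have sub: "K i \<subseteq> S" for i
  proof
    fix x assume "x \<in> K i"
    then show "x \<in> S"
      using S(2)[of x] d mult_pos_pos[of "real i" d] by (cases "i = 0") (fastforce simp: K_def)+
  qed
  ultimately have K: "compact (K i)" for i
    using S(1) compact_Int_closed[OF S(1), of "K i"] sub[of i] by (cases "i = 0") (auto simp: K_def Int_absorb1)
  have K_eq: "emeasure riesz_measure (K i) = ennreal (?\<mu> (K i))" "outer (K i) = ennreal (?\<mu> (K i))" for i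
    using outer_compact_finite[OF K, of i] K[of i]
    by (simp_all add: emeasure_eq_ennreal_measure emeasure_riesz_measure borel_compact flip: emeasure_riesz_measure)
  have sC: "s i \<in> Cc" for i
    unfolding s_def[abs_def]
  proof (rule Cc_compose[OF g(1), of "\<lambda>t. max 0 (min d (t - real i * d))"])
    have "0 \<le> real i * d"
      using d by simp
    then show "max 0 (min d (0 - real i * d)) = 0"
      by linarith
  qed (intro continuous_intros)
  have sum_min: "(\<Sum>i<m. s i x) = min (g x) (real m * d)" for m x
  proof (induction m)
    case (Suc m)
    then show ?case
      using d g(2)[of x] by (auto simp: s_def algebra_simps min_def max_def)
  qed (use g(2)[of x] in auto)
  have slices: "(\<Sum>i<n. s i x) = g x" for x
    using sum_min[of x n] g(3)[of x] by simp
  have hi: "s i x \<le> d * indicator (K i) x" and lo: "d * indicator (K (Suc i)) x \<le> s i x" for i x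
  proof -
    show "s i x \<le> d * indicator (K i) x"
      using S(2)[of x] d by (cases "i = 0") (auto simp: s_def K_def indicator_def)
    show "d * indicator (K (Suc i)) x \<le> s i x"
      using d by (auto simp: s_def K_def indicator_def algebra_simps)
  qed
  have s0: "0 \<le> s i x" for i x
    by (simp add: s_def)
  have ind: "integrable riesz_measure (\<lambda>x. d * indicator (K i) x :: real)"
    "(LINT x|riesz_measure. d * indicator (K i) x) = d * ?\<mu> (K i)" for i
  proof -
    have Ks: "K i \<in> sets riesz_measure"
      using K by (simp add: sets_riesz_measure borel_compact)
    then show "integrable riesz_measure (\<lambda>x. d * indicator (K i) x :: real)"
      using K_eq(1)[of i] by (intro integrable_mult_right integrable_real_indicator) auto
    show "(LINT x|riesz_measure. d * indicator (K i) x) = d * ?\<mu> (K i)"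
      using Ks by simp
  qed
  have int_hi: "(LINT x|riesz_measure. s i x) \<le> d * ?\<mu> (K i)" for i
    using integral_mono[OF integrable_Cc[OF sC] ind(1) hi] unfolding ind(2) .
  have int_lo: "d * ?\<mu> (K (Suc i)) \<le> (LINT x|riesz_measure. s i x)" for i
    using integral_mono[OF ind(1) integrable_Cc[OF sC] lo] unfolding ind(2) .
  have scaled: "(\<lambda>x. (1 / d) * s i x) \<in> Cc" "\<Lambda> (\<lambda>x. (1 / d) * s i x) = \<Lambda> (s i) / d" for i
    using Cc_scale[OF sC, of "1 / d"] scale[OF sC, of "1 / d"] by simp_all
  have L_hi: "\<Lambda> (s i) \<le> d * ?\<mu> (K i)" for i
  proof -
    have "ennreal (\<Lambda> (\<lambda>x. (1 / d) * s i x)) \<le> outer (K i)"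
    proof (rule le_outer_compact[OF K scaled(1)])
      fix x
      have "s i x \<le> d * 1"
        using hi[of i x] d by (cases "x \<in> K i") auto
      then show "1 / d * s i x \<le> 1"
        using d by (simp add: field_simps)
      show "1 / d * s i x = 0" if "x \<notin> K i"
        using hi[of i x] s0[of i x] that by simp
    qed (use s0 d in auto)
    then show ?thesis
      unfolding K_eq scaled using d by (simp add: divide_le_eq mult.commute)
  qed
  have L_lo: "d * ?\<mu> (K (Suc i)) \<le> \<Lambda> (s i)" for i
  proof -
    have "outer (K (Suc i)) \<le> ennreal (\<Lambda> (\<lambda>x. (1 / d) * s i x))"
    proof (rule outer_compact_le[OF K scaled(1)])
      fix x assume "x \<in> K (Suc i)"
      then show "1 \<le> 1 / d * s i x"
        using lo[of i x] d by (simp add: field_simps)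
    qed (use s0 d in auto)
    moreover have "0 \<le> \<Lambda> (s i)"
      using sC s0 by (rule nonneg)
    ultimately show ?thesis
      unfolding K_eq scaled using d by (simp add: le_divide_eq mult.commute)
  qed
  have "\<Lambda> g - (LINT x|riesz_measure. g x) = (\<Sum>i<n. \<Lambda> (s i) - (LINT x|riesz_measure. s i x))"
    using sum[of "{..<n}" s] sC integrable_Cc[OF sC]
    by (simp add: slices sum_subtractf Bochner_Integration.integral_sum[symmetric])
  also have "\<bar>\<dots>\<bar> \<le> (\<Sum>i<n. d * ?\<mu> (K i) - d * ?\<mu> (K (Suc i)))"
    using int_hi int_lo L_hi L_lo by (intro order_trans[OF sum_abs] sum_mono) (smt (verit))
  also have "\<dots> = d * ?\<mu> (K 0) - d * ?\<mu> (K n)"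
    by (rule sum_lessThan_telescope')
  also have "\<dots> \<le> d * ?\<mu> S"
    using d by (simp add: K_def)
  finally show ?thesis .
qed

text \<open>With n + 1 slices of height B / (n + 1) the estimate is a constant divided by n +
  1.\<close>

lemma riesz_nonneg:
  assumes g: "g \<in> Cc" "\<And>x. 0 \<le> g x"
  shows "(LINT x|riesz_measure. g x) = \<Lambda> g"
proof -
  obtain S where S: "compact S" "\<And>x. x \<notin> S \<Longrightarrow> g x = 0"
    using Cc_support[OF g(1)] by blast
  obtain B where B: "B > 0" "\<And>x. \<bar>g x\<bar> \<le> B"
    using Cc_bounded[OF g(1)] by blast
  have "\<bar>\<Lambda> g - (LINT x|riesz_measure. g x)\<bar> \<le> B / real (Suc n) * measure riesz_measure S" for n
  proof (rule slice_estimate[OF g _ _ S, where n = "Suc n"])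
    show "g x \<le> real (Suc n) * (B / real (Suc n))" for x
      using B(2)[of x] by simp
  qed (use B in auto)
  moreover have "(\<lambda>n. B / real (Suc n) * measure riesz_measure S) \<longlonglongrightarrow> 0"
    by (intro tendsto_mult_left_zero LIMSEQ_Suc[OF lim_const_over_n])
  ultimately have "\<bar>\<Lambda> g - (LINT x|riesz_measure. g x)\<bar> \<le> 0"
    by (intro LIMSEQ_le_const) auto
  then show ?thesis by simp
qed

theorem riesz_representation:
  assumes g: "g \<in> Cc" shows "(LINT x|riesz_measure. g x) = \<Lambda> g"
proof -
  define p where "p x = max 0 (g x)" for x
  define q where "q x = max 0 (- g x)" for x
  have pq: "p \<in> Cc" "q \<in> Cc"
    unfolding p_def[abs_def] q_def[abs_def]
    by (rule Cc_compose[OF g]; force intro: continuous_intros)+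
  have eq: "g = (\<lambda>x. p x - q x)"
    by (auto simp: p_def q_def)
  have "(LINT x|riesz_measure. g x) = (LINT x|riesz_measure. p x) - (LINT x|riesz_measure. q x)"
    unfolding eq using integrable_Cc pq by (intro Bochner_Integration.integral_diff)
  also have "\<dots> = \<Lambda> p - \<Lambda> q"
    using pq by (subst (1 2) riesz_nonneg) (auto simp: p_def q_def)
  also have "\<dots> = \<Lambda> g"
    unfolding eq using pq by (intro diff[symmetric])
  finally show ?thesis .
qed

end

section \<open>Compactly supported probability measures\<close>

text \<open>The values of a non-negative \<mu> form a measure \<open>N\<close>, and
  \<open>variation_nonneg\<close> identifies the variation with \<open>N\<close>. From here on
  integrals against such measures are Lebesgue integrals, and the Jordan decompositions
  disappear.\<close>

lemma pos_radon_measure: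
  assumes \<mu>: "\<mu> \<in> pos_radon_measures"
  shows "finite_measure (variation \<mu>)" "sets (variation \<mu>) = sets borel"
    "\<And>A. A \<in> sets borel \<Longrightarrow> \<mu> A = of_real (measure (variation \<mu>) A)"
    "\<And>f. cintegral \<mu> f = (LINT x|variation \<mu>. f x)"
    "regular_borel_measure (variation \<mu>)"
proof -
  have r: "complex_borel_measure \<mu>" "regular_borel_measure (variation \<mu>)" and pos: "\<And>A. 0 \<le> \<mu> A"
    using \<mu> by (auto simp: pos_radon_measures_def radon_measures_def)
  have Re: "0 \<le> Re (\<mu> A)" "\<mu> A = of_real (Re (\<mu> A))" for A
    using pos[of A] by (auto simp: less_eq_complex_def complex_eq_iff)
  have sums: "(\<lambda>i. \<mu> (A i)) sums \<mu> (\<Union>i. A i)" if "range A \<subseteq> sets borel" "disjoint_family A" for A :: "nat \<Rightarrow> 'a set"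
    using r(1) that by (auto simp: complex_borel_measure_def)
  \<comment> \<open>Additivity on the constant sequence of empty sets: a convergent series with
    constant terms has terms 0.\<close>
  have "(\<lambda>i::nat. \<mu> {}) sums \<mu> {}"
    using sums[of "\<lambda>_. {}"] by (simp add: disjoint_family_on_def)
  then have "(\<lambda>i::nat. \<mu> {}) \<longlonglongrightarrow> 0"
    by (intro summable_LIMSEQ_zero sums_summable)
  then have empty: "\<mu> {} = 0"
    by (simp add: LIMSEQ_const_iff)
  define N where "N = measure_of UNIV (sets borel) (\<lambda>A. ennreal (Re (\<mu> A)))"
  have sets_N: "sets N = sets borel"
    unfolding N_def using sets.sigma_sets_eq[of borel] by (simp add: sets_measure_of)
  have emeasure_N: "emeasure N A = ennreal (Re (\<mu> A))" if "A \<in> sets borel" for A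
    unfolding N_def
  proof (rule emeasure_measure_of_sigma)
    show "sigma_algebra UNIV (sets (borel :: 'a measure))"
      using sets.sigma_algebra_axioms[of borel] by simp
    show "countably_additive (sets borel) (\<lambda>A. ennreal (Re (\<mu> A)))"
      unfolding countably_additive_def
    proof (intro allI impI)
      fix A :: "nat \<Rightarrow> 'a set" assume "range A \<subseteq> sets borel" "disjoint_family A"
      then have "(\<lambda>i. Re (\<mu> (A i))) sums Re (\<mu> (\<Union>i. A i))"
        using sums sums_Re by blast
      then show "(\<Sum>i. ennreal (Re (\<mu> (A i)))) = ennreal (Re (\<mu> (\<Union>i. A i)))"
        using Re by (intro suminf_ennreal_eq)
    qed
  qed (use that empty in \<open>auto simp: positive_def\<close>)
  have sp: "space N = UNIV"
    using sets_eq_imp_space_eq[OF sets_N] by simp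
  have fin: "finite_measure N"
    by (rule finite_measureI) (simp add: sp emeasure_N)
  have eq: "\<mu> A = of_real (measure N A)" if "A \<in> sets borel" for A
    using Re that by (simp add: measure_def emeasure_N)
  have "variation \<mu> = N"
    by (rule variation_nonneg[OF fin sets_N eq])
  then show "finite_measure (variation \<mu>)" "sets (variation \<mu>) = sets borel"
    "\<And>A. A \<in> sets borel \<Longrightarrow> \<mu> A = of_real (measure (variation \<mu>) A)"
    "\<And>f. cintegral \<mu> f = (LINT x|variation \<mu>. f x)"
    using fin sets_N eq cintegral_nonneg[OF fin sets_N eq] by simp_all
qed (use \<mu> in \<open>auto simp: pos_radon_measures_def radon_measures_def\<close>)

lemma pos_radon_measureI:
  fixes N :: "'a::t2_space measure"
  assumes fin: "finite_measure N" and sets_N: "sets N = sets borel" and reg: "regular_borel_measure N"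
  defines "\<mu> \<equiv> \<lambda>A. if A \<in> sets borel then complex_of_real (measure N A) else 0"
  shows "\<mu> \<in> pos_radon_measures" "variation \<mu> = N"
proof -
  interpret finite_measure N by fact
  show v: "variation \<mu> = N"
    by (rule variation_nonneg[OF fin sets_N]) (simp add: \<mu>_def)
  have "(\<lambda>i. \<mu> (A i)) sums \<mu> (\<Union>i. A i)"
    if A: "range A \<subseteq> sets borel" "disjoint_family A" for A :: "nat \<Rightarrow> 'a set"
  proof -
    have "\<And>i. A i \<in> sets borel" "(\<Union>i. A i) \<in> sets borel"
      using A(1) by auto
    then show ?thesis
      using finite_measure_UNION[of A] A sets_N by (simp add: \<mu>_def sums_of_real_iff)
  qed
  moreover have "emeasure N UNIV < \<infinity>"
    by (simp add: emeasure_eq_measure)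
  ultimately show "\<mu> \<in> pos_radon_measures"
    using reg v
    by (auto simp: pos_radon_measures_def radon_measures_def complex_borel_measure_def \<mu>_def
      less_eq_complex_def)
qed

text \<open>The discrete measure with mass \<open>c i\<close> at \<open>x i\<close>. Being an image
  of a measure on the index set, it allows \<open>x\<close> to repeat points.\<close>

definition weighted_points :: "'i set \<Rightarrow> ('i \<Rightarrow> real) \<Rightarrow> ('i \<Rightarrow> 'a) \<Rightarrow> 'a::topological_space measure" where
  "weighted_points I c x = distr (point_measure I (\<lambda>i. ennreal (c i))) borel x"

lemma weighted_points:
  fixes x :: "'i \<Rightarrow> 'a::t2_space"
  assumes I: "finite I" and c: "\<And>i. i \<in> I \<Longrightarrow> 0 \<le> c i"
  shows "finite_measure (weighted_points I c x)" "sets (weighted_points I c x) = sets borel"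
    "measure (weighted_points I c x) UNIV = (\<Sum>i\<in>I. c i)"
    "regular_borel_measure (weighted_points I c x)"
    "\<And>A. A \<in> sets borel \<Longrightarrow> emeasure (weighted_points I c x) A = (\<Sum>i\<in>{i\<in>I. x i \<in> A}. ennreal (c i))"
    "\<And>g::'a \<Rightarrow> complex. g \<in> borel_measurable borel \<Longrightarrow> (LINT z|weighted_points I c x. g z) = (\<Sum>i\<in>I. c i *\<^sub>R g (x i))"
proof -
  let ?N = "weighted_points I c x"
  show sets_N: "sets ?N = sets borel"
    by (simp add: weighted_points_def)
  show em: "emeasure ?N A = (\<Sum>i\<in>{i\<in>I. x i \<in> A}. ennreal (c i))" if "A \<in> sets borel" for A
  proof -
    have "emeasure ?N A = emeasure (point_measure I (\<lambda>i. ennreal (c i))) (x -` A \<inter> I)"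
      unfolding weighted_points_def using that by (subst emeasure_distr) (auto simp: space_point_measure)
    also have "\<dots> = (\<Sum>i\<in>x -` A \<inter> I. ennreal (c i))"
      using I by (intro emeasure_point_measure_finite) auto
    also have "x -` A \<inter> I = {i\<in>I. x i \<in> A}"
      by auto
    finally show ?thesis .
  qed
  have UNIV: "emeasure ?N UNIV = ennreal (\<Sum>i\<in>I. c i)"
    using em[of UNIV] c by (simp add: sum_ennreal)
  then show "measure ?N UNIV = (\<Sum>i\<in>I. c i)"
    using c by (simp add: measure_def sum_nonneg)
  have sp: "space ?N = UNIV"
    using sets_eq_imp_space_eq[OF sets_N] by simp
  show "finite_measure ?N"
    by (rule finite_measureI) (simp add: sp UNIV)
  show "regular_borel_measure ?N"
    unfolding regular_borel_measure_def
  proof (intro conjI allI impI ballI sets_N)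
    fix K :: "'a set" assume "compact K"
    then show "emeasure ?N K < \<infinity>"
      using I by (subst em) (auto simp: borel_compact)
  next
    fix A :: "'a set" assume A: "A \<in> sets borel"
    \<comment> \<open>Removing the finitely many atoms outside \<open>A\<close> from the space
      leaves an open set of the same mass as \<open>A\<close>; inner regularity below uses the
      finite set of atoms inside \<open>U\<close>.\<close>
    define U where "U = - (x ` {i\<in>I. x i \<notin> A})"
    have "finite (x ` {i\<in>I. x i \<notin> A})"
      using I by simp
    then have U: "open U" "A \<subseteq> U"
      using finite_imp_closed by (auto simp: U_def)
    have "{i\<in>I. x i \<in> U} = {i\<in>I. x i \<in> A}"
      by (auto simp: U_def)
    then have "emeasure ?N U = emeasure ?N A"
      using em A U by simp
    then show "emeasure ?N A = (INF U\<in>{U. open U \<and> A \<subseteq> U}. emeasure ?N U)"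
      using U by (intro antisym INF_greatest INF_lower2[of U]) (auto intro!: emeasure_mono simp: sets_N)
  next
    fix U :: "'a set" assume U: "open U"
    define K where "K = x ` {i\<in>I. x i \<in> U}"
    have K: "compact K" "K \<subseteq> U"
      using I by (auto simp: K_def finite_imp_compact)
    have "{i\<in>I. x i \<in> K} = {i\<in>I. x i \<in> U}"
      by (auto simp: K_def)
    then have "emeasure ?N K = emeasure ?N U"
      using em K U by (simp add: borel_compact)
    then show "emeasure ?N U = (SUP K\<in>{K. compact K \<and> K \<subseteq> U}. emeasure ?N K)"
      using U K by (intro antisym SUP_least SUP_upper2[of K]) (auto intro!: emeasure_mono simp: sets_N)
  qed
  show "(LINT z|?N. g z) = (\<Sum>i\<in>I. c i *\<^sub>R g (x i))" if "g \<in> borel_measurable borel" for g :: "'a \<Rightarrow> complex"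
    unfolding weighted_points_def using that I c
    by (subst integral_distr) (auto simp: lebesgue_integral_point_measure_finite)
qed

text \<open>That the complement of the support is null is not immediate, since it may be an
  uncountable union of null open sets. A compact subset of it is covered by finitely many of them,
  and inner regularity on open sets does the rest.\<close>

lemma compact_prob_measure:
  assumes \<mu>: "\<mu> \<in> compact_prob_measures"
  shows "\<mu> \<in> pos_radon_measures" "compact (msupport \<mu>)" "measure (variation \<mu>) UNIV = 1"
    "AE x in variation \<mu>. x \<in> msupport \<mu>"
proof -
  show p: "\<mu> \<in> pos_radon_measures" and K: "compact (msupport \<mu>)"
    using \<mu> by (auto simp: compact_prob_measures_def)
  note M = pos_radon_measure[OF p]
  have "complex_of_real (measure (variation \<mu>) UNIV) = 1"
    using \<mu> M(3)[of UNIV] by (auto simp: compact_prob_measures_def)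
  then show "measure (variation \<mu>) UNIV = 1"
    using of_real_eq_1_iff by blast
  have o: "open (- msupport \<mu>)"
    using K by (simp add: compact_imp_closed open_Compl)
  have null: "emeasure (variation \<mu>) C = 0" if C: "compact C" "C \<subseteq> - msupport \<mu>" for C
  proof -
    have "\<exists>U. open U \<and> x \<in> U \<and> emeasure (variation \<mu>) U = 0" if "x \<in> C" for x
      using C that by (force simp: msupport_def)
    then obtain U where U: "\<And>x. x \<in> C \<Longrightarrow> open (U x) \<and> x \<in> U x \<and> emeasure (variation \<mu>) (U x) = 0"
      by metis
    obtain D where D: "finite D" "D \<subseteq> C" "C \<subseteq> (\<Union>x\<in>D. U x)"
    proof (rule compactE_image[OF C(1), of C U])
      show "\<And>x. x \<in> C \<Longrightarrow> open (U x)" "C \<subseteq> (\<Union>x\<in>C. U x)"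
        using U by auto
    qed (rule that)
    have Us: "U x \<in> sets (variation \<mu>)" if "x \<in> D" for x
      using U D that M(2) by (simp add: subset_iff)
    have "emeasure (variation \<mu>) C \<le> emeasure (variation \<mu>) (\<Union>x\<in>D. U x)"
      using D Us by (intro emeasure_mono) auto
    also have "\<dots> \<le> (\<Sum>x\<in>D. emeasure (variation \<mu>) (U x))"
      using D Us by (intro emeasure_subadditive_finite) auto
    also have "\<dots> = 0"
      using U D by (simp add: subset_iff)
    finally show ?thesis by simp
  qed
  have "emeasure (variation \<mu>) (- msupport \<mu>) = (SUP K\<in>{K. compact K \<and> K \<subseteq> - msupport \<mu>}. emeasure (variation \<mu>) K)"
    using M(5) o unfolding regular_borel_measure_def by blast
  also have "\<dots> = (SUP K\<in>{K. compact K \<and> K \<subseteq> - msupport \<mu>}. 0)"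
    using null by (intro SUP_cong) auto
  also have "\<dots> = 0"
    by (auto simp: SUP_constant)
  finally have "- msupport \<mu> \<in> null_sets (variation \<mu>)"
    using o M(2) by auto
  then show "AE x in variation \<mu>. x \<in> msupport \<mu>"
    by (rule AE_I') auto
qed

section \<open>Integration against probability measures carried by a compact set\<close>

lemma uniform_near_compact:
  fixes u :: "'a::topological_space \<Rightarrow> 'b::topological_space \<Rightarrow> real"
  assumes u: "continuous_on UNIV (\<lambda>(z, w). u z w)" and K: "compact K" and e: "e > 0"
  shows "\<exists>N. open N \<and> z0 \<in> N \<and> (\<forall>z\<in>N. \<forall>w\<in>K. \<bar>u z w - u z0 w\<bar> \<le> e)"
proof -
  have "continuous_on (UNIV \<times> K) (\<lambda>(z, w). u z w)"
    using u by (rule continuous_on_subset) auto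
  from continuous_on_prod_compactE[where ?x0.0 = z0, OF this K UNIV_I e]
  obtain N where "z0 \<in> N" "open N"
    "\<forall>z\<in>N \<inter> UNIV. \<forall>w\<in>K. dist (case (z, w) of (z, w) \<Rightarrow> u z w) (case (z0, w) of (z, w) \<Rightarrow> u z w) \<le> e" .
  then show ?thesis
    by (intro exI[of _ N]) (simp add: dist_real_def)
qed

lemma continuous_on_section:
  assumes "continuous_on UNIV (\<lambda>(z, w). u z w)"
  shows "continuous_on UNIV (u z)" "continuous_on UNIV (\<lambda>z. u z w)"
proof -
  have "continuous_on UNIV (\<lambda>w. (\<lambda>(z, w). u z w) (z, w))" "continuous_on UNIV (\<lambda>z. (\<lambda>(z, w). u z w) (z, w))"
    by (rule continuous_on_compose2[OF assms]; force intro: continuous_intros)+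
  then show "continuous_on UNIV (u z)" "continuous_on UNIV (\<lambda>z. u z w)"
    by simp_all
qed

lemma continuous_on_eventually_eps:
  fixes g :: "'a::topological_space \<Rightarrow> 'b::metric_space"
  assumes "\<And>z0 e. e > 0 \<Longrightarrow> \<exists>N. open N \<and> z0 \<in> N \<and> (\<forall>z\<in>N. dist (g z) (g z0) \<le> e)"
  shows "continuous_on UNIV g"
  unfolding continuous_on_def
proof
  fix z0
  have "\<forall>\<^sub>F z in at z0. dist (g z) (g z0) < e" if e: "e > 0" for e
  proof -
    obtain N where N: "open N" "z0 \<in> N" "\<And>z. z \<in> N \<Longrightarrow> dist (g z) (g z0) \<le> e / 2"
      using assms[of "e / 2" z0] e by auto
    have "dist (g z) (g z0) < e" if "z \<in> N" for z
      using N(3)[OF that] e by simp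
    then show ?thesis
      unfolding eventually_at_topological using N by blast
  qed
  then show "(g \<longlongrightarrow> g z0) (at z0)"
    by (rule tendstoI)
qed

text \<open>Integrands have to be controlled only on \<open>S\<close>, so continuous functions need
  not be bounded. For convolutions of point masses \<open>S\<close> will be the support.\<close>

locale compact_probability =
  fixes M :: "'a::t2_space measure" and S :: "'a set"
  assumes fin: "finite_measure M" and sets_M: "sets M = sets borel" and total: "measure M UNIV = 1"
    and S: "compact S" and AE_S: "AE z in M. z \<in> S"
begin

lemma space_M: "space M = UNIV"
  using sets_eq_imp_space_eq[OF sets_M] by simp

lemma borel_measurable_M: "continuous_on UNIV g \<Longrightarrow> g \<in> borel_measurable M"
  for g :: "'a \<Rightarrow> 'c::topological_space"
  using measurable_cong_sets[OF sets_M refl] borel_measurable_continuous_onI by blast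

lemma integrable_M:
  fixes g :: "'a \<Rightarrow> real"
  assumes "continuous_on UNIV g" shows "integrable M g"
proof -
  have "compact (g ` S)"
    using S assms by (intro compact_continuous_image) (auto intro: continuous_on_subset)
  then have "bounded (g ` S)"
    by (rule compact_imp_bounded)
  then obtain B where "\<And>y. y \<in> g ` S \<Longrightarrow> norm y \<le> B"
    unfolding bounded_iff by blast
  then have "AE z in M. norm (g z) \<le> B"
    using AE_S by (auto elim!: eventually_mono)
  then show ?thesis
    by (rule finite_measure.integrable_const_bound[OF fin _ borel_measurable_M[OF assms]])
qed

lemma integral_const: "(LINT z|M. (c::real)) = c"
  using total by (simp add: space_M)

lemma integral_le:
  assumes "continuous_on UNIV g" "\<And>z. z \<in> S \<Longrightarrow> g z \<le> (c::real)" shows "(LINT z|M. g z) \<le> c"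
proof -
  have "(LINT z|M. g z) \<le> (LINT z|M. c)"
    using AE_S assms
    by (intro integral_mono_AE integrable_M continuous_on_const) (auto elim: eventually_mono)
  then show ?thesis
    by (simp only: integral_const)
qed

lemma integral_ge:
  assumes "continuous_on UNIV g" "\<And>z. z \<in> S \<Longrightarrow> (c::real) \<le> g z" shows "c \<le> (LINT z|M. g z)"
  using integral_le[of "\<lambda>z. - g z" "- c"] assms by (simp add: continuous_on_minus)

lemma continuous_parametric_integral:
  fixes u :: "'a \<Rightarrow> 'b::topological_space \<Rightarrow> real"
  assumes u: "continuous_on UNIV (\<lambda>(z, w). u z w)"
  shows "continuous_on UNIV (\<lambda>w. LINT z|M. u z w)"
proof (rule continuous_on_eventually_eps)
  fix w0 and e :: real assume e: "e > 0"
  have u': "continuous_on UNIV (\<lambda>(w, z). u z w)"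
    using continuous_on_compose2[OF u continuous_on_swap] by (simp add: split_def)
  obtain N where N: "open N" "w0 \<in> N" "\<And>w z. w \<in> N \<Longrightarrow> z \<in> S \<Longrightarrow> \<bar>u z w - u z w0\<bar> \<le> e"
    using uniform_near_compact[OF u' S e, of w0] by auto
  have c: "continuous_on UNIV (\<lambda>z. u z w)" for w
    using continuous_on_section(2)[OF u] .
  have "\<bar>(LINT z|M. u z w) - (LINT z|M. u z w0)\<bar> \<le> e" if "w \<in> N" for w
  proof -
    have eq: "(LINT z|M. u z w) - (LINT z|M. u z w0) = (LINT z|M. u z w - u z w0)"
      using integrable_M c by (intro Bochner_Integration.integral_diff[symmetric]) blast+
    have "(LINT z|M. u z w - u z w0) \<le> e"
      using N(3)[OF that] by (intro integral_le continuous_on_diff c) (auto simp: abs_le_iff)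
    moreover have "- e \<le> (LINT z|M. u z w - u z w0)"
      using N(3)[OF that] by (intro integral_ge continuous_on_diff c) (simp add: abs_le_iff algebra_simps)
    ultimately show ?thesis
      unfolding eq by linarith
  qed
  then show "\<exists>N. open N \<and> w0 \<in> N \<and> (\<forall>w\<in>N. dist (LINT z|M. u z w) (LINT z|M. u z w0) \<le> e)"
    using N unfolding dist_real_def by blast
qed

text \<open>If the integral were 0, the open set where g > 0 would be null, although it is a
  neighbourhood of \<open>z0\<close>.\<close>

lemma integral_pos:
  assumes "continuous_on UNIV g" "\<And>z. 0 \<le> (g z :: real)"
    and "0 < g z0" "\<And>U. open U \<Longrightarrow> z0 \<in> U \<Longrightarrow> emeasure M U > 0"
  shows "0 < (LINT z|M. g z)"
proof (rule ccontr)
  assume "\<not> 0 < (LINT z|M. g z)"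
  moreover have "0 \<le> (LINT z|M. g z)"
    using assms(2) by simp
  ultimately have "(LINT z|M. g z) = 0" by linarith
  then have "AE z in M. g z = 0"
    using integral_nonneg_eq_0_iff_AE[OF integrable_M[OF assms(1)]] assms(2) by auto
  moreover have "open {z. 0 < g z}"
    using assms(1) by (intro open_Collect_less continuous_intros)
  then have "{z. 0 < g z} \<in> sets M"
    using sets_M by simp
  moreover from \<open>AE z in M. g z = 0\<close> have "AE z in M. \<not> 0 < g z"
    by (rule eventually_mono) simp
  ultimately have "emeasure M {z. 0 < g z} = 0"
    using AE_iff_measurable[of "{z. 0 < g z}" M "\<lambda>z. \<not> 0 < g z"] space_M by auto
  then show False
    using assms(3) assms(4)[OF \<open>open {z. 0 < g z}\<close>] by simp
qed

text \<open>The reference values \<open>c i\<close> are arbitrary, so that one partition can serve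
  several integrands at the same time; this is how \<open>commutes_integral\<close> uses it.\<close>

lemma riemann_sum_near:
  fixes n :: nat
  assumes g: "continuous_on UNIV g" and B: "\<And>i. i < n \<Longrightarrow> B i \<in> sets M" "disjoint_family_on B {..<n}" "S \<subseteq> (\<Union>i<n. B i)"
    and near: "\<And>i z. i < n \<Longrightarrow> z \<in> B i \<inter> S \<Longrightarrow> \<bar>g z - c i\<bar> \<le> (e::real)"
  shows "\<bar>(LINT z|M. g z) - (\<Sum>i<n. measure M (B i) * c i)\<bar> \<le> e"
proof -
  have int: "integrable M (\<lambda>z. indicator (B i) z * c i)" if "i < n" for i
    using B(1)[OF that] finite_measure.emeasure_finite[OF fin]
    by (intro integrable_mult_left integrable_real_indicator) (auto simp: less_top)
  have "(LINT z|M. (\<Sum>i<n. indicator (B i) z * c i)) = (\<Sum>i<n. LINT z|M. indicator (B i) z * c i)"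
    using int by (intro Bochner_Integration.integral_sum) auto
  also have "\<dots> = (\<Sum>i<n. measure M (B i) * c i)"
    using B(1) sets.sets_into_space[OF B(1)] by (intro sum.cong) (auto simp: Int_absorb2)
  finally have "(LINT z|M. g z) - (\<Sum>i<n. measure M (B i) * c i)
      = (LINT z|M. g z - (\<Sum>i<n. indicator (B i) z * c i))"
    using Bochner_Integration.integral_diff[OF integrable_M[OF g] Bochner_Integration.integrable_sum, of "{..<n}"] int
    by (simp only: lessThan_iff)
  also have "\<bar>\<dots>\<bar> \<le> (LINT z|M. e)"
  proof (rule order_trans[OF integral_abs_bound], rule integral_mono_AE)
    show "integrable M (\<lambda>z. \<bar>g z - (\<Sum>i<n. indicator (B i) z * c i)\<bar>)"
      using integrable_M[OF g] int by (intro integrable_abs Bochner_Integration.integrable_diff Bochner_Integration.integrable_sum) auto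
    show "integrable M (\<lambda>z. e)"
      by (rule integrable_M) auto
    show "AE z in M. \<bar>g z - (\<Sum>i<n. indicator (B i) z * c i)\<bar> \<le> e"
      using AE_S
    proof eventually_elim
      case (elim z)
      then obtain j where j: "j < n" "z \<in> B j"
        using B(3) by auto
      have "(\<Sum>i<n. indicator (B i) z * c i) = (\<Sum>i<n. if i = j then c i else 0)"
        using B(2) j by (intro sum.cong) (auto simp: disjoint_family_on_def indicator_def)
      also have "\<dots> = c j"
        using j(1) by simp
      finally have "(\<Sum>i<n. indicator (B i) z * c i) = c j" .
      then show ?case
        using near[of j z] j elim by simp
    qed
  qed
  also have "\<dots> = e"
    by (rule integral_const)
  finally show ?thesis .
qed

end

section \<open>Interchanging a positive functional with an integral\<close>

context positive_functional
begin

lemma indicator_majorant: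
  fixes K :: "'a set"
  assumes "compact K"
  shows "\<exists>k\<in>Cc. (\<forall>x. 0 \<le> k x) \<and> (\<forall>x\<in>K. 1 \<le> k x)"
proof -
  obtain k W L where "k \<in> Cc" "\<And>x. 0 \<le> k x" "K \<subseteq> W" "\<And>x. x \<in> W \<Longrightarrow> k x = 1"
    by (rule Urysohn_Cc[OF lc assms open_UNIV]) auto
  then show ?thesis
    by (intro bexI[of _ k]) (auto simp: subset_iff)
qed

lemma abs_le:
  assumes "g \<in> Cc" "h \<in> Cc" "\<And>x. \<bar>g x\<bar> \<le> h x"
  shows "\<bar>\<Lambda> g\<bar> \<le> \<Lambda> h"
  using mono[OF assms(1,2)] mono[OF Cc_minus[OF assms(1)] assms(2)] scale[OF assms(1), of "- 1"] assms(3)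
  by (force simp: abs_le_iff)

text \<open>One Riemann sum \<open>s\<close> of the functions \<open>u (a i)\<close> approximates
  \<open>v\<close> up to e k pointwise, hence \<Lambda> v up to e \<Lambda> k. The same partition
  gives \<Lambda> s as a Riemann sum for the integral of \<Lambda> (u z), with the same error. The
  two errors make up the factor \<open>2 * \<Lambda> k\<close>.\<close>

lemma commutes_integral:
  fixes u :: "'a \<Rightarrow> 'a \<Rightarrow> real"
  assumes M: "compact_probability M S" and u: "continuous_on UNIV (\<lambda>(z, w). u z w)"
    and K: "compact K" "\<And>z w. z \<in> S \<Longrightarrow> w \<notin> K \<Longrightarrow> u z w = 0"
    and uC: "\<And>z. u z \<in> Cc" and v: "v \<in> Cc" "\<And>w. v w = (LINT z|M. u z w)"
    and cont: "continuous_on UNIV (\<lambda>z. \<Lambda> (u z))"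
  shows "(LINT z|M. \<Lambda> (u z)) = \<Lambda> v"
proof -
  interpret compact_probability M S by fact
  obtain k where k: "k \<in> Cc" "\<And>x. 0 \<le> k x" "\<And>x. x \<in> K \<Longrightarrow> 1 \<le> k x"
    using indicator_majorant[OF K(1)] by blast
  have *: "\<bar>(LINT z|M. \<Lambda> (u z)) - \<Lambda> v\<bar> \<le> e * (2 * \<Lambda> k)" if e: "e > 0" for e
  proof -
    have "\<exists>N. open N \<and> a \<in> N \<and> (\<forall>z\<in>N. \<forall>w\<in>K. \<bar>u z w - u a w\<bar> \<le> e)" for a
      using uniform_near_compact[OF u K(1) e] .
    then obtain N where N: "\<And>a. open (N a)" "\<And>a. a \<in> N a"
        "\<And>a z w. z \<in> N a \<Longrightarrow> w \<in> K \<Longrightarrow> \<bar>u z w - u a w\<bar> \<le> e"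
      by metis
    obtain D where D: "D \<subseteq> S" "finite D" "S \<subseteq> (\<Union>a\<in>D. N a)"
      using compactE_image[OF S, of S N] N by blast
    obtain a :: "nat \<Rightarrow> 'a" and n where a: "D = a ` {..<n}"
      using D(2) finite_imp_nat_seg_image_inj_on[of D] by (metis lessThan_def)
    define B where "B = disjointed (N \<circ> a)"
    have aS: "a i \<in> S" if "i < n" for i
      using that a D(1) by auto
    have "(\<Union>i<n. B i) = (\<Union>i<n. N (a i))"
      using finite_UN_disjointed_eq[of "N \<circ> a" n] by (simp add: B_def lessThan_atLeast0)
    then have B: "B i \<in> sets M" "disjoint_family_on B {..<n}" "S \<subseteq> (\<Union>i<n. B i)" for i
      using D(3) a N(1) disjoint_family_disjointed[of "N \<circ> a"] sets_M
      by (auto simp: B_def disjointed_def disjoint_family_on_def)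
    have BN: "B i \<subseteq> N (a i)" for i
      using disjointed_subset[of "N \<circ> a" i] by (simp add: B_def)
    \<comment> \<open>On \<open>K\<close> the majorant is at least 1, and off \<open>K\<close> both
      functions vanish; so the uniform estimate on \<open>K\<close> becomes one by
      \<open>e * k\<close> on the whole space, which \<Lambda> preserves.\<close>
    have near: "\<bar>u z w - u (a i) w\<bar> \<le> e * k w" if "i < n" "z \<in> B i \<inter> S" for i z w
    proof (cases "w \<in> K")
      case True
      then have "\<bar>u z w - u (a i) w\<bar> \<le> e * 1"
        using N(3)[of z "a i" w] BN that by auto
      also have "\<dots> \<le> e * k w"
        using k(3)[OF True] e by (intro mult_left_mono) auto
      finally show ?thesis .
    next
      case False
      then show ?thesis
        using K(2) aS that k(2)[of w] e by simp
    qed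
    define s where "s w = (\<Sum>i<n. measure M (B i) * u (a i) w)" for w
    have sC: "s \<in> Cc" "\<Lambda> s = (\<Sum>i<n. measure M (B i) * \<Lambda> (u (a i)))"
      unfolding s_def[abs_def] using uC sum[of "{..<n}" "\<lambda>i w. measure M (B i) * u (a i) w"]
      by (auto simp: scale Cc_scale intro!: Cc_sum)
    have "\<bar>v w - s w\<bar> \<le> e * k w" for w
      unfolding v(2) s_def
      using near by (intro riemann_sum_near[OF continuous_on_section(2)[OF u] B]) auto
    then have "\<bar>\<Lambda> (\<lambda>w. v w - s w)\<bar> \<le> \<Lambda> (\<lambda>w. e * k w)"
      using v(1) sC k(1) by (intro abs_le Cc_diff Cc_scale)
    then have 1: "\<bar>\<Lambda> v - \<Lambda> s\<bar> \<le> e * \<Lambda> k"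
      using v(1) sC k(1) by (simp add: diff scale)
    have "\<bar>\<Lambda> (u z) - \<Lambda> (u (a i))\<bar> \<le> e * \<Lambda> k" if "i < n" "z \<in> B i \<inter> S" for i z
    proof -
      have "\<bar>\<Lambda> (\<lambda>w. u z w - u (a i) w)\<bar> \<le> \<Lambda> (\<lambda>w. e * k w)"
        using near[OF that] uC k(1) by (intro abs_le Cc_diff Cc_scale)
      then show ?thesis
        using uC k(1) by (simp add: diff scale)
    qed
    then have 2: "\<bar>(LINT z|M. \<Lambda> (u z)) - \<Lambda> s\<bar> \<le> e * \<Lambda> k"
      unfolding sC(2) by (intro riemann_sum_near[OF cont B]) auto
    show ?thesis
      using 1 2 by (simp add: algebra_simps)
  qed
  have "\<bar>(LINT z|M. \<Lambda> (u z)) - \<Lambda> v\<bar> \<le> 0"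
  proof (rule field_le_epsilon)
    fix e :: real assume e: "e > 0"
    have k0: "0 \<le> \<Lambda> k"
      using k by (intro nonneg)
    have "\<bar>(LINT z|M. \<Lambda> (u z)) - \<Lambda> v\<bar> \<le> e / (2 * \<Lambda> k + 1) * (2 * \<Lambda> k)"
      using e k0 by (intro *) simp
    also have "\<dots> \<le> e"
      using e k0 by (simp add: field_simps)
    finally show "\<bar>(LINT z|M. \<Lambda> (u z)) - \<Lambda> v\<bar> \<le> 0 + e" by simp
  qed
  then show ?thesis by simp
qed

end

section \<open>Translations on a hypergroup\<close>

definition Cb :: "('a::topological_space \<Rightarrow> real) set" where
  "Cb = {g. continuous_on UNIV g \<and> bounded (range g)}"

lemma Cb_continuous: "g \<in> Cb \<Longrightarrow> continuous_on UNIV g"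
  by (simp add: Cb_def)

lemma CbI: "continuous_on UNIV g \<Longrightarrow> (\<And>x. \<bar>g x\<bar> \<le> B) \<Longrightarrow> g \<in> Cb"
  unfolding Cb_def bounded_iff by auto

lemma Cb_bound: "g \<in> Cb \<Longrightarrow> \<exists>B. \<forall>x. \<bar>g x\<bar> \<le> B"
  unfolding Cb_def bounded_iff by auto

lemma Cc_Cb: "g \<in> Cc \<Longrightarrow> g \<in> Cb"
  using Cc_bounded[of g] by (metis CbI Cc_continuous)

lemma Cb_prod:
  assumes "finite I" "\<And>i. i \<in> I \<Longrightarrow> g i \<in> Cb" shows "(\<lambda>x. \<Prod>i\<in>I. g i x) \<in> Cb"
  using assms
proof (induction I)
  case empty
  show ?case by (rule CbI[where B = 1]) auto
next
  case (insert i I)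
  then obtain B C where BC: "\<And>x. \<bar>g i x\<bar> \<le> B" "\<And>x. \<bar>\<Prod>i\<in>I. g i x\<bar> \<le> C"
    using Cb_bound[of "g i"] Cb_bound[of "\<lambda>x. \<Prod>i\<in>I. g i x"] by auto
  have "\<bar>g i x * (\<Prod>i\<in>I. g i x)\<bar> \<le> B * C" for x
    using BC(1)[of x] BC(2)[of x] unfolding abs_mult by (intro mult_mono) auto
  then show ?case
    using insert Cb_continuous[of "g i"] Cb_continuous[of "\<lambda>x. \<Prod>i\<in>I. g i x"]
    by (intro CbI[where B = "B * C"]) (simp_all add: continuous_on_mult)
qed

lemma bcontfun_of_real: "g \<in> Cb \<Longrightarrow> (\<lambda>x. complex_of_real (g x)) \<in> bcontfun"
  unfolding Cb_def bcontfun_def bounded_iff by (auto intro!: continuous_intros)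

text \<open>Seen as a single weighted point, a point mass inherits regularity and the evaluation of
  integrals from the discrete measures.\<close>

lemma point_mass_eq:
  "point_mass a = (\<lambda>A. if A \<in> sets borel
     then complex_of_real (measure (weighted_points {()} (\<lambda>_. 1) (\<lambda>_. a)) A) else 0)"
proof
  fix A :: "'a set"
  have "{i \<in> {()}. a \<in> A} = (if a \<in> A then {()} else {})"
    by auto
  then show "point_mass a A = (if A \<in> sets borel
     then complex_of_real (measure (weighted_points {()} (\<lambda>_. 1) (\<lambda>_. a)) A) else 0)"
    using weighted_points(5)[of "{()}" "\<lambda>_. 1" A "\<lambda>_. a"]
    by (auto simp: point_mass_def measure_def)
qed

lemma point_mass_radon: "point_mass a \<in> pos_radon_measures"
  and variation_point_mass: "variation (point_mass a) = weighted_points {()} (\<lambda>_. 1) (\<lambda>_. a)"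
proof -
  let ?N = "weighted_points {()} (\<lambda>_. 1) (\<lambda>_. a)"
  have *: "finite_measure ?N" "sets ?N = sets borel" "regular_borel_measure ?N"
    by (intro weighted_points(1,2,4); simp)+
  show "point_mass a \<in> pos_radon_measures" "variation (point_mass a) = ?N"
    unfolding point_mass_eq by (rule pos_radon_measureI[OF *])+
qed

lemma cintegral_point_mass:
  assumes "continuous_on UNIV g" shows "cintegral (point_mass a) g = g a"
  unfolding pos_radon_measure(4)[OF point_mass_radon] variation_point_mass
  using assms by (subst weighted_points(6)) (auto intro: borel_measurable_continuous_onI)

lemma pos_radon_radon: "\<mu> \<in> pos_radon_measures \<Longrightarrow> \<mu> \<in> radon_measures"
  by (simp add: pos_radon_measures_def)

section \<open>Convolutions of point masses, their supports, and translations\<close>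

context hypergroup
begin

definition point_conv :: "'a \<Rightarrow> 'a \<Rightarrow> 'a measure" where
  "point_conv x y = variation (conv (point_mass x) (point_mass y))"

definition point_supp :: "'a \<Rightarrow> 'a \<Rightarrow> 'a set" where
  "point_supp x y = msupport (conv (point_mass x) (point_mass y))"

definition avg :: "'a \<Rightarrow> 'a \<Rightarrow> ('a \<Rightarrow> real) \<Rightarrow> real" where
  "avg x y g = (LINT z|point_conv x y. g z)"

text \<open>The real version of the translate \<open>conv_fun conv chk (point_mass x) g\<close>; the
  two are compared in \<open>conv_fun_of_real\<close>.\<close>

definition ltrans :: "'a \<Rightarrow> ('a \<Rightarrow> real) \<Rightarrow> 'a \<Rightarrow> real" where
  "ltrans x g = (\<lambda>y. avg (chk x) y g)"

lemma conv_point_mass_radon: "conv (point_mass x) (point_mass y) \<in> pos_radon_measures"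
  using conv_point_mass by (rule compact_prob_measure(1))

lemma compact_probability_point_conv: "compact_probability (point_conv x y) (point_supp x y)"
  unfolding point_conv_def point_supp_def
  by (rule compact_probability.intro; rule pos_radon_measure(1,2)[OF conv_point_mass_radon]
      compact_prob_measure(2-4)[OF conv_point_mass])

lemma cintegral_conv: "cintegral (conv (point_mass x) (point_mass y)) f = (LINT z|point_conv x y. f z)"
  unfolding point_conv_def by (rule pos_radon_measure(4)[OF conv_point_mass_radon])

lemma cintegral_conv_of_real:
  "cintegral (conv (point_mass x) (point_mass y)) (\<lambda>z. complex_of_real (g z)) = of_real (avg x y g)"
  by (simp add: cintegral_conv avg_def)

lemma avg_continuous:
  assumes "g \<in> Cb" shows "continuous_on UNIV (\<lambda>(x, y). avg x y g)"
proof -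
  let ?F = "{(\<lambda>\<mu>. cintegral \<mu> f) |f. f \<in> (bcontfun :: ('a \<Rightarrow> complex) set)}"
  have F: "(\<lambda>\<mu>. cintegral \<mu> (\<lambda>z. complex_of_real (g z))) \<in> ?F"
    using bcontfun_of_real[OF assms]
    by (intro CollectI exI[of _ "\<lambda>z. complex_of_real (g z)"]) simp
  then have "?F \<noteq> {}"
    by (metis empty_iff)
  from conv_continuous[unfolded continuous_map_weak_topology[OF this]]
  have "continuous_map euclidean euclidean
    (\<lambda>t. cintegral (case t of (x, y) \<Rightarrow> conv (point_mass x) (point_mass y)) (\<lambda>z. complex_of_real (g z)))"
    using F by (rule conjunct2[THEN bspec])
  then have "continuous_on UNIV (\<lambda>t. Re (cintegral (case t of (x, y) \<Rightarrow> conv (point_mass x) (point_mass y)) (\<lambda>z. complex_of_real (g z))))"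
    by (intro continuous_on_Re) simp
  then show ?thesis
    by (simp add: cintegral_conv_of_real split_def)
qed

lemma avg_continuous_left: "g \<in> Cb \<Longrightarrow> continuous_on UNIV (\<lambda>x. avg x y g)"
  and avg_continuous_right: "g \<in> Cb \<Longrightarrow> continuous_on UNIV (\<lambda>y. avg x y g)"
  using continuous_on_section[OF avg_continuous] by blast+

lemma integrable_point_conv:
  fixes g :: "'a \<Rightarrow> real"
  assumes "continuous_on UNIV g" shows "integrable (point_conv x y) g"
  by (rule compact_probability.integrable_M[OF compact_probability_point_conv assms])

lemma avg_add:
  "continuous_on UNIV g \<Longrightarrow> continuous_on UNIV h \<Longrightarrow> avg x y (\<lambda>z. g z + h z) = avg x y g + avg x y h"
  by (simp add: avg_def integrable_point_conv)

lemma avg_scale: "avg x y (\<lambda>z. c * g z) = c * avg x y g"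
  by (simp add: avg_def)

lemma avg_const: "avg x y (\<lambda>_. c) = c"
  unfolding avg_def by (rule compact_probability.integral_const[OF compact_probability_point_conv])

text \<open>Both sides integrate \<open>g\<close> against the convolution of the three point masses
  at x, y and q, expanded by \<open>conv_weak\<close> for the two ways of bracketing it. Continuity
  of the inner integrals allows the remaining point mass to be evaluated.\<close>

lemma avg_assoc:
  assumes g: "g \<in> Cb"
  shows "(LINT w|point_conv x y. avg w q g) = (LINT w|point_conv y q. avg x w g)"
proof -
  let ?f = "\<lambda>z. complex_of_real (g z)"
  have r: "point_mass x \<in> radon_measures" "conv (point_mass x) (point_mass y) \<in> radon_measures" for x y
    using point_mass_radon conv_point_mass_radon pos_radon_radon by blast+
  have "cintegral (conv (conv (point_mass x) (point_mass y)) (point_mass q)) ?f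
      = cintegral (point_mass q) (\<lambda>v. cintegral (conv (point_mass x) (point_mass y))
          (\<lambda>w. cintegral (conv (point_mass w) (point_mass v)) ?f))"
    using r bcontfun_of_real[OF g] by (intro conv_weak)
  also have "\<dots> = cintegral (point_mass q) (\<lambda>v. complex_of_real (LINT w|point_conv x y. avg w v g))"
    by (simp add: cintegral_conv_of_real) (simp add: avg_def)
  also have "\<dots> = complex_of_real (LINT w|point_conv x y. avg w q g)"
    by (intro cintegral_point_mass continuous_intros avg_continuous[OF g]
      compact_probability.continuous_parametric_integral[OF compact_probability_point_conv])
  finally have 1: "cintegral (conv (conv (point_mass x) (point_mass y)) (point_mass q)) ?f
      = complex_of_real (LINT w|point_conv x y. avg w q g)" .
  have "cintegral (conv (point_mass x) (conv (point_mass y) (point_mass q))) ?f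
      = cintegral (conv (point_mass y) (point_mass q)) (\<lambda>v. cintegral (point_mass x)
          (\<lambda>w. cintegral (conv (point_mass w) (point_mass v)) ?f))"
    using r bcontfun_of_real[OF g] by (intro conv_weak)
  also have "\<dots> = cintegral (conv (point_mass y) (point_mass q)) (\<lambda>v. complex_of_real (avg x v g))"
    using avg_continuous_left[OF g]
    by (simp add: cintegral_conv_of_real cintegral_point_mass continuous_on_of_real)
  also have "\<dots> = complex_of_real (LINT w|point_conv y q. avg x w g)"
    by (simp add: cintegral_conv_of_real) (simp add: avg_def)
  finally show ?thesis
    using 1 conv_assoc[OF r(1) r(1) r(1), of x y q] by simp
qed

lemma point_supp_nbhd: "z \<in> point_supp x y \<Longrightarrow> open U \<Longrightarrow> z \<in> U \<Longrightarrow> emeasure (point_conv x y) U > 0"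
  by (simp add: point_supp_def point_conv_def msupport_def)

lemma unit_in_point_supp: "e \<in> point_supp x y \<longleftrightarrow> y = chk x"
  unfolding point_supp_def by (rule unit_in_supp)

lemma compact_point_supp: "compact (point_supp x y)"
  by (rule compact_probability.S[OF compact_probability_point_conv])

lemma point_supp_nonempty: "point_supp x y \<noteq> {}"
proof
  assume "point_supp x y = {}"
  then have "avg x y (\<lambda>_. 1) \<le> 0"
    unfolding avg_def by (intro compact_probability.integral_le[OF compact_probability_point_conv]) auto
  then show False
    by (simp add: avg_const)
qed

lemma avg_pos:
  assumes "g \<in> Cb" "\<And>z. 0 \<le> g z" "z \<in> point_supp x y" "0 < g z"
  shows "0 < avg x y g"
  unfolding avg_def
  using assms point_supp_nbhd
  by (intro compact_probability.integral_pos[OF compact_probability_point_conv Cb_continuous, where ?z0.0 = z]) auto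

text \<open>Upper semicontinuity of the supports, which is how the continuity of supports enters
  below.\<close>

lemma point_supp_upper:
  assumes "open V" "point_supp x y \<subseteq> V"
  shows "\<exists>A B. open A \<and> open B \<and> x \<in> A \<and> y \<in> B \<and> (\<forall>a\<in>A. \<forall>b\<in>B. point_supp a b \<subseteq> V)"
proof -
  \<comment> \<open>Taking the whole space as the set that must be met leaves only the condition of
    being contained in \<open>V\<close>.\<close>
  let ?W = "{C. compact C \<and> C \<noteq> {} \<and> C \<inter> UNIV \<noteq> {} \<and> C \<subseteq> V}"
  have "openin michael_topology ?W"
    unfolding michael_topology_def using assms(1)
    by (intro topology_generated_by_Basis) (auto intro!: exI[of _ UNIV] exI[of _ V])
  then have "openin euclidean {t \<in> topspace euclidean. (\<lambda>(x, y). msupport (conv (point_mass x) (point_mass y))) t \<in> ?W}"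
    using supp_continuous by (rule openin_continuous_map_preimage[rotated])
  then have "open {t. (\<lambda>(x, y). point_supp x y) t \<in> ?W}"
    by (simp add: point_supp_def)
  moreover have "(x, y) \<in> {t. (\<lambda>(x, y). point_supp x y) t \<in> ?W}"
    using assms compact_point_supp point_supp_nonempty by auto
  ultimately obtain A B where "open A" "open B" "(x, y) \<in> A \<times> B" "A \<times> B \<subseteq> {t. (\<lambda>(x, y). point_supp x y) t \<in> ?W}"
    by (rule open_prod_elim)
  then show ?thesis
    by (intro exI[of _ A] exI[of _ B]) auto
qed

lemma chk_continuous: "continuous_on UNIV chk"
  using homeomorphic_imp_continuous_map[OF chk_homeomorphic] by simp

text \<open>Both sides say that \<open>e\<close> belongs to the support of \<open>\<delta>\<^sub>p * \<delta>\<^sub>y * \<delta>\<^bsub>chk z\<^esub>\<close>.\<close>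

lemma point_supp_rotate:
  assumes z: "z \<in> point_supp p y"
  shows "chk p \<in> point_supp y (chk z)"
proof (rule ccontr)
  let ?q = "chk z"
  assume not: "chk p \<notin> point_supp y ?q"
  \<comment> \<open>Since \<open>chk p\<close> is not in the support, w \<noteq>
    \<open>chk p\<close>, so \<open>e\<close> is outside \<open>point_supp p w\<close>. A bump at
    \<open>e\<close> then avoids this compact set, and by upper semicontinuity also
    \<open>point_supp p b\<close> for b near w.\<close>
  have "\<exists>g B. g \<in> Cc \<and> (\<forall>x. 0 \<le> g x) \<and> g e = 1 \<and> open B \<and> w \<in> B \<and> (\<forall>b\<in>B. \<forall>v\<in>point_supp p b. g v = 0)"
    if w: "w \<in> point_supp y ?q" for w
  proof -
    have "e \<notin> point_supp p w"
      using not w unfolding unit_in_point_supp by auto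
    then have sub: "{e} \<subseteq> - point_supp p w" and o: "open (- point_supp p w)"
      using compact_point_supp by (auto simp: compact_imp_closed)
    obtain g W L where g: "g \<in> Cc" "\<And>x. 0 \<le> g x" "\<And>x. g x \<le> 1" "open W" "{e} \<subseteq> W"
      "\<And>x. x \<in> W \<Longrightarrow> g x = 1" "compact L" "L \<subseteq> - point_supp p w" "\<And>x. x \<notin> L \<Longrightarrow> g x = 0"
      by (rule Urysohn_Cc[OF locally_compact compact_sing[of e] o sub]) blast
    have "point_supp p w \<subseteq> - L" "open (- L)"
      using g(7,8) by (auto simp: compact_imp_closed)
    then obtain B where "open B" "w \<in> B" "\<forall>b\<in>B. point_supp p b \<subseteq> - L"
      using point_supp_upper[of "- L" p w] by blast
    then show ?thesis
      using g by (intro exI[of _ g] exI[of _ B]) (auto 4 3)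
  qed
  then obtain g B where gB: "\<And>w. w \<in> point_supp y ?q \<Longrightarrow> g w \<in> Cc \<and> (\<forall>x. 0 \<le> g w x) \<and> g w e = 1 \<and>
      open (B w) \<and> w \<in> B w \<and> (\<forall>b\<in>B w. \<forall>v\<in>point_supp p b. g w v = 0)"
    by metis
  obtain D where D: "D \<subseteq> point_supp y ?q" "finite D" "point_supp y ?q \<subseteq> (\<Union>w\<in>D. B w)"
  proof (rule compactE_image[OF compact_point_supp])
    show "\<And>w. w \<in> point_supp y ?q \<Longrightarrow> open (B w)" "point_supp y ?q \<subseteq> (\<Union>w\<in>point_supp y ?q. B w)"
      using gB by auto
  qed (rule that)
  \<comment> \<open>The product of finitely many bumps vanishes on \<open>point_supp p b\<close> for
    all b in the support of \<open>point_conv y ?q\<close>, yet is still 1 at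
    \<open>e\<close>.\<close>
  define h where "h v = (\<Prod>w\<in>D. g w v)" for v
  have gD: "g w \<in> Cb" "0 \<le> g w v" "g w e = 1" if "w \<in> D" for w v
    using gB[OF subsetD[OF D(1) that]] by (auto intro: Cc_Cb)
  have h: "h \<in> Cb" "\<And>v. 0 \<le> h v" "h e = 1"
    unfolding h_def by (intro Cb_prod D(2) prod_nonneg prod.neutral ballI; simp add: gD)+
  have "avg p b h = 0" if b: "b \<in> point_supp y ?q" for b
  proof -
    obtain w where w: "w \<in> D" "b \<in> B w"
      using D(3) b by blast
    have "h v = 0" if "v \<in> point_supp p b" for v
      unfolding h_def using D w gB[OF subsetD[OF D(1) w(1)]] that by (intro prod_zero) (auto intro!: bexI[of _ w])
    then have "avg p b h \<le> 0"
      unfolding avg_def using h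
      by (intro compact_probability.integral_le[OF compact_probability_point_conv] Cb_continuous) auto
    moreover have "0 \<le> avg p b h"
      unfolding avg_def using h(2) by simp
    ultimately show ?thesis by simp
  qed
  then have "(LINT w|point_conv y ?q. avg p w h) \<le> 0"
    using avg_continuous_right[OF h(1)]
    by (intro compact_probability.integral_le[OF compact_probability_point_conv]) auto
  \<comment> \<open>With the other bracketing the point z contributes: \<open>e\<close> lies in the
    support of \<open>point_conv z (chk z)\<close>, where \<open>h\<close> is positive, and z lies
    in the support of \<open>point_conv p y\<close>.\<close>
  moreover have "0 < (LINT w|point_conv p y. avg w ?q h)"
  proof (rule compact_probability.integral_pos[OF compact_probability_point_conv, where ?z0.0 = z])
    show "continuous_on UNIV (\<lambda>w. avg w ?q h)"
      using h(1) by (rule avg_continuous_left)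
    show "0 \<le> avg w ?q h" for w
      unfolding avg_def using h(2) by simp
    show "0 < avg z ?q h"
      using h unit_in_point_supp[of z ?q] by (intro avg_pos[where z = e]) auto
  qed (use z point_supp_nbhd in auto)
  ultimately show False
    using avg_assoc[OF h(1), of p y ?q] by simp
qed

text \<open>An equivalence is wanted because a point mass is 0 on non-Borel sets, so these have to
  correspond as well. The involution gives the second direction from the first.\<close>

lemma vimage_chk_borel: "{x. chk x \<in> A} \<in> sets borel \<longleftrightarrow> A \<in> sets borel"
proof -
  have *: "{x. chk x \<in> A} \<in> sets borel" if "A \<in> sets borel" for A
    using measurable_sets[OF borel_measurable_continuous_onI[OF chk_continuous] that]
    by (simp add: vimage_def)
  show ?thesis
  proof
    assume "{x. chk x \<in> A} \<in> sets borel"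
    then have "{y. chk y \<in> {x. chk x \<in> A}} \<in> sets borel"
      by (rule *)
    then show "A \<in> sets borel"
      by (simp add: chk_chk)
  qed (rule *)
qed

lemma check_point_mass: "check_measure chk (point_mass x) = point_mass (chk x)"
  unfolding check_measure_def point_mass_def using vimage_chk_borel by auto

text \<open>The involution reverses the order in a convolution and, being a homeomorphism, carries
  open sets of positive mass to open sets of positive mass.\<close>

lemma point_supp_chk:
  assumes z: "z \<in> point_supp x y"
  shows "chk z \<in> point_supp (chk y) (chk x)"
  unfolding point_supp_def msupport_def mem_Collect_eq point_conv_def[symmetric]
proof (intro allI impI)
  fix U assume U: "open U \<and> chk z \<in> U"
  have o: "open {w. chk w \<in> U}"
    using U open_vimage[OF _ chk_continuous, of U] by (simp add: vimage_def)
  have "conv (point_mass (chk y)) (point_mass (chk x)) = check_measure chk (conv (point_mass x) (point_mass y))"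
    using chk_conv[OF pos_radon_radon[OF point_mass_radon] pos_radon_radon[OF point_mass_radon], of x y]
    by (simp add: check_point_mass)
  then have "conv (point_mass (chk y)) (point_mass (chk x)) U = conv (point_mass x) (point_mass y) {w. chk w \<in> U}"
    by (simp add: check_measure_def)
  then have "complex_of_real (measure (point_conv (chk y) (chk x)) U)
      = complex_of_real (measure (point_conv x y) {w. chk w \<in> U})"
    using U o unfolding point_conv_def
    by (subst (1 2) pos_radon_measure(3)[OF conv_point_mass_radon, symmetric]) auto
  then have *: "measure (point_conv (chk y) (chk x)) U = measure (point_conv x y) {w. chk w \<in> U}"
    using of_real_eq_iff by blast
  have "emeasure (point_conv x y) {w. chk w \<in> U} > 0"
    using U by (intro point_supp_nbhd[OF z o]) simp
  then show "emeasure (point_conv (chk y) (chk x)) U > 0"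
    using * finite_measure.emeasure_eq_measure[OF compact_probability.fin[OF compact_probability_point_conv]]
    by simp
qed

text \<open>By upper semicontinuity the supports near each pair stay in a compact neighbourhood of a
  single support; finitely many product neighbourhoods cover \<open>K \<times> C\<close>.\<close>

lemma point_supp_compact_union:
  assumes "compact K" "compact C"
  shows "\<exists>L. compact L \<and> (\<forall>x\<in>K. \<forall>z\<in>C. point_supp x z \<subseteq> L)"
proof -
  have "\<exists>A B L. open A \<and> open B \<and> fst t \<in> A \<and> snd t \<in> B \<and> compact L \<and> (\<forall>a\<in>A. \<forall>b\<in>B. point_supp a b \<subseteq> L)" for t
  proof -
    obtain V L where VL: "open V" "compact L" "point_supp (fst t) (snd t) \<subseteq> V" "V \<subseteq> L"
      using compact_neighbourhood[OF locally_compact compact_point_supp[of "fst t" "snd t"]]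
      by (elim exE conjE)
    obtain A B where "open A" "open B" "fst t \<in> A" "snd t \<in> B"
      and AB: "\<forall>a\<in>A. \<forall>b\<in>B. point_supp a b \<subseteq> V"
      using point_supp_upper[OF VL(1,3)] by (elim exE conjE)
    then show ?thesis
      using VL(2,4) AB by (intro exI[of _ A] exI[of _ B] exI[of _ L] conjI ballI) auto
  qed
  then obtain A B L where ABL: "\<And>t. open (A t)" "\<And>t. open (B t)" "\<And>t. fst t \<in> A t" "\<And>t. snd t \<in> B t"
    "\<And>t. compact (L t)" "\<And>t a b. a \<in> A t \<Longrightarrow> b \<in> B t \<Longrightarrow> point_supp a b \<subseteq> L t"
    by metis
  have "compact (K \<times> C)"
    using assms by (rule compact_Times)
  then obtain D where D: "D \<subseteq> K \<times> C" "finite D" "K \<times> C \<subseteq> (\<Union>t\<in>D. A t \<times> B t)"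
  proof (rule compactE_image)
    show "\<And>t. t \<in> K \<times> C \<Longrightarrow> open (A t \<times> B t)"
      using ABL(1,2) by (simp add: open_Times)
    show "K \<times> C \<subseteq> (\<Union>t\<in>K \<times> C. A t \<times> B t)"
    proof
      fix t assume t: "t \<in> K \<times> C"
      show "t \<in> (\<Union>t\<in>K \<times> C. A t \<times> B t)"
        using ABL(3,4)[of t] by (intro UN_I[OF t]) (simp add: mem_Times_iff)
    qed
  qed (rule that)
  show ?thesis
  proof (intro exI conjI ballI)
    show "compact (\<Union>t\<in>D. L t)"
      using D(2) ABL(5) by (intro compact_UN) auto
    fix x z assume "x \<in> K" "z \<in> C"
    then have "(x, z) \<in> (\<Union>t\<in>D. A t \<times> B t)"
      using D(3) by blast
    then obtain t where "t \<in> D" "x \<in> A t" "z \<in> B t"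
      by auto
    then show "point_supp x z \<subseteq> (\<Union>t\<in>D. L t)"
      using ABL(6) by blast
  qed
qed

text \<open>Two rotations and one involution turn z in \<open>point_supp (chk x) y\<close> into y in
  \<open>point_supp x z\<close>. So the translate can be non-zero only on the supports with x in
  \<open>K\<close> and z in the carrier of \<open>h\<close>. That \<open>L\<close> does not depend
  on x is what later estimates rely on.\<close>

lemma ltrans_support:
  assumes h: "h \<in> Cc" and K: "compact K"
  shows "\<exists>L. compact L \<and> (\<forall>x\<in>K. \<forall>y. y \<notin> L \<longrightarrow> ltrans x h y = 0)"
proof -
  obtain C where C: "compact C" "\<And>z. z \<notin> C \<Longrightarrow> h z = 0"
    using Cc_support[OF h] by blast
  obtain L where L: "compact L" "\<And>x z. x \<in> K \<Longrightarrow> z \<in> C \<Longrightarrow> point_supp x z \<subseteq> L"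
    using point_supp_compact_union[OF K C(1)] by blast
  have "ltrans x h y = 0" if x: "x \<in> K" and y: "y \<notin> L" for x y
  proof -
    have "h z = 0" if z: "z \<in> point_supp (chk x) y" for z
    proof (rule C(2), rule notI)
      assume "z \<in> C"
      have "x \<in> point_supp y (chk z)"
        using point_supp_rotate[OF z] by (simp add: chk_chk)
      then have "chk y \<in> point_supp (chk z) (chk x)"
        by (rule point_supp_rotate)
      then have "y \<in> point_supp x z"
        using point_supp_chk[of "chk y" "chk z" "chk x"] by (simp add: chk_chk)
      then show False
        using L(2)[OF x \<open>z \<in> C\<close>] y by blast
    qed
    then have "ltrans x h y \<le> 0" "0 \<le> ltrans x h y"
      unfolding ltrans_def avg_def using Cc_continuous[OF h]
      by (intro compact_probability.integral_le[OF compact_probability_point_conv]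
        compact_probability.integral_ge[OF compact_probability_point_conv]; simp)+
    then show ?thesis by simp
  qed
  then show ?thesis
    using L(1) by blast
qed

lemma ltrans_continuous:
  assumes "h \<in> Cb" shows "continuous_on UNIV (\<lambda>(x, y). ltrans x h y)"
proof -
  have "continuous_on UNIV (\<lambda>t. (\<lambda>(x, y). avg x y h) (chk (fst t), snd t))"
    by (rule continuous_on_compose2[OF avg_continuous[OF assms]])
      (auto intro!: continuous_intros continuous_on_compose2[OF chk_continuous])
  then show ?thesis
    by (simp add: ltrans_def split_def)
qed

lemma ltrans_Cc:
  assumes h: "h \<in> Cc" shows "ltrans x h \<in> Cc"
proof -
  obtain L where "compact L" "\<forall>y. y \<notin> L \<longrightarrow> ltrans x h y = 0"
    using ltrans_support[OF h compact_sing[of x]] by auto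
  then show ?thesis
    using continuous_on_section(1)[OF ltrans_continuous[OF Cc_Cb[OF h]]] by (intro CcI) auto
qed

lemma ltrans_nonneg: "(\<And>z. 0 \<le> g z) \<Longrightarrow> 0 \<le> ltrans x g y"
  by (simp add: ltrans_def avg_def)

lemma conv_fun_of_real:
  assumes "g \<in> Cb"
  shows "conv_fun conv chk (point_mass x) (\<lambda>z. complex_of_real (g z)) = (\<lambda>y. of_real (ltrans x g y))"
proof
  fix y
  have "continuous_on UNIV (\<lambda>x. complex_of_real (ltrans x g y))"
    using continuous_on_section(2)[OF ltrans_continuous[OF assms]] by (intro continuous_intros)
  then show "conv_fun conv chk (point_mass x) (\<lambda>z. complex_of_real (g z)) y = of_real (ltrans x g y)"
    unfolding conv_fun_def cintegral_conv_of_real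
    by (subst cintegral_point_mass) (simp_all add: ltrans_def)
qed

text \<open>Every y has a translate positive at y: for s in \<open>point_supp a (chk y)\<close>,
  rotation gives a in \<open>point_supp s y\<close>, and \<open>f\<close> is positive at a. Finitely
  many such translates have a sum bounded away from 0 on a compact carrier of
  \<open>g\<close>.\<close>

lemma ltrans_dominates:
  assumes f: "f \<in> Cc" "\<And>x. 0 \<le> f x" "f a \<noteq> 0" and g: "g \<in> Cc"
  shows "\<exists>(I :: 'a set) x c. finite I \<and> 0 \<le> c \<and> (\<forall>y. g y \<le> (\<Sum>i\<in>I. c * ltrans (x i) f y))"
proof -
  have "\<exists>x. 0 < ltrans x f y" for y
  proof -
    obtain s where s: "s \<in> point_supp a (chk y)"
      using point_supp_nonempty by blast
    have "a \<in> point_supp s y"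
      using point_supp_chk[OF point_supp_rotate[OF s]] by (simp add: chk_chk)
    then have "0 < avg s y f"
      using f by (intro avg_pos[where z = a] Cc_Cb) (auto simp: less_le)
    then show ?thesis
      by (intro exI[of _ "chk s"]) (simp add: ltrans_def chk_chk)
  qed
  then obtain x where x: "\<And>y. 0 < ltrans (x y) f y"
    by metis
  obtain K where K: "compact K" "\<And>y. y \<notin> K \<Longrightarrow> g y = 0"
    using Cc_support[OF g] by blast
  obtain B where B: "B > 0" "\<And>y. \<bar>g y\<bar> \<le> B"
    using Cc_bounded[OF g] by blast
  have cont: "continuous_on UNIV (ltrans x f)" for x
    using f(1) by (intro Cc_continuous ltrans_Cc)
  obtain D where D: "D \<subseteq> K" "finite D" "K \<subseteq> (\<Union>d\<in>D. {y. 0 < ltrans (x d) f y})"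
  proof (rule compactE_image[OF K(1)])
    show "\<And>d. d \<in> K \<Longrightarrow> open {y. 0 < ltrans (x d) f y}"
      using cont by (intro open_Collect_less continuous_intros)
    show "K \<subseteq> (\<Union>d\<in>K. {y. 0 < ltrans (x d) f y})"
      using x by auto
  qed (rule that)
  define s where "s y = (\<Sum>d\<in>D. ltrans (x d) f y)" for y
  have s0: "0 \<le> s y" for y
    unfolding s_def using f(2) by (intro sum_nonneg ltrans_nonneg)
  have spos: "0 < s y" if y: "y \<in> K" for y
  proof -
    obtain d where "d \<in> D" "0 < ltrans (x d) f y"
      using D(3) y by blast
    then show ?thesis
      unfolding s_def using D(2) f(2) ltrans_nonneg by (intro sum_pos2) auto
  qed
  have "\<exists>\<delta>>0. \<forall>y\<in>K. \<delta> \<le> s y"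
  proof (cases "K = {}")
    case False
    have "continuous_on K s"
      unfolding s_def[abs_def] using cont by (intro continuous_on_sum) (auto intro: continuous_on_subset)
    from continuous_attains_inf[OF K(1) False this] show ?thesis
      using spos by blast
  qed (auto intro: exI[of _ 1])
  then obtain \<delta> where \<delta>: "\<delta> > 0" "\<And>y. y \<in> K \<Longrightarrow> \<delta> \<le> s y"
    by blast
  \<comment> \<open>The factor compares the upper bound B of |g| with the lower bound \<delta> of
    the sum on \<open>K\<close>; off \<open>K\<close> the function \<open>g\<close> is 0 and the sum
    non-negative.\<close>
  have "g y \<le> B / \<delta> * s y" for y
  proof (cases "y \<in> K")
    case True
    have "g y \<le> B / \<delta> * \<delta>"
      using B(2)[of y] \<delta>(1) by (simp add: abs_le_iff)
    also have "\<dots> \<le> B / \<delta> * s y"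
      using B(1) \<delta> True by (intro mult_left_mono) auto
    finally show ?thesis .
  qed (use K(2) s0 B(1) \<delta>(1) in auto)
  then show ?thesis
    using D(2) B(1) \<delta>(1) by (intro exI[of _ D] exI[of _ x] exI[of _ "B / \<delta>"]) (simp add: s_def sum_distrib_left)
qed

text \<open>The positive and negative parts of the coefficients give two discrete measures. Their
  convolutions with \<open>f\<close> are the corresponding sums of translates and their norms are
  the sums of coefficients, so the hypothesis is the inequality that the positivity property asks
  for.\<close>

lemma positivity_weighted_points:
  fixes I :: "'i set" and x :: "'i \<Rightarrow> 'a"
  assumes pos: "positivity_property conv chk (\<lambda>z. complex_of_real (f z))" and f: "f \<in> Cb"
    and I: "finite I" and le: "\<And>y. 0 \<le> (\<Sum>i\<in>I. c i * ltrans (x i) f y)"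
  shows "0 \<le> (\<Sum>i\<in>I. c i)"
proof -
  define meas where "meas c = (\<lambda>A. if A \<in> sets borel then complex_of_real (measure (weighted_points I c x) A) else 0)" for c
  have meas: "meas c \<in> pos_radon_measures" "tv_norm (meas c) = (\<Sum>i\<in>I. c i)"
    "conv_fun conv chk (meas c) (\<lambda>z. complex_of_real (f z)) y = of_real (\<Sum>i\<in>I. c i * ltrans (x i) f y)"
    if c: "\<And>i. 0 \<le> c i" for c :: "'i \<Rightarrow> real" and y
  proof -
    have wp: "finite_measure (weighted_points I c x)" "sets (weighted_points I c x) = sets borel"
      "regular_borel_measure (weighted_points I c x)"
      using weighted_points(1,2,4)[OF I c] .
    show m: "meas c \<in> pos_radon_measures"
      unfolding meas_def by (rule pos_radon_measureI(1)[OF wp])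
    have v: "variation (meas c) = weighted_points I c x"
      unfolding meas_def by (rule pos_radon_measureI(2)[OF wp])
    show "tv_norm (meas c) = (\<Sum>i\<in>I. c i)"
      unfolding tv_norm_def v by (rule weighted_points(3)[OF I c])
    have "continuous_on UNIV (\<lambda>x. complex_of_real (avg (chk x) y f))"
      using continuous_on_section(2)[OF ltrans_continuous[OF f]] unfolding ltrans_def
      by (intro continuous_intros)
    then have "(\<lambda>x. complex_of_real (avg (chk x) y f)) \<in> borel_measurable borel"
      by (rule borel_measurable_continuous_onI)
    then show "conv_fun conv chk (meas c) (\<lambda>z. complex_of_real (f z)) y = of_real (\<Sum>i\<in>I. c i * ltrans (x i) f y)"
      unfolding conv_fun_def cintegral_conv_of_real pos_radon_measure(4)[OF m] v
      by (subst weighted_points(6)[OF I c]) (auto simp: ltrans_def scaleR_conv_of_real)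
  qed
  define p where "p i = max 0 (c i)" for i
  define q where "q i = max 0 (- c i)" for i
  have pq: "0 \<le> p i" "0 \<le> q i" "c i = p i - q i" for i
    by (auto simp: p_def q_def)
  have "(\<Sum>i\<in>I. q i * ltrans (x i) f y) \<le> (\<Sum>i\<in>I. p i * ltrans (x i) f y)" for y
    using le[of y] by (simp add: pq(3) left_diff_distrib sum_subtractf)
  then have "conv_fun conv chk (meas q) (\<lambda>z. complex_of_real (f z)) y
      \<le> conv_fun conv chk (meas p) (\<lambda>z. complex_of_real (f z)) y" for y
    unfolding meas(3)[of p, OF pq(1)] meas(3)[of q, OF pq(2)] by (simp add: less_eq_complex_def)
  then have "tv_norm (meas q) \<le> tv_norm (meas p)"
    using pos meas(1)[of p, OF pq(1)] meas(1)[of q, OF pq(2)] unfolding positivity_property_def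
    by blast
  then show ?thesis
    using meas(2)[of p, OF pq(1)] meas(2)[of q, OF pq(2)] by (simp add: pq(3) sum_subtractf)
qed

end

section \<open>The invariant functional\<close>

lemma bcontfun_of_Cc: "g \<in> Cc \<Longrightarrow> g \<in> bcontfun"
  using Cc_Cb[of g] by (simp add: Cb_def bcontfun_def)

lemma apply_Bcontfun_Cc: "g \<in> Cc \<Longrightarrow> apply_bcontfun (Bcontfun g) = g"
  by (simp add: Bcontfun_inverse bcontfun_of_Cc)

lemma apply_fst_sum:
  fixes w :: "'i \<Rightarrow> ('a::topological_space \<Rightarrow>\<^sub>C real) \<times> real"
  shows "apply_bcontfun (fst (\<Sum>i\<in>I. c i *\<^sub>R w i)) y = (\<Sum>i\<in>I. c i * apply_bcontfun (fst (w i)) y)"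
  by (induction I rule: infinite_finite_induct)
    (auto simp: zero_bcontfun.rep_eq plus_bcontfun.rep_eq scaleR_bcontfun.rep_eq)

lemma cont_compact_supp_parts:
  assumes "g \<in> cont_compact_supp"
  shows "(\<lambda>z. Re (g z)) \<in> Cc" "(\<lambda>z. Im (g z)) \<in> Cc"
proof -
  have cont: "continuous_on UNIV g" and K: "compact (closure {z. g z \<noteq> 0})"
    using assms by (auto simp: cont_compact_supp_def)
  have van: "g z = 0" if "z \<notin> closure {z. g z \<noteq> 0}" for z
    using that subsetD[OF closure_subset[of "{z. g z \<noteq> 0}"], of z] by (metis mem_Collect_eq)
  show "(\<lambda>z. Re (g z)) \<in> Cc"
    by (rule CcI[OF continuous_on_Re[OF cont] K]) (drule van, simp)
  show "(\<lambda>z. Im (g z)) \<in> Cc"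
    by (rule CcI[OF continuous_on_Im[OF cont] K]) (drule van, simp)
qed

context hypergroup
begin

text \<open>Hahn-Banach is applied with \<open>p v = inf {\<Sum>i. c i | v \<le> \<Sum>i. c i * ltrans (x i) f}\<close>, where the
  \<open>c i\<close> may be negative.\<close>

theorem ex_weight:
  assumes f: "f \<in> Cc" "\<And>x. 0 \<le> f x" "f a \<noteq> 0"
    and pos: "positivity_property conv chk (\<lambda>z. complex_of_real (f z))"
  shows "\<exists>\<Phi>. positive_functional \<Phi> \<and> (\<forall>x. \<Phi> (ltrans x f) = 1)"
proof -
  \<comment> \<open>The bounded continuous functions form a real vector space type, in which the
    compactly supported ones are the subspace required by Hahn-Banach.\<close>
  define V :: "('a \<Rightarrow>\<^sub>C real) set" where "V = {v. apply_bcontfun v \<in> Cc}"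
  have V: "subspace V"
    unfolding V_def subspace_def
    by (auto simp: zero_bcontfun.rep_eq plus_bcontfun.rep_eq scaleR_bcontfun.rep_eq
      intro: Cc_zero Cc_add Cc_scale)
  \<comment> \<open>Each translate is paired with its prescribed value 1. The span \<open>W\<close>
    relates a combination of translates to its sum of coefficients, so the functional on the span is
    handled as a graph, without first proving that it is well defined.\<close>
  define b where "b x = (Bcontfun (ltrans x f), 1 :: real)" for x
  define W where "W = span (range b)"
  have fst_b: "apply_bcontfun (fst (b x)) = ltrans x f" for x
    by (simp add: b_def apply_Bcontfun_Cc ltrans_Cc f(1))
  have snd_b: "snd (b x) = 1" for x
    by (simp add: b_def)
  have W_pos: "0 \<le> t" if W: "(u, t) \<in> W" and u: "\<And>y. 0 \<le> apply_bcontfun u y" for u t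
  proof -
    obtain T r where T: "finite T" "T \<subseteq> range b" "(u, t) = (\<Sum>v\<in>T. r v *\<^sub>R v)"
      using W unfolding W_def span_explicit by blast
    \<comment> \<open>One translation parameter is selected by \<open>inv b\<close> for each vector
      in the combination, as different parameters may give the same translate.\<close>
    have "(\<Sum>v\<in>T. r v *\<^sub>R v) = (\<Sum>v\<in>T. r v *\<^sub>R b (inv b v))"
      using T(2) by (intro sum.cong) (auto simp: f_inv_into_f)
    then have ut: "(u, t) = (\<Sum>v\<in>T. r v *\<^sub>R b (inv b v))"
      using T(3) by simp
    have "0 \<le> (\<Sum>v\<in>T. r v * ltrans (inv b v) f y)" for y
      using u[of y] apply_fst_sum[of r "\<lambda>v. b (inv b v)" T y] unfolding ut[symmetric] by (simp add: fst_b)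
    then have "0 \<le> (\<Sum>v\<in>T. r v)"
      using positivity_weighted_points[OF pos Cc_Cb[OF f(1)] T(1)] by blast
    then show ?thesis
      using arg_cong[OF ut, of snd] by (simp add: snd_sum snd_b)
  qed
  define A where "A v = {t. \<exists>u. (u, t) \<in> W \<and> (\<forall>y. apply_bcontfun v y \<le> apply_bcontfun u y)}" for v
  define p where "p v = Inf (A v)" for v
  have A_ne: "\<exists>t. t \<in> A v" if v: "v \<in> V" for v
  proof -
    obtain I :: "'a set" and x c where I: "finite I" "\<And>y. apply_bcontfun v y \<le> (\<Sum>i\<in>I. c * ltrans (x i) f y)"
      using ltrans_dominates[OF f, of "apply_bcontfun v"] v by (auto simp: V_def)
    let ?w = "\<Sum>i\<in>I. c *\<^sub>R b (x i)"
    have "?w \<in> W"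
      unfolding W_def by (intro span_sum span_scale span_base) simp
    then have "snd ?w \<in> A v"
      using I(2) unfolding A_def
      by (intro CollectI exI[of _ "fst ?w"]) (simp add: apply_fst_sum fst_b)
    then show ?thesis ..
  qed
  have A_add: "s + t \<in> A (v + w)" if st: "s \<in> A v" "t \<in> A w" for s t v w
  proof -
    obtain u u' where "(u, s) \<in> W" "(u', t) \<in> W" "\<And>y. apply_bcontfun v y \<le> apply_bcontfun u y"
      "\<And>y. apply_bcontfun w y \<le> apply_bcontfun u' y"
      using st unfolding A_def by blast
    then show ?thesis
      unfolding A_def W_def using span_add[of "(u, s)" "range b" "(u', t)"]
      by (intro CollectI exI[of _ "u + u'"]) (auto simp: plus_bcontfun.rep_eq add_mono)
  qed
  have A_scale: "c * t \<in> A (c *\<^sub>R v)" if t: "t \<in> A v" and c: "c > 0" for c t v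
  proof -
    obtain u where "(u, t) \<in> W" "\<And>y. apply_bcontfun v y \<le> apply_bcontfun u y"
      using t unfolding A_def by blast
    then show ?thesis
      unfolding A_def W_def using span_scale[of "(u, t)" "range b" c] c
      by (intro CollectI exI[of _ "c *\<^sub>R u"]) (auto simp: scaleR_bcontfun.rep_eq mult_left_mono)
  qed
  have A_0: "0 \<le> t" if "t \<in> A 0" for t
    using that W_pos by (auto simp: A_def zero_bcontfun.rep_eq)
  have bdd: "bdd_below (A v)" if v: "v \<in> V" for v
  proof -
    \<comment> \<open>An upper estimate s for -v bounds the estimates t for v from below, since s +
      t is an upper estimate for 0 and hence non-negative.\<close>
    obtain s where "s \<in> A (- v)"
      using A_ne[of "- v"] subspace_neg[OF V v] by blast
    then have "- s \<le> t" if "t \<in> A v" for t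
      using A_0 A_add[OF that, of s "- v"] by fastforce
    then show ?thesis
      by (rule bdd_belowI)
  qed
  have low: "p v \<le> t" if "v \<in> V" "t \<in> A v" for v t
    unfolding p_def using bdd that by (intro cInf_lower)
  have great: "c \<le> p v" if "v \<in> V" "\<And>t. t \<in> A v \<Longrightarrow> c \<le> t" for v c
    unfolding p_def using A_ne[OF that(1)] that(2) by (intro cInf_greatest) auto
  have "sublinear_on V p"
    unfolding sublinear_on_def
  proof (intro conjI ballI allI impI)
    fix v w assume vw: "v \<in> V" "w \<in> V"
    have "p (v + w) \<le> s + t" if "s \<in> A v" "t \<in> A w" for s t
      using vw by (intro low subspace_add[OF V] A_add that)
    then have "p (v + w) - t \<le> p v" if "t \<in> A w" for t
      using that vw by (intro great) (auto simp: algebra_simps)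
    then have "p (v + w) - p v \<le> p w"
      using vw by (intro great) (auto simp: algebra_simps)
    then show "p (v + w) \<le> p v + p w" by simp
  next
    fix v and c :: real assume v: "v \<in> V" "c > 0"
    have "p (c *\<^sub>R v) / c \<le> p v"
    proof (rule great[OF v(1)])
      fix t assume "t \<in> A v"
      then have "p (c *\<^sub>R v) \<le> c * t"
        using v by (intro low subspace_scale[OF V] A_scale)
      then show "p (c *\<^sub>R v) / c \<le> t"
        using v(2) by (simp add: field_simps)
    qed
    then show "p (c *\<^sub>R v) \<le> c * p v"
      using v(2) by (simp add: field_simps)
  qed
  from Hahn_Banach_sublinear[OF V this] obtain \<Phi> where \<Phi>:
    "\<And>v w. v \<in> V \<Longrightarrow> w \<in> V \<Longrightarrow> \<Phi> (v + w) = \<Phi> v + \<Phi> w"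
    "\<And>v c. v \<in> V \<Longrightarrow> \<Phi> (c *\<^sub>R v) = c * \<Phi> v" "\<And>v. v \<in> V \<Longrightarrow> \<Phi> v \<le> p v"
    by blast
  have BV: "Bcontfun g \<in> V" if "g \<in> Cc" for g
    using that by (simp add: V_def apply_Bcontfun_Cc)
  have le: "\<Phi> v \<le> t" if "v \<in> V" "t \<in> A v" for v t
    using \<Phi>(3)[OF that(1)] low[OF that] by linarith
  have B_scale: "Bcontfun (\<lambda>x. c * g x) = c *\<^sub>R Bcontfun g" if "g \<in> Cc" for c g
    using that by (intro bcontfun_eqI) (simp add: apply_Bcontfun_Cc Cc_scale scaleR_bcontfun.rep_eq)
  have "positive_functional (\<lambda>g. \<Phi> (Bcontfun g))"
  proof
    fix g h :: "'a \<Rightarrow> real" assume gh: "g \<in> Cc" "h \<in> Cc"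
    have "Bcontfun (\<lambda>x. g x + h x) = Bcontfun g + Bcontfun h"
      using gh by (intro bcontfun_eqI) (simp add: apply_Bcontfun_Cc Cc_add plus_bcontfun.rep_eq)
    then show "\<Phi> (Bcontfun (\<lambda>x. g x + h x)) = \<Phi> (Bcontfun g) + \<Phi> (Bcontfun h)"
      using \<Phi>(1) BV gh by simp
  next
    fix g :: "'a \<Rightarrow> real" and c assume g: "g \<in> Cc"
    then show "\<Phi> (Bcontfun (\<lambda>x. c * g x)) = c * \<Phi> (Bcontfun g)"
      unfolding B_scale[OF g] by (intro \<Phi>(2) BV)
  next
    fix g :: "'a \<Rightarrow> real" assume g: "g \<in> Cc" "\<And>x. 0 \<le> g x"
    \<comment> \<open>The zero combination dominates -g, so \<Phi> is at most 0 there: positivity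
      comes from domination by \<open>p\<close> alone.\<close>
    have "(0, 0) \<in> W"
      unfolding W_def using span_zero[of "range b"] by (simp add: zero_prod_def)
    then have "0 \<in> A ((- 1) *\<^sub>R Bcontfun g)"
      unfolding A_def using g
      by (intro CollectI exI[of _ 0]) (simp add: scaleR_bcontfun.rep_eq zero_bcontfun.rep_eq apply_Bcontfun_Cc)
    then have "\<Phi> ((- 1) *\<^sub>R Bcontfun g) \<le> 0"
      using g BV by (intro le subspace_scale[OF V])
    then show "0 \<le> \<Phi> (Bcontfun g)"
      using \<Phi>(2)[OF BV[OF g(1)], of "- 1"] by simp
  qed (rule locally_compact)
  moreover have "\<Phi> (Bcontfun (ltrans x f)) = 1" for x
  proof -
    let ?v = "Bcontfun (ltrans x f)"
    have v: "?v \<in> V"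
      using BV ltrans_Cc[OF f(1)] by blast
    have "(?v, 1) \<in> W"
      unfolding W_def using span_base[of "b x" "range b"] by (simp add: b_def)
    then have "1 \<in> A ?v"
      unfolding A_def by blast
    then have "\<Phi> ?v \<le> 1"
      by (rule le[OF v])
    \<comment> \<open>The negative of a translate also lies in the span, with value -1; domination
      by \<open>p\<close> at both signs forces the value 1.\<close>
    have "((- 1) *\<^sub>R ?v, - 1) \<in> W"
      unfolding W_def using span_scale[OF span_base[of "b x" "range b"], of "- 1"] by (simp add: b_def)
    then have "- 1 \<in> A ((- 1) *\<^sub>R ?v)"
      unfolding A_def by blast
    then have "\<Phi> ((- 1) *\<^sub>R ?v) \<le> - 1"
      using v by (intro le subspace_scale[OF V])
    then have "1 \<le> \<Phi> ?v"
      using \<Phi>(2)[OF v, of "- 1"] by simp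
    with \<open>\<Phi> ?v \<le> 1\<close> show ?thesis by simp
  qed
  ultimately show ?thesis
    by (intro exI[of _ "\<lambda>g. \<Phi> (Bcontfun g)"]) simp
qed

end

section \<open>The transform \<open>F\<close> and its bounds\<close>

locale weighted_hypergroup = hypergroup conv e chk + Phi: positive_functional \<Phi>
  for conv :: "('a::t2_space set \<Rightarrow> complex) \<Rightarrow> ('a set \<Rightarrow> complex) \<Rightarrow> ('a set \<Rightarrow> complex)"
    and e :: 'a and chk :: "'a \<Rightarrow> 'a" and \<Phi> :: "('a \<Rightarrow> real) \<Rightarrow> real" +
  fixes f :: "'a \<Rightarrow> real"
  assumes f_Cc: "f \<in> Cc" and \<Phi>_f: "\<Phi> (ltrans x f) = 1"
    and dominated: "g \<in> Cc \<Longrightarrow>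
      \<exists>(I :: 'a set) x c. finite I \<and> 0 \<le> c \<and> (\<forall>y. g y \<le> (\<Sum>i\<in>I. c * ltrans (x i) f y))"
begin

text \<open>The involution here cancels the one in \<open>ltrans\<close>: \<open>F h z\<close> is
  \<Phi> applied to \<open>avg z w h\<close> as a function of w. Thus \<Phi> acts on the second
  variable and the first stays free for left translation.\<close>

definition F :: "('a \<Rightarrow> real) \<Rightarrow> 'a \<Rightarrow> real" where
  "F h z = \<Phi> (ltrans (chk z) h)"

lemma ltrans_chk: "ltrans (chk z) h = (\<lambda>w. avg z w h)"
  by (simp add: ltrans_def chk_chk)

text \<open>For x in a compact neighbourhood of \<open>x0\<close> all translates share a carrier,
  and \<open>k\<close> is at least 1 on it. As \<open>k\<close> does not depend on the error, the
  estimate survives both \<Phi> and \<open>F\<close>.\<close>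

lemma ltrans_near:
  assumes h: "h \<in> Cc"
  shows "\<exists>k\<in>Cc. (\<forall>y. 0 \<le> k y) \<and> (\<forall>e>0. \<exists>N. open N \<and> x0 \<in> N \<and>
    (\<forall>x\<in>N. \<forall>y. \<bar>ltrans x h y - ltrans x0 h y\<bar> \<le> e * k y))"
proof -
  obtain V C where V: "open V" "compact C" "{x0} \<subseteq> V" "V \<subseteq> C"
    using compact_neighbourhood[OF locally_compact compact_sing[of x0]] by blast
  obtain L where L: "compact L" "\<And>x y. x \<in> C \<Longrightarrow> y \<notin> L \<Longrightarrow> ltrans x h y = 0"
    using ltrans_support[OF h V(2)] by blast
  obtain k where k: "k \<in> Cc" "\<And>y. 0 \<le> k y" "\<And>y. y \<in> L \<Longrightarrow> 1 \<le> k y"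
    using Phi.indicator_majorant[OF L(1)] by blast
  have "\<exists>N. open N \<and> x0 \<in> N \<and> (\<forall>x\<in>N. \<forall>y. \<bar>ltrans x h y - ltrans x0 h y\<bar> \<le> e * k y)" if e: "e > 0" for e
  proof -
    obtain N where N: "open N" "x0 \<in> N" "\<And>x y. x \<in> N \<Longrightarrow> y \<in> L \<Longrightarrow> \<bar>ltrans x h y - ltrans x0 h y\<bar> \<le> e"
      using uniform_near_compact[OF ltrans_continuous[OF Cc_Cb[OF h]] L(1) e, of x0] by blast
    have "\<bar>ltrans x h y - ltrans x0 h y\<bar> \<le> e * k y" if x: "x \<in> N \<inter> V" for x y
    proof (cases "y \<in> L")
      case True
      have "\<bar>ltrans x h y - ltrans x0 h y\<bar> \<le> e * 1"
        using N(3) x True by simp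
      also have "\<dots> \<le> e * k y"
        using k(3)[OF True] e by (intro mult_left_mono) auto
      finally show ?thesis .
    next
      case False
      have "x \<in> C" "x0 \<in> C"
        using V x by auto
      then show ?thesis
        using L(2) False k(2)[of y] e by simp
    qed
    then show ?thesis
      using N(1,2) V(1,3) by (intro exI[of _ "N \<inter> V"]) auto
  qed
  then show ?thesis
    using k by blast
qed

lemma \<Phi>_ltrans_continuous:
  assumes h: "h \<in> Cc" shows "continuous_on UNIV (\<lambda>x. \<Phi> (ltrans x h))"
proof (rule continuous_on_eventually_eps)
  fix x0 and e :: real assume e: "e > 0"
  obtain k where k: "k \<in> Cc" "\<And>y. 0 \<le> k y" and
    near: "\<And>e. e > 0 \<Longrightarrow> \<exists>N. open N \<and> x0 \<in> N \<and> (\<forall>x\<in>N. \<forall>y. \<bar>ltrans x h y - ltrans x0 h y\<bar> \<le> e * k y)"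
    using ltrans_near[OF h, of x0] by blast
  have k0: "0 \<le> \<Phi> k"
    using k by (rule Phi.nonneg)
  define d where "d = e / (\<Phi> k + 1)"
  have d: "d > 0" "d * \<Phi> k \<le> e"
    using e k0 by (auto simp: d_def field_simps)
  obtain N where N: "open N" "x0 \<in> N" "\<And>x y. x \<in> N \<Longrightarrow> \<bar>ltrans x h y - ltrans x0 h y\<bar> \<le> d * k y"
    using near[OF d(1)] by blast
  have "dist (\<Phi> (ltrans x h)) (\<Phi> (ltrans x0 h)) \<le> e" if "x \<in> N" for x
  proof -
    have "\<bar>\<Phi> (\<lambda>y. ltrans x h y - ltrans x0 h y)\<bar> \<le> \<Phi> (\<lambda>y. d * k y)"
      using N(3)[OF that] h k(1) by (intro Phi.abs_le Cc_diff Cc_scale ltrans_Cc)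
    then show ?thesis
      using h k(1) d(2) by (simp add: Phi.diff Phi.scale ltrans_Cc dist_real_def)
  qed
  then show "\<exists>N. open N \<and> x0 \<in> N \<and> (\<forall>x\<in>N. dist (\<Phi> (ltrans x h)) (\<Phi> (ltrans x0 h)) \<le> e)"
    using N(1,2) by blast
qed

lemma F_continuous: "h \<in> Cc \<Longrightarrow> continuous_on UNIV (F h)"
  unfolding F_def[abs_def]
  using continuous_on_compose2[OF \<Phi>_ltrans_continuous chk_continuous] by auto

lemma F_add: "g \<in> Cc \<Longrightarrow> h \<in> Cc \<Longrightarrow> F (\<lambda>x. g x + h x) z = F g z + F h z"
  unfolding F_def ltrans_chk
  using ltrans_Cc[of g "chk z"] ltrans_Cc[of h "chk z"]
  by (simp add: avg_add Cc_continuous Phi.add ltrans_chk)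

lemma F_scale: "g \<in> Cc \<Longrightarrow> F (\<lambda>x. c * g x) z = c * F g z"
  unfolding F_def ltrans_chk using ltrans_Cc[of g "chk z"]
  by (simp add: avg_scale Phi.scale ltrans_chk)

lemma F_diff: "g \<in> Cc \<Longrightarrow> h \<in> Cc \<Longrightarrow> F (\<lambda>x. g x - h x) z = F g z - F h z"
  using F_add[OF _ Cc_minus, of g h z] F_scale[of h "- 1" z] by simp

lemma F_nonneg: "g \<in> Cc \<Longrightarrow> (\<And>x. 0 \<le> g x) \<Longrightarrow> 0 \<le> F g z"
  unfolding F_def by (intro Phi.nonneg ltrans_Cc ltrans_nonneg)

lemma F_mono: "g \<in> Cc \<Longrightarrow> h \<in> Cc \<Longrightarrow> (\<And>x. g x \<le> h x) \<Longrightarrow> F g z \<le> F h z"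
  using F_nonneg[OF Cc_diff, of h g z] F_diff[of h g z] by simp

lemma F_sum: "(\<And>i. i \<in> I \<Longrightarrow> g i \<in> Cc) \<Longrightarrow> F (\<lambda>x. \<Sum>i\<in>I. g i x) z = (\<Sum>i\<in>I. F (g i) z)"
proof (induction I rule: infinite_finite_induct)
  case (insert i I)
  then show ?case
    by (simp add: F_add Cc_sum)
qed (use F_scale[OF Cc_zero, of 0] in auto)

lemma F_f: "F f z = 1"
  by (simp add: F_def \<Phi>_f)

text \<open>At y both sides come from \<Phi> applied, in a variable w, to the integral of
  \<open>h\<close> against the convolution of the point masses at chk x, y and w. On the left \<Phi>
  stands inside the average over the first two, on the right outside;
  \<open>commutes_integral\<close> and \<open>avg_assoc\<close> connect them.\<close>

lemma ltrans_F:
  assumes h: "h \<in> Cc" shows "ltrans x (F h) = F (ltrans x h)"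
proof
  fix y
  let ?S = "point_supp (chk x) y"
  \<comment> \<open>The integrand at z is the translate of \<open>h\<close> by \<open>chk z\<close>,
    so the common carrier is that of the translates by the image of the support under
    \<open>chk\<close>.\<close>
  have c: "compact (chk ` ?S)"
    using compact_point_supp chk_continuous
    by (intro compact_continuous_image) (auto intro: continuous_on_subset)
  obtain L where L: "compact L" "\<And>v w. v \<in> chk ` ?S \<Longrightarrow> w \<notin> L \<Longrightarrow> ltrans v h w = 0"
    using ltrans_support[OF h c] by metis
  have "(LINT z|point_conv (chk x) y. \<Phi> (\<lambda>w. avg z w h)) = \<Phi> (ltrans (chk y) (ltrans x h))"
  proof (rule Phi.commutes_integral[OF compact_probability_point_conv _ L(1)])
    show "continuous_on UNIV (\<lambda>(z, w). avg z w h)"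
      using h by (intro avg_continuous Cc_Cb)
    show "avg z w h = 0" if "z \<in> ?S" "w \<notin> L" for z w
      using L(2)[of "chk z" w] that by (simp add: ltrans_chk)
    show "(\<lambda>w. avg z w h) \<in> Cc" for z
      using ltrans_Cc[OF h, of "chk z"] by (simp add: ltrans_chk)
    show "ltrans (chk y) (ltrans x h) \<in> Cc"
      using h by (intro ltrans_Cc)
    show "ltrans (chk y) (ltrans x h) w = (LINT z|point_conv (chk x) y. avg z w h)" for w
      using avg_assoc[OF Cc_Cb[OF h], of "chk x" y w] by (simp add: ltrans_chk) (simp add: avg_def ltrans_def)
    show "continuous_on UNIV (\<lambda>z. \<Phi> (\<lambda>w. avg z w h))"
      using F_continuous[OF h] by (simp add: F_def[abs_def] ltrans_chk)
  qed
  then show "ltrans x (F h) y = F (ltrans x h) y"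
    by (simp add: ltrans_def[of x "\<lambda>z. \<Phi> (\<lambda>w. avg z w h)"] avg_def[of _ _ "\<lambda>z. \<Phi> (\<lambda>w. avg z w h)"]
      F_def[abs_def] ltrans_chk)
qed

text \<open>By \<open>ltrans_F\<close>, the transform of a translate of \<open>f\<close> is a
  translate of the constant 1, hence again 1. A combination of translates dominating
  \<open>g\<close> therefore bounds \<open>F g\<close> by its sum of coefficients.\<close>

lemma F_bounded:
  assumes "g \<in> Cc" shows "\<exists>B>0. \<forall>z. F g z \<le> B"
proof -
  obtain I :: "'a set" and x c where I: "finite I" "0 \<le> c" "\<And>y. g y \<le> (\<Sum>i\<in>I. c * ltrans (x i) f y)"
    using dominated[OF assms] by blast
  have one: "F (ltrans (x i) f) z = 1" for i z
    unfolding ltrans_F[OF f_Cc, symmetric] F_f[abs_def] by (simp add: ltrans_def avg_const F_f)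
  have "F g z \<le> c * card I" for z
  proof -
    have "F g z \<le> F (\<lambda>y. \<Sum>i\<in>I. c * ltrans (x i) f y) z"
      using I(3) by (intro F_mono assms Cc_sum Cc_scale ltrans_Cc f_Cc)
    also have "\<dots> = (\<Sum>i\<in>I. c * F (ltrans (x i) f) z)"
      by (simp add: F_sum F_scale Cc_scale ltrans_Cc f_Cc)
    finally show ?thesis
      by (simp add: one mult.commute)
  qed
  then show ?thesis
    using I(2) by (intro exI[of _ "c * card I + 1"]) (auto intro: add_nonneg_pos add_increasing2)
qed

lemma F_abs: "g \<in> Cc \<Longrightarrow> k \<in> Cc \<Longrightarrow> (\<And>x. \<bar>g x\<bar> \<le> k x) \<Longrightarrow> \<bar>F g z\<bar> \<le> F k z"
  using F_mono[of g k z] F_mono[OF Cc_minus, of g k z] F_scale[of g "- 1" z]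
  by (force simp: abs_le_iff)

lemma F_Cb:
  assumes "g \<in> Cc" shows "F g \<in> Cb"
proof -
  obtain B where B: "\<And>z. F (\<lambda>x. \<bar>g x\<bar>) z \<le> B"
    using F_bounded[OF Cc_abs[OF assms]] by blast
  show ?thesis
  proof (rule CbI[OF F_continuous[OF assms]])
    show "\<bar>F g z\<bar> \<le> B" for z
      using order_trans[OF F_abs[OF assms Cc_abs[OF assms]] B] by simp
  qed
qed

end

text \<open>Dividing by r moves the function into the unit ball, where the functional norm
  applies.\<close>

lemma dual_space_bound:
  assumes \<phi>: "\<phi> \<in> dual_space (bcontfun :: ('a::topological_space \<Rightarrow> complex) set)"
  shows "\<exists>C\<ge>0. \<forall>u\<in>bcontfun. \<forall>r>0. (\<forall>y. cmod (u y) \<le> r) \<longrightarrow> cmod (\<phi> u) \<le> C * r"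
proof -
  have lin: "clinear_on bcontfun \<phi>" and fin: "functional_norm bcontfun \<phi> < \<infinity>"
    using \<phi> by (auto simp: dual_space_def)
  obtain C where C: "functional_norm bcontfun \<phi> = ennreal C" "C \<ge> 0"
    using fin by (cases "functional_norm bcontfun \<phi>") auto
  have "cmod (\<phi> u) \<le> C * r" if u: "u \<in> bcontfun" and r: "r > 0" "\<And>y. cmod (u y) \<le> r" for u r
  proof -
    let ?w = "\<lambda>y. complex_of_real (1 / r) * u y"
    have cont: "continuous_on UNIV u"
      using u by (simp add: bcontfun_def)
    have w1: "cmod (?w y) \<le> 1" for y
      using r(1) r(2)[of y] by (simp add: norm_mult norm_divide field_simps)
    then have w: "?w \<in> bcontfun"
      using cont r(1) unfolding bcontfun_def bounded_iff by (auto intro!: continuous_intros)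
    have "sup_norm ?w \<le> 1"
      unfolding sup_norm_def using w1 by (intro cSUP_least) auto
    then have "ennreal (cmod (\<phi> ?w)) \<le> functional_norm bcontfun \<phi>"
      unfolding functional_norm_def using w by (intro SUP_upper) auto
    then have "cmod (\<phi> ?w) \<le> C"
      using C by simp
    moreover have "\<phi> ?w = complex_of_real (1 / r) * \<phi> u"
      using lin u unfolding clinear_on_def by blast
    then have "cmod (\<phi> ?w) = cmod (\<phi> u) / r"
      using r(1) by (simp only: norm_mult norm_of_real) simp
    ultimately show ?thesis
      using r(1) by (simp add: divide_le_eq)
  qed
  then show ?thesis
    using C(2) by blast
qed

section \<open>Applying the invariant mean\<close>

context weighted_hypergroup
begin

definition Fc :: "('a \<Rightarrow> real) \<Rightarrow> 'a \<Rightarrow> complex" where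
  "Fc h = (\<lambda>z. complex_of_real (F h z))"

lemma Fc_bcontfun: "h \<in> Cc \<Longrightarrow> Fc h \<in> bcontfun"
  unfolding Fc_def by (intro bcontfun_of_real F_Cb)

lemma conv_fun_Fc: "h \<in> Cc \<Longrightarrow> conv_fun conv chk (point_mass x) (Fc h) = Fc (ltrans x h)"
  unfolding Fc_def by (simp add: conv_fun_of_real F_Cb ltrans_F)

text \<open>Translates of \<open>F h\<close> are transforms of translates of \<open>h\<close>. Two
  nearby ones differ by at most d times \<open>F k\<close>, which is bounded, so they are uniformly
  close and every bounded functional sees the continuity.\<close>

lemma Fc_WUCB_r:
  assumes h: "h \<in> Cc" shows "Fc h \<in> WUCB_r conv chk"
proof -
  \<comment> \<open>The description of continuity into a weak topology asks for a non-empty family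
    of functionals.\<close>
  have "(\<lambda>_. 0) \<in> dual_space (bcontfun :: ('a \<Rightarrow> complex) set)"
    by (auto simp: dual_space_def clinear_on_def functional_norm_def intro!: le_less_trans[OF SUP_least[of _ _ 0]])
  then have ne: "dual_space (bcontfun :: ('a \<Rightarrow> complex) set) \<noteq> {}"
    by blast
  have "continuous_on UNIV (\<lambda>x. \<phi> (Fc (ltrans x h)))"
    if \<phi>: "\<phi> \<in> dual_space (bcontfun :: ('a \<Rightarrow> complex) set)" for \<phi>
  proof (rule continuous_on_eventually_eps)
    fix x0 and e :: real assume e: "e > 0"
    obtain C where C: "C \<ge> 0" "\<And>u r. u \<in> bcontfun \<Longrightarrow> r > 0 \<Longrightarrow> (\<And>y. cmod (u y) \<le> r) \<Longrightarrow> cmod (\<phi> u) \<le> C * r"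
      using dual_space_bound[OF \<phi>] by blast
    obtain k where k: "k \<in> Cc" "\<And>y. 0 \<le> k y" and
      near: "\<And>e. e > 0 \<Longrightarrow> \<exists>N. open N \<and> x0 \<in> N \<and> (\<forall>x\<in>N. \<forall>y. \<bar>ltrans x h y - ltrans x0 h y\<bar> \<le> e * k y)"
      using ltrans_near[OF h, of x0] by blast
    obtain B where B: "B > 0" "\<And>z. F k z \<le> B"
      using F_bounded[OF k(1)] by blast
    \<comment> \<open>B bounds \<open>F k\<close> and C bounds the functional, so the final error is
      C d B; the added 1 keeps the denominator positive.\<close>
    define d where "d = e / (C * B + 1)"
    have CB: "0 \<le> C * B"
      using C(1) B(1) by simp
    have d: "d > 0" "C * (d * B) \<le> e"
      using e CB by (auto simp: d_def field_simps)
    obtain N where N: "open N" "x0 \<in> N" "\<And>x y. x \<in> N \<Longrightarrow> \<bar>ltrans x h y - ltrans x0 h y\<bar> \<le> d * k y"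
      using near[OF d(1)] by blast
    have "dist (\<phi> (Fc (ltrans x h))) (\<phi> (Fc (ltrans x0 h))) \<le> e" if x: "x \<in> N" for x
    proof -
      let ?D = "\<lambda>y. ltrans x h y - ltrans x0 h y"
      have D: "?D \<in> Cc"
        using h by (intro Cc_diff ltrans_Cc)
      have "cmod (Fc ?D z) \<le> d * B" for z
      proof -
        have "\<bar>F ?D z\<bar> \<le> F (\<lambda>y. d * k y) z"
          using N(3)[OF x] k(1) by (intro F_abs D Cc_scale)
        also have "\<dots> \<le> d * B"
          using B(2)[of z] d(1) k(1) by (simp add: F_scale)
        finally show ?thesis
          by (simp add: Fc_def)
      qed
      then have "cmod (\<phi> (Fc ?D)) \<le> C * (d * B)"
        using d(1) B(1) by (intro C(2) Fc_bcontfun D) auto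
      moreover have "Fc (ltrans x h) = (\<lambda>z. Fc ?D z + Fc (ltrans x0 h) z)"
        using h by (auto simp: Fc_def F_diff ltrans_Cc)
      then have "\<phi> (Fc (ltrans x h)) = \<phi> (Fc ?D) + \<phi> (Fc (ltrans x0 h))"
        using \<phi> Fc_bcontfun[OF D] Fc_bcontfun[OF ltrans_Cc[OF h]]
        by (simp add: dual_space_def clinear_on_def)
      ultimately show ?thesis
        using d(2) by (simp add: dist_norm)
    qed
    then show "\<exists>N. open N \<and> x0 \<in> N \<and>
        (\<forall>x\<in>N. dist (\<phi> (Fc (ltrans x h))) (\<phi> (Fc (ltrans x0 h))) \<le> e)"
      using N(1,2) by blast
  qed
  then show ?thesis
    unfolding WUCB_r_def continuous_map_weak_topology[OF ne]
    using Fc_bcontfun h ltrans_Cc by (auto simp: conv_fun_Fc[OF h])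
qed

lemma ex_invariant_functional:
  assumes m: "left_invariant_mean conv chk m"
  shows "\<exists>\<Lambda>. positive_functional \<Lambda> \<and> \<Lambda> f = 1 \<and> (\<forall>h\<in>Cc. \<forall>x. \<Lambda> (ltrans x h) = \<Lambda> h)"
proof -
  define \<Lambda> where "\<Lambda> h = Re (m (Fc h))" for h
  have lin: "clinear_on (WUCB_r conv chk) m" and norm: "functional_norm (WUCB_r conv chk) m = 1"
    and one: "m (\<lambda>_. 1) = 1"
    and inv: "\<And>g x. g \<in> WUCB_r conv chk \<Longrightarrow> m (conv_fun conv chk (point_mass x) g) = m g"
    using m by (auto simp: left_invariant_mean_def)
  have add: "\<Lambda> (\<lambda>x. g x + h x) = \<Lambda> g + \<Lambda> h" if gh: "g \<in> Cc" "h \<in> Cc" for g h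
  proof -
    have "Fc (\<lambda>x. g x + h x) = (\<lambda>z. Fc g z + Fc h z)"
      using gh by (auto simp: Fc_def F_add)
    then show ?thesis
      using lin Fc_WUCB_r[OF gh(1)] Fc_WUCB_r[OF gh(2)] by (simp add: \<Lambda>_def clinear_on_def)
  qed
  have scale: "\<Lambda> (\<lambda>x. c * g x) = c * \<Lambda> g" if g: "g \<in> Cc" for c g
  proof -
    have "Fc (\<lambda>x. c * g x) = (\<lambda>z. complex_of_real c * Fc g z)"
      using g by (auto simp: Fc_def F_scale)
    then show ?thesis
      using lin Fc_WUCB_r[OF g] by (simp add: \<Lambda>_def clinear_on_def)
  qed
  have f1: "\<Lambda> f = 1"
    using one by (simp add: \<Lambda>_def Fc_def F_f)
  have nonneg: "0 \<le> \<Lambda> g" if g: "g \<in> Cc" "\<And>x. 0 \<le> g x" for g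
  proof -
    obtain B where B: "B > 0" "\<And>z. F g z \<le> B"
      using F_bounded[OF g(1)] by blast
    \<comment> \<open>As \<open>F f\<close> is 1, the transform of \<open>?d\<close> is 1 - F g / B,
      with values between 0 and 1. The norm of \<open>m\<close> then gives \<Lambda> ?d \<le> 1 =
      \<Lambda> f, which makes \<Lambda> g non-negative.\<close>
    let ?g = "\<lambda>x. (1 / B) * g x" and ?d = "\<lambda>x. f x - (1 / B) * g x"
    have C: "?g \<in> Cc" "?d \<in> Cc"
      using g(1) f_Cc by (auto intro!: Cc_diff Cc_scale simp del: times_divide_eq_left)
    have "cmod (Fc ?d z) \<le> 1" for z
    proof -
      have "F ?d z = 1 - F g z / B"
        unfolding F_diff[OF f_Cc C(1)] F_scale[OF g(1)] F_f by simp
      moreover have "0 \<le> F g z / B" "F g z / B \<le> 1"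
        using B(1) B(2)[of z] F_nonneg[OF g, of z] by simp_all
      ultimately show ?thesis
        unfolding Fc_def norm_of_real by linarith
    qed
    then have "sup_norm (Fc ?d) \<le> 1"
      unfolding sup_norm_def by (intro cSUP_least) auto
    then have "ennreal (cmod (m (Fc ?d))) \<le> functional_norm (WUCB_r conv chk) m"
      unfolding functional_norm_def using Fc_WUCB_r[OF C(2)] by (intro SUP_upper) auto
    then have "cmod (m (Fc ?d)) \<le> 1"
      unfolding norm by simp
    then have "\<Lambda> ?d \<le> 1"
      using complex_Re_le_cmod[of "m (Fc ?d)"] by (simp add: \<Lambda>_def)
    moreover have "\<Lambda> ?d + \<Lambda> ?g = 1"
      using add[OF C(2,1)] f1 by simp
    ultimately show ?thesis
      using scale[OF g(1), of "1 / B"] B(1) zero_le_divide_iff[of "\<Lambda> g" B] by auto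
  qed
  have "positive_functional \<Lambda>"
  proof
    show "0 \<le> \<Lambda> g" if "g \<in> Cc" "\<And>x. 0 \<le> g x" for g
      using that by (rule nonneg)
  qed (simp_all add: locally_compact add scale)
  moreover have "\<Lambda> (ltrans x h) = \<Lambda> h" if "h \<in> Cc" for h x
    using inv[OF Fc_WUCB_r[OF that], of x] by (simp add: \<Lambda>_def conv_fun_Fc that)
  ultimately show ?thesis
    using f1 by blast
qed

end

section \<open>From the invariant functional to the Haar measure\<close>

lemma integral_complex_parts:
  assumes "integrable M a" "integrable M b"
  shows "(LINT x|M. complex_of_real (a x) + \<i> * complex_of_real (b x))
    = complex_of_real (LINT x|M. a x) + \<i> * complex_of_real (LINT x|M. b x)"
  using assms by (subst Bochner_Integration.integral_add) (auto simp: complex_of_real_integrable_eq)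

context hypergroup
begin

lemma conv_fun_parts:
  assumes a: "a \<in> Cb" and b: "b \<in> Cb"
  shows "conv_fun conv chk (point_mass x) (\<lambda>z. complex_of_real (a z) + \<i> * complex_of_real (b z)) y
    = complex_of_real (ltrans x a y) + \<i> * complex_of_real (ltrans x b y)"
proof -
  have *: "cintegral (conv (point_mass (chk v)) (point_mass y)) (\<lambda>z. complex_of_real (a z) + \<i> * complex_of_real (b z))
    = complex_of_real (ltrans v a y) + \<i> * complex_of_real (ltrans v b y)" for v
    unfolding cintegral_conv ltrans_def avg_def
    by (rule integral_complex_parts; rule integrable_point_conv; rule Cb_continuous; rule a b)
  have "continuous_on UNIV (\<lambda>v. complex_of_real (ltrans v a y) + \<i> * complex_of_real (ltrans v b y))"
    using continuous_on_section(2)[OF ltrans_continuous] a b by (intro continuous_intros) auto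
  then show ?thesis
    unfolding conv_fun_def * by (rule cintegral_point_mass)
qed

text \<open>A null measure would integrate \<open>f\<close> to 0 instead of 1. Invariance for
  complex functions is reduced to \<Lambda> by real and imaginary parts, whose translates are again
  in \<open>Cc\<close>.\<close>

lemma left_haar_measure_riesz:
  assumes "positive_functional \<Lambda>" and f: "f \<in> Cc" "\<Lambda> f = 1"
    and inv: "\<And>h x. h \<in> Cc \<Longrightarrow> \<Lambda> (ltrans x h) = \<Lambda> h"
  shows "left_haar_measure conv chk (positive_functional.riesz_measure \<Lambda>)"
proof -
  interpret L: positive_functional \<Lambda> by fact
  let ?N = "L.riesz_measure"
  have "emeasure ?N UNIV \<noteq> 0"
  proof
    assume "emeasure ?N UNIV = 0"
    then have "UNIV \<in> null_sets ?N"
      by (intro null_setsI) (simp_all add: L.sets_riesz_measure)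
    then have "AE x in ?N. f x = 0"
      by (rule AE_I') auto
    then have "(LINT x|?N. f x) = 0"
      by (rule integral_eq_zero_AE)
    then show False
      using L.riesz_representation[OF f(1)] f(2) by simp
  qed
  moreover have "(LINT y|?N. conv_fun conv chk (point_mass x) g y) = (LINT y|?N. g y)"
    if g: "g \<in> cont_compact_supp" for g x
  proof -
    define a where "a z = Re (g z)" for z
    define b where "b z = Im (g z)" for z
    have geq: "g = (\<lambda>z. complex_of_real (a z) + \<i> * complex_of_real (b z))"
      by (auto simp: a_def b_def complex_eq)
    have ab: "a \<in> Cc" "b \<in> Cc"
      using cont_compact_supp_parts[OF g] by (simp_all add: a_def[abs_def] b_def[abs_def])
    have "(LINT y|?N. conv_fun conv chk (point_mass x) g y)
        = (LINT y|?N. complex_of_real (ltrans x a y) + \<i> * complex_of_real (ltrans x b y))"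
      unfolding geq using ab by (simp add: conv_fun_parts Cc_Cb)
    also have "\<dots> = complex_of_real (\<Lambda> (ltrans x a)) + \<i> * complex_of_real (\<Lambda> (ltrans x b))"
      using ab by (simp add: integral_complex_parts L.integrable_Cc L.riesz_representation ltrans_Cc)
    also have "\<dots> = complex_of_real (\<Lambda> a) + \<i> * complex_of_real (\<Lambda> b)"
      using inv ab by simp
    also have "\<dots> = (LINT y|?N. g y)"
      unfolding geq using ab by (simp add: integral_complex_parts L.integrable_Cc L.riesz_representation)
    finally show ?thesis .
  qed
  ultimately show ?thesis
    using L.regular_riesz_measure by (simp add: left_haar_measure_def)
qed

end

theorem theorem4p5:
  fixes conv :: "('a::t2_space set \<Rightarrow> complex) \<Rightarrow> ('a set \<Rightarrow> complex) \<Rightarrow> ('a set \<Rightarrow> complex)"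
    and e :: 'a and chk :: "'a \<Rightarrow> 'a"
  assumes "hypergroup conv e chk"
    and "\<exists>f\<in>cont_compact_supp. (\<forall>x. 0 \<le> f x) \<and> (\<exists>x. f x \<noteq> 0) \<and> positivity_property conv chk f"
    and "\<exists>m. left_invariant_mean conv chk m"
  shows "\<exists>N. left_haar_measure conv chk N"
proof -
  interpret hypergroup conv e chk by fact
  obtain fc a where fc: "fc \<in> cont_compact_supp" "\<And>x. 0 \<le> fc x" "fc a \<noteq> 0" "positivity_property conv chk fc"
    using assms(2) by blast
  \<comment> \<open>The order on the complex numbers makes \<open>fc\<close> real-valued, so nothing
    is lost by passing to the real part.\<close>
  define f where "f x = Re (fc x)" for x
  have fc_eq: "fc = (\<lambda>x. complex_of_real (f x))" and f0: "\<And>x. 0 \<le> f x"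
    using fc(2) by (auto simp: f_def less_eq_complex_def complex_eq_iff)
  have f: "f \<in> Cc"
    using cont_compact_supp_parts(1)[OF fc(1)] by (simp add: f_def[abs_def])
  have fa: "f a \<noteq> 0" and pos: "positivity_property conv chk (\<lambda>x. complex_of_real (f x))"
    using fc(3,4) unfolding fc_eq by auto
  obtain \<Phi> where \<Phi>: "positive_functional \<Phi>" "\<And>x. \<Phi> (ltrans x f) = 1"
    using ex_weight[OF f f0 fa pos] by blast
  interpret weighted_hypergroup conv e chk \<Phi> f
    using \<Phi> f ltrans_dominates[OF f f0 fa] hypergroup_axioms
    by (intro weighted_hypergroup.intro weighted_hypergroup_axioms.intro)
  obtain m where "left_invariant_mean conv chk m"
    using assms(3) by blast
  then obtain \<Lambda> where "positive_functional \<Lambda>" "\<Lambda> f = 1" "\<And>h x. h \<in> Cc \<Longrightarrow> \<Lambda> (ltrans x h) = \<Lambda> h"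
    using ex_invariant_functional by blast
  then have "left_haar_measure conv chk (positive_functional.riesz_measure \<Lambda>)"
    using f by (intro left_haar_measure_riesz)
  then show ?thesis ..
qed

end
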